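(* Let $\Gamma,\Delta$ be countable discrete groups and $\Gamma\curvearrowright\mathcal I$ an action on a countable set. Let $\Delta_{\mathcal I}^{\rm free}=\ast_{\mathcal I}\Delta$ with the coordinate-shift action of $\Gamma$, and let $\mathcal G_{\rm free}$, $\ell^\infty(\partial\mathcal G_{\rm free})$ and $C(\partial\mathcal G_{\rm free})$ be as defined in the context. Assume that $\Gamma$ is exact and that $\Gamma\curvearrowright\mathcal I$ has finite stabilizers and finitely many orbits. Then the left translation action $\Gamma\curvearrowright C(\partial\mathcal G_{\rm free})$ is amenable. In particular $\Gamma\curvearrowright\Delta_{\mathcal I}^{\rm free}$ is bi-exact relative to $\mathcal G_{\rm free}$, i.e. the left-right translation action $\Gamma\times\Gamma\curvearrowright\ell^\infty(\partial\mathcal G_{\rm free})$ is amenable.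
   Context: $\Delta_i$ denotes the $i$-th copy of $\Delta$ in the free product $\Delta_{\mathcal I}^{\rm free}$; $g\in\Gamma$ maps $\Delta_i$ identically onto $\Delta_{g\cdot i}$. $\Delta_{\mathcal I}^{\rm free}\rtimes\Gamma$ is the semidirect product, with elements $(y,g)$. Any nontrivial $y\in\Delta_{\mathcal I}^{\rm free}$ has a unique reduced decomposition $y=y_{i_1}\cdots y_{i_n}$, with $y_{i_k}\in\Delta_{i_k}$ nontrivial and $i_k\ne i_{k+1}$; put $\mathrm{supp}(y)=\{i_1,\dots,i_n\}\subset\mathcal I$. For finite subsets $E\subset\Delta$, $F\subset\mathcal I$ and $n\in\mathbb N$, $A(E,F,n)$ is the set of $(y,g)\in\Delta_{\mathcal I}^{\rm free}\rtimes\Gamma$ such that either $y=e$, or the decomposition $y=y_{i_1}\cdots y_{i_m}$ satisfies (a) $m\le n$; (b) $y_{i_k}\in E$ for all $k$ (identifying $\Delta_{i_k}$ with $\Delta$); (c) $\mathrm{supp}(y)\subset F\cup gF$. $\mathcal G_{\rm free}$ is the family of all subsets of $\Delta_{\mathcal I}^{\rm free}\rtimes\Gamma$ contained in some $A(E,F,n)$; it is closed under finite unions, inverses, and left and right translations. $c_0(\mathcal G_{\rm free})$ is the set of bounded functions $f$ on $\Delta_{\mathcal I}^{\rm free}\rtimes\Gamma$ such that $\{|f|>\varepsilon\}\in\mathcal G_{\rm free}$ for all $\varepsilon>0$. $C(\overline{\mathcal G_{\rm free}})=\{f\in\ell^\infty(\Delta_{\mathcal I}^{\rm free}\rtimes\Gamma)\mid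 f(x\,\cdot\,h)-f\in c_0(\mathcal G_{\rm free})\ \forall x\in\Delta_{\mathcal I}^{\rm free},\ h\in\Delta_{\mathcal I}^{\rm free}\rtimes\Gamma\}$ and $\ell^\infty(\overline{\mathcal G_{\rm free}})=\{f\in\ell^\infty(\Delta_{\mathcal I}^{\rm free}\rtimes\Gamma)\mid f-f(s\,\cdot\,),\,f-f(\,\cdot\,s)\in c_0(\mathcal G_{\rm free})\ \forall s\in\Delta_{\mathcal I}^{\rm free}\}$. Put $C(\partial\mathcal G_{\rm free})=C(\overline{\mathcal G_{\rm free}})/c_0(\mathcal G_{\rm free})$, with $\Gamma$-action induced by $f\mapsto f(g^{-1}\,\cdot\,)$, and $\ell^\infty(\partial\mathcal G_{\rm free})=\ell^\infty(\overline{\mathcal G_{\rm free}})/c_0(\mathcal G_{\rm free})$, with $\Gamma\times\Gamma$-action induced by $f\mapsto f(g^{-1}\,\cdot\,h)$. An action of a discrete group $G$ on a unital commutative C$^*$-algebra $C(Y)$ ($Y$ compact Hausdorff) is (topologically) amenable if there is a net of continuous maps $m_i\colon Y\to\mathrm{Prob}(G)$ with $\sup_{y\in Y}\|g\cdot m_i(y)-m_i(g\cdot y)\|_1\to0$ for every $g\in G$ (for exact $G$ this is equivalent to coincidence of the full and reduced crossed products $C(Y)\rtimes G$). *)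

theory Defs
  imports "HOL-Analysis.Analysis" "HOL-Algebra.Group_Action" "HOL-Algebra.Module"
    "HOL-Algebra.QuotRing"
begin

section \<open>Topologically amenable actions\<close>

definition l1_dist :: "('g, 'b) monoid_scheme \<Rightarrow> ('g \<Rightarrow> real) \<Rightarrow> ('g \<Rightarrow> real) \<Rightarrow> real" where
  "l1_dist G p q = (\<Sum>\<^sub>\<infinity>h\<in>carrier G. \<bar>p h - q h\<bar>)"

definition Prob :: "('g, 'b) monoid_scheme \<Rightarrow> ('g \<Rightarrow> real) set" where
  "Prob G = {p \<in> extensional (carrier G). (\<forall>h\<in>carrier G. 0 \<le> p h) \<and> (p has_sum 1) (carrier G)}"

definition Prob_topology :: "('g, 'b) monoid_scheme \<Rightarrow> ('g \<Rightarrow> real) topology" where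
  "Prob_topology G = Metric_space.mtopology (Prob G) (l1_dist G)"

definition translate_prob :: "('g, 'b) monoid_scheme \<Rightarrow> 'g \<Rightarrow> ('g \<Rightarrow> real) \<Rightarrow> ('g \<Rightarrow> real)" where
  "translate_prob G g p = (\<lambda>h\<in>carrier G. p (inv\<^bsub>G\<^esub> g \<otimes>\<^bsub>G\<^esub> h))"

text \<open>
  Amenability of an action \<open>\<sigma>\<close> of \<open>G\<close> on a compact Hausdorff space \<open>Y\<close>. The net of maps
  \<open>m\<^sub>i\<close> is given by its filter of tails \<open>F\<close>, a proper filter on the maps from \<open>Y\<close> to \<open>Prob G\<close>.
  The supremum is taken in \<^typ>\<open>ennreal\<close>, so that it is \<open>0\<close> when \<open>Y\<close> is empty.
\<close>

definition topologically_amenable ::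
    "('g, 'b) monoid_scheme \<Rightarrow> 'y topology \<Rightarrow> ('g \<Rightarrow> 'y \<Rightarrow> 'y) \<Rightarrow> bool" where
  "topologically_amenable G Y \<sigma> \<longleftrightarrow>
     (\<exists>F :: ('y \<Rightarrow> 'g \<Rightarrow> real) filter. F \<noteq> bot \<and>
        (\<forall>\<^sub>F m in F. continuous_map Y (Prob_topology G) m) \<and>
        (\<forall>g\<in>carrier G.
           ((\<lambda>m. SUP y\<in>topspace Y. ennreal (l1_dist G (translate_prob G g (m y)) (m (\<sigma> g y))))
              \<longlongrightarrow> 0) F))"


section \<open>Commutative unital algebras and their Gelfand spectra\<close>

definition complex_ring :: "complex ring" where
  "complex_ring = \<lparr>carrier = UNIV, mult = (*), one = 1, zero = 0, add = (+)\<rparr>"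

definition characters :: "(complex, 'a, 'm) module_scheme \<Rightarrow> ('a \<Rightarrow> complex) set" where
  "characters A = {\<psi> \<in> extensional (carrier A). \<psi> \<in> ring_hom A complex_ring \<and>
     (\<forall>c. \<forall>a\<in>carrier A. \<psi> (c \<odot>\<^bsub>A\<^esub> a) = c * \<psi> a)}"

text \<open>The weak-* topology on the characters. If \<open>A\<close> is a unital commutative C*-algebra, this is the
  compact Hausdorff space \<open>Y\<close> with \<open>A \<cong> C(Y)\<close>.\<close>

definition gelfand_spectrum :: "(complex, 'a, 'm) module_scheme \<Rightarrow> ('a \<Rightarrow> complex) topology" where
  "gelfand_spectrum A =
     subtopology (product_topology (\<lambda>_. euclidean) (carrier A)) (characters A)"

text \<open>The action on \<open>Y\<close> that corresponds to an action \<open>\<alpha>\<close> on \<open>C(Y)\<close>, that is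
  \<open>(\<alpha>\<^sub>g f)(y) = f (g\<^sup>-\<^sup>1 y)\<close>.\<close>

definition spectrum_action ::
    "('g, 'b) monoid_scheme \<Rightarrow> (complex, 'a, 'm) module_scheme \<Rightarrow> ('g \<Rightarrow> 'a \<Rightarrow> 'a) \<Rightarrow>
     'g \<Rightarrow> ('a \<Rightarrow> complex) \<Rightarrow> ('a \<Rightarrow> complex)" where
  "spectrum_action G A \<alpha> g \<psi> = (\<lambda>a\<in>carrier A. \<psi> (\<alpha> (inv\<^bsub>G\<^esub> g) a))"

definition amenable_action ::
    "('g, 'b) monoid_scheme \<Rightarrow> (complex, 'a, 'm) module_scheme \<Rightarrow> ('g \<Rightarrow> 'a \<Rightarrow> 'a) \<Rightarrow> bool" where
  "amenable_action G A \<alpha> \<longleftrightarrow>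
     topologically_amenable G (gelfand_spectrum A) (spectrum_action G A \<alpha>)"

definition bounded_functions :: "'x set \<Rightarrow> ('x \<Rightarrow> complex) set" where
  "bounded_functions X = {f \<in> extensional X. bounded (f ` X)}"

text \<open>A set \<open>S\<close> of functions on \<open>X\<close>, with the pointwise operations.\<close>

definition function_algebra ::
    "'x set \<Rightarrow> ('x \<Rightarrow> complex) set \<Rightarrow> (complex, 'x \<Rightarrow> complex) module" where
  "function_algebra X S =
     \<lparr>carrier = S,
      mult = (\<lambda>f f'. \<lambda>x\<in>X. f x * f' x),
      one = (\<lambda>x\<in>X. 1),
      zero = (\<lambda>x\<in>X. 0),
      add = (\<lambda>f f'. \<lambda>x\<in>X. f x + f' x),
      smult = (\<lambda>c f. \<lambda>x\<in>X. c * f x)\<rparr>"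

text \<open>The quotient ring \<^term>\<open>A Quot J\<close>, with the induced scalar multiplication.\<close>

definition quotient_algebra ::
    "(complex, 'a, 'm) module_scheme \<Rightarrow> 'a set \<Rightarrow> (complex, 'a set) module" where
  "quotient_algebra A J =
     \<lparr>carrier = carrier (A Quot J),
      mult = mult (A Quot J),
      one = one (A Quot J),
      zero = zero (A Quot J),
      add = add (A Quot J),
      smult = (\<lambda>c X. \<Union>a\<in>X. J +>\<^bsub>A\<^esub> (c \<odot>\<^bsub>A\<^esub> a))\<rparr>"

text \<open>If every \<open>\<alpha> g\<close> is additive and maps \<open>J\<close> onto \<open>J\<close>, then the image of the coset of \<open>a\<close>
  is the coset of \<open>\<alpha> g a\<close>.\<close>

definition quotient_action :: "('g \<Rightarrow> 'a \<Rightarrow> 'a) \<Rightarrow> 'g \<Rightarrow> 'a set \<Rightarrow> 'a set" where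
  "quotient_action \<alpha> g X = \<alpha> g ` X"

text \<open>Exactness of a discrete group as amenability at infinity: amenability of the left
  translation action on \<open>\<ell>\<^sup>\<infinity>(G) = C(\<beta>G)\<close>, which holds iff \<open>G\<close> acts amenably
  on some nonempty compact Hausdorff space.\<close>

definition exact_group :: "('g, 'b) monoid_scheme \<Rightarrow> bool" where
  "exact_group G \<longleftrightarrow>
     amenable_action G (function_algebra (carrier G) (bounded_functions (carrier G)))
       (\<lambda>g f. \<lambda>x\<in>carrier G. f (inv\<^bsub>G\<^esub> g \<otimes>\<^bsub>G\<^esub> x))"


section \<open>The semidirect product of the free product by the shift\<close>

text \<open>Elements of the free product of copies of \<open>D\<close> indexed by \<open>I\<close> are represented by their
  reduced decompositions; the letter \<open>(i, d)\<close> is the element \<open>d\<close> of the \<open>i\<close>-th copy.\<close>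

definition reduced_words :: "('d, 'b) monoid_scheme \<Rightarrow> 'i set \<Rightarrow> ('i \<times> 'd) list set" where
  "reduced_words D I =
     {w. set w \<subseteq> I \<times> (carrier D - {\<one>\<^bsub>D\<^esub>}) \<and> distinct_adj (map fst w)}"

fun letter_mult ::
    "('d, 'b) monoid_scheme \<Rightarrow> 'i \<times> 'd \<Rightarrow> ('i \<times> 'd) list \<Rightarrow> ('i \<times> 'd) list" where
  "letter_mult D (i, d) [] = [(i, d)]"
| "letter_mult D (i, d) ((j, e) # w) =
     (if i \<noteq> j then (i, d) # (j, e) # w
      else if d \<otimes>\<^bsub>D\<^esub> e = \<one>\<^bsub>D\<^esub> then w
      else (i, d \<otimes>\<^bsub>D\<^esub> e) # w)"

definition free_product :: "('d, 'b) monoid_scheme \<Rightarrow> 'i set \<Rightarrow> ('i \<times> 'd) list monoid" where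
  "free_product D I =
     \<lparr>carrier = reduced_words D I,
      mult = (\<lambda>u v. foldr (letter_mult D) u v),
      one = []\<rparr>"

definition supp :: "('i \<times> 'd) list \<Rightarrow> 'i set" where
  "supp y = fst ` set y"

definition shift :: "('g \<Rightarrow> 'i \<Rightarrow> 'i) \<Rightarrow> 'g \<Rightarrow> ('i \<times> 'd) list \<Rightarrow> ('i \<times> 'd) list" where
  "shift \<phi> g y = map (\<lambda>(i, d). (\<phi> g i, d)) y"

definition semidirect_product ::
    "('n, 'a) monoid_scheme \<Rightarrow> ('g, 'b) monoid_scheme \<Rightarrow> ('g \<Rightarrow> 'n \<Rightarrow> 'n) \<Rightarrow> ('n \<times> 'g) monoid" where
  "semidirect_product N G \<theta> =
     \<lparr>carrier = carrier N \<times> carrier G,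
      mult = (\<lambda>(x, g) (y, h). (x \<otimes>\<^bsub>N\<^esub> \<theta> g y, g \<otimes>\<^bsub>G\<^esub> h)),
      one = (\<one>\<^bsub>N\<^esub>, \<one>\<^bsub>G\<^esub>)\<rparr>"

type_synonym ('i, 'd, 'g) wreath = "('i \<times> 'd) list \<times> 'g"

definition free_wreath ::
    "('g, 'b) monoid_scheme \<Rightarrow> ('d, 'c) monoid_scheme \<Rightarrow> 'i set \<Rightarrow> ('g \<Rightarrow> 'i \<Rightarrow> 'i) \<Rightarrow>
     ('i, 'd, 'g) wreath monoid" where
  "free_wreath \<Gamma> \<Delta> I \<phi> = semidirect_product (free_product \<Delta> I) \<Gamma> (shift \<phi>)"

abbreviation emb_free :: "('g, 'b) monoid_scheme \<Rightarrow> ('i \<times> 'd) list \<Rightarrow> ('i, 'd, 'g) wreath" where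
  "emb_free \<Gamma> x \<equiv> (x, \<one>\<^bsub>\<Gamma>\<^esub>)"

abbreviation emb_group :: "'g \<Rightarrow> ('i, 'd, 'g) wreath" where
  "emb_group g \<equiv> ([], g)"


section \<open>The family of small sets and the boundary algebras\<close>

definition small_set ::
    "('g, 'b) monoid_scheme \<Rightarrow> ('d, 'c) monoid_scheme \<Rightarrow> 'i set \<Rightarrow> ('g \<Rightarrow> 'i \<Rightarrow> 'i) \<Rightarrow>
     'd set \<Rightarrow> 'i set \<Rightarrow> nat \<Rightarrow> ('i, 'd, 'g) wreath set" where
  "small_set \<Gamma> \<Delta> I \<phi> E F n =
     {(y, g) \<in> carrier (free_wreath \<Gamma> \<Delta> I \<phi>).
        y = [] \<or> (length y \<le> n \<and> snd ` set y \<subseteq> E \<and> supp y \<subseteq> F \<union> \<phi> g ` F)}"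

definition G_free ::
    "('g, 'b) monoid_scheme \<Rightarrow> ('d, 'c) monoid_scheme \<Rightarrow> 'i set \<Rightarrow> ('g \<Rightarrow> 'i \<Rightarrow> 'i) \<Rightarrow>
     ('i, 'd, 'g) wreath set set" where
  "G_free \<Gamma> \<Delta> I \<phi> =
     {S. \<exists>E F n. finite E \<and> E \<subseteq> carrier \<Delta> \<and> finite F \<and> F \<subseteq> I \<and> S \<subseteq> small_set \<Gamma> \<Delta> I \<phi> E F n}"

definition c0_free ::
    "('g, 'b) monoid_scheme \<Rightarrow> ('d, 'c) monoid_scheme \<Rightarrow> 'i set \<Rightarrow> ('g \<Rightarrow> 'i \<Rightarrow> 'i) \<Rightarrow>
     (('i, 'd, 'g) wreath \<Rightarrow> complex) set" where
  "c0_free \<Gamma> \<Delta> I \<phi> =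
     {f \<in> bounded_functions (carrier (free_wreath \<Gamma> \<Delta> I \<phi>)).
        \<forall>\<epsilon>>0. {z \<in> carrier (free_wreath \<Gamma> \<Delta> I \<phi>). cmod (f z) > \<epsilon>} \<in> G_free \<Gamma> \<Delta> I \<phi>}"

text \<open>\<open>C\<close> and \<open>\<ell>\<^sup>\<infinity>\<close> of the compactification determined by \<^const>\<open>G_free\<close>.\<close>

definition C_closure ::
    "('g, 'b) monoid_scheme \<Rightarrow> ('d, 'c) monoid_scheme \<Rightarrow> 'i set \<Rightarrow> ('g \<Rightarrow> 'i \<Rightarrow> 'i) \<Rightarrow>
     (('i, 'd, 'g) wreath \<Rightarrow> complex) set" where
  "C_closure \<Gamma> \<Delta> I \<phi> = (let K = free_wreath \<Gamma> \<Delta> I \<phi> in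
     {f \<in> bounded_functions (carrier K).
        \<forall>x\<in>carrier (free_product \<Delta> I). \<forall>h\<in>carrier K.
          (\<lambda>z\<in>carrier K. f (emb_free \<Gamma> x \<otimes>\<^bsub>K\<^esub> z \<otimes>\<^bsub>K\<^esub> h) - f z) \<in> c0_free \<Gamma> \<Delta> I \<phi>})"

definition linf_closure ::
    "('g, 'b) monoid_scheme \<Rightarrow> ('d, 'c) monoid_scheme \<Rightarrow> 'i set \<Rightarrow> ('g \<Rightarrow> 'i \<Rightarrow> 'i) \<Rightarrow>
     (('i, 'd, 'g) wreath \<Rightarrow> complex) set" where
  "linf_closure \<Gamma> \<Delta> I \<phi> = (let K = free_wreath \<Gamma> \<Delta> I \<phi> in
     {f \<in> bounded_functions (carrier K).
        \<forall>s\<in>carrier (free_product \<Delta> I).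
          (\<lambda>z\<in>carrier K. f z - f (emb_free \<Gamma> s \<otimes>\<^bsub>K\<^esub> z)) \<in> c0_free \<Gamma> \<Delta> I \<phi> \<and>
          (\<lambda>z\<in>carrier K. f z - f (z \<otimes>\<^bsub>K\<^esub> emb_free \<Gamma> s)) \<in> c0_free \<Gamma> \<Delta> I \<phi>})"

definition C_boundary ::
    "('g, 'b) monoid_scheme \<Rightarrow> ('d, 'c) monoid_scheme \<Rightarrow> 'i set \<Rightarrow> ('g \<Rightarrow> 'i \<Rightarrow> 'i) \<Rightarrow>
     (complex, (('i, 'd, 'g) wreath \<Rightarrow> complex) set) module" where
  "C_boundary \<Gamma> \<Delta> I \<phi> =
     quotient_algebra (function_algebra (carrier (free_wreath \<Gamma> \<Delta> I \<phi>)) (C_closure \<Gamma> \<Delta> I \<phi>))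
       (c0_free \<Gamma> \<Delta> I \<phi>)"

definition linf_boundary ::
    "('g, 'b) monoid_scheme \<Rightarrow> ('d, 'c) monoid_scheme \<Rightarrow> 'i set \<Rightarrow> ('g \<Rightarrow> 'i \<Rightarrow> 'i) \<Rightarrow>
     (complex, (('i, 'd, 'g) wreath \<Rightarrow> complex) set) module" where
  "linf_boundary \<Gamma> \<Delta> I \<phi> =
     quotient_algebra (function_algebra (carrier (free_wreath \<Gamma> \<Delta> I \<phi>)) (linf_closure \<Gamma> \<Delta> I \<phi>))
       (c0_free \<Gamma> \<Delta> I \<phi>)"

definition left_translation ::
    "('g, 'b) monoid_scheme \<Rightarrow> ('d, 'c) monoid_scheme \<Rightarrow> 'i set \<Rightarrow> ('g \<Rightarrow> 'i \<Rightarrow> 'i) \<Rightarrow>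
     'g \<Rightarrow> (('i, 'd, 'g) wreath \<Rightarrow> complex) \<Rightarrow> (('i, 'd, 'g) wreath \<Rightarrow> complex)" where
  "left_translation \<Gamma> \<Delta> I \<phi> g f = (let K = free_wreath \<Gamma> \<Delta> I \<phi> in
     (\<lambda>z\<in>carrier K. f (emb_group (inv\<^bsub>\<Gamma>\<^esub> g) \<otimes>\<^bsub>K\<^esub> z)))"

definition left_right_translation ::
    "('g, 'b) monoid_scheme \<Rightarrow> ('d, 'c) monoid_scheme \<Rightarrow> 'i set \<Rightarrow> ('g \<Rightarrow> 'i \<Rightarrow> 'i) \<Rightarrow>
     'g \<times> 'g \<Rightarrow> (('i, 'd, 'g) wreath \<Rightarrow> complex) \<Rightarrow> (('i, 'd, 'g) wreath \<Rightarrow> complex)" where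
  "left_right_translation \<Gamma> \<Delta> I \<phi> = (\<lambda>(g, h) f. let K = free_wreath \<Gamma> \<Delta> I \<phi> in
     (\<lambda>z\<in>carrier K. f (emb_group (inv\<^bsub>\<Gamma>\<^esub> g) \<otimes>\<^bsub>K\<^esub> z \<otimes>\<^bsub>K\<^esub> emb_group h)))"

definition biexact_relative_G_free ::
    "('g, 'b) monoid_scheme \<Rightarrow> ('d, 'c) monoid_scheme \<Rightarrow> 'i set \<Rightarrow> ('g \<Rightarrow> 'i \<Rightarrow> 'i) \<Rightarrow> bool" where
  "biexact_relative_G_free \<Gamma> \<Delta> I \<phi> \<longleftrightarrow>
     amenable_action (\<Gamma> \<times>\<times> \<Gamma>) (linf_boundary \<Gamma> \<Delta> I \<phi>)
       (quotient_action (left_right_translation \<Gamma> \<Delta> I \<phi>))"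

end

theory Submission
  imports Defs
begin

text \<open>
  Exactness gives maps from \<open>\<Gamma>\<close> to \<open>Prob \<Gamma>\<close> that are equivariant up to \<open>\<epsilon>\<close> on finitely many elements
  and, by compactness of the spectrum of \<open>\<ell>\<^sup>\<infinity>(\<Gamma>)\<close>, may be taken with values supported in one finite
  set; averaging over the finite stabilizers yields such a map \<open>\<mu>\<close> on \<open>I\<close>. Send \<open>(y, g)\<close>, with
  \<open>y\<close> a reduced word with letters \<open>(i, d)\<close>, to the average of the \<open>\<mu> i\<close>, or of
  \<open>\<mu> i \<otimes> \<mu> (g\<^sup>-\<^sup>1 i)\<close> for the left-right action, where the letter \<open>(i, d)\<close> has weight
  \<open>\<bar>d\<bar> + min \<bar>i\<bar> \<bar>g\<^sup>-\<^sup>1 i\<bar> + length y\<close> for proper length functions on \<open>\<Delta>\<close> and \<open>I\<close>.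
  The total weight \<open>W\<close> is bounded exactly on the sets in \<^const>\<open>G_free\<close>, and the translations that
  occur change the weights by a total of at most \<open>C (length y + 1)\<close>, which is \<open>o(W)\<close> because
  \<open>W \<ge> (length y)\<^sup>2\<close>. So the matrix coefficients of the average define functions on the boundary,
  and evaluating characters at them gives the almost equivariant maps. Estimates pass from
  functions to characters since finitely many values of a character are approximated by values
  at points outside any given small set.
\<close>

section \<open>Probability measures and amenability\<close>

lemma Prob_summable:
  assumes "p \<in> Prob G"
  shows "p summable_on carrier G"
  using assms by (auto simp: Prob_def summable_on_def)

lemma Prob_diff_summable:
  assumes "p \<in> Prob G" "q \<in> Prob G"
  shows "(\<lambda>h. \<bar>p h - q h\<bar>) summable_on carrier G"
proof -
  have "(\<lambda>h. p h + q h) summable_on carrier G"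
    using assms by (intro summable_on_add Prob_summable)
  then show ?thesis
    by (rule summable_on_comparison_test) (use assms in \<open>force simp: Prob_def abs_le_iff\<close>)+
qed

lemma sum_le_l1_dist:
  assumes "p \<in> Prob G" "q \<in> Prob G" "finite U" "U \<subseteq> carrier G"
  shows "(\<Sum>h\<in>U. \<bar>p h - q h\<bar>) \<le> l1_dist G p q"
  unfolding l1_dist_def
  by (rule finite_sum_le_infsum) (use assms Prob_diff_summable in auto)

lemma sum_Prob_le_1:
  assumes "p \<in> Prob G" "finite U" "U \<subseteq> carrier G"
  shows "sum p U \<le> 1"
proof -
  have "sum p U \<le> infsum p (carrier G)"
    by (rule finite_sum_le_infsum) (use assms Prob_summable in \<open>auto simp: Prob_def\<close>)
  also have "\<dots> = 1"
    using assms(1) by (auto simp: Prob_def infsumI)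
  finally show ?thesis .
qed

lemma l1_dist_finite_support:
  assumes "finite U" "U \<subseteq> carrier G"
    and "\<And>h. h \<in> carrier G - U \<Longrightarrow> p h = 0" "\<And>h. h \<in> carrier G - U \<Longrightarrow> q h = 0"
  shows "l1_dist G p q = (\<Sum>h\<in>U. \<bar>p h - q h\<bar>)"
proof -
  have "l1_dist G p q = (\<Sum>\<^sub>\<infinity>h\<in>U. \<bar>p h - q h\<bar>)"
    unfolding l1_dist_def by (rule infsum_cong_neutral) (use assms in auto)
  with assms(1) show ?thesis by simp
qed

lemma Prob_finite_support:
  assumes "finite U" "U \<subseteq> carrier G" and "p \<in> extensional (carrier G)"
    and "\<And>h. h \<in> carrier G - U \<Longrightarrow> p h = 0" "\<And>h. h \<in> U \<Longrightarrow> 0 \<le> p h"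
    and "sum p U = 1"
  shows "p \<in> Prob G"
proof -
  have "(p has_sum 1) U"
    using assms(1,6) has_sum_finite by metis
  then have "(p has_sum 1) (carrier G)"
    using has_sum_cong_neutral[of "carrier G" U p p 1] assms by auto
  then show ?thesis
    using assms by (auto simp: Prob_def) (metis DiffI order_refl)
qed

lemma Metric_space_Prob: "Metric_space (Prob G) (l1_dist G)"
proof
  show "0 \<le> l1_dist G p q" for p q
    unfolding l1_dist_def by (rule infsum_nonneg) simp
  show "l1_dist G p q = l1_dist G q p" for p q
    by (simp add: l1_dist_def abs_minus_commute)
  show "l1_dist G p q = 0 \<longleftrightarrow> p = q" if pq: "p \<in> Prob G" "q \<in> Prob G" for p q
  proof
    assume 0: "l1_dist G p q = 0"
    show "p = q"
    proof (rule extensionalityI[of _ "carrier G"])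
      fix h assume "h \<in> carrier G"
      then have "\<bar>p h - q h\<bar> \<le> l1_dist G p q"
        using sum_le_l1_dist[OF pq, of "{h}"] by simp
      with 0 show "p h = q h" by simp
    qed (use pq in \<open>auto simp: Prob_def\<close>)
  qed (simp add: l1_dist_def)
  show "l1_dist G p r \<le> l1_dist G p q + l1_dist G q r"
    if "p \<in> Prob G" "q \<in> Prob G" "r \<in> Prob G" for p q r
  proof -
    have "l1_dist G p r \<le> (\<Sum>\<^sub>\<infinity>h\<in>carrier G. \<bar>p h - q h\<bar> + \<bar>q h - r h\<bar>)"
      unfolding l1_dist_def
      by (rule infsum_mono) (use that in \<open>auto intro!: summable_on_add Prob_diff_summable\<close>)
    also have "\<dots> = l1_dist G p q + l1_dist G q r"
      unfolding l1_dist_def by (rule infsum_add) (use that in \<open>auto intro!: Prob_diff_summable\<close>)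
    finally show ?thesis .
  qed
qed

lemma translate_prob_Prob:
  fixes G (structure)
  assumes "group G" "g \<in> carrier G" "p \<in> Prob G"
  shows "translate_prob G g p \<in> Prob G"
proof -
  interpret group G by fact
  have "bij_betw (\<lambda>h. inv g \<otimes> h) (carrier G) (carrier G)"
    by (rule bij_betwI[where g = "\<lambda>h. g \<otimes> h"]) (use assms in \<open>auto simp flip: m_assoc\<close>)
  moreover have "(p has_sum 1) (carrier G)"
    using assms(3) by (simp add: Prob_def)
  ultimately have "((\<lambda>h. p (inv g \<otimes> h)) has_sum 1) (carrier G)"
    using has_sum_reindex_bij_betw[of "\<lambda>h. inv g \<otimes> h" "carrier G" "carrier G" p] by simp
  moreover have "(translate_prob G g p has_sum 1) (carrier G) \<longleftrightarrow>
      ((\<lambda>h. p (inv g \<otimes> h)) has_sum 1) (carrier G)"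
    by (rule has_sum_cong) (simp add: translate_prob_def)
  ultimately show ?thesis
    using assms by (auto simp: translate_prob_def Prob_def)
qed

lemma topologically_amenableI:
  assumes "countable (carrier G)"
    and ex: "\<And>Q \<epsilon>. finite Q \<Longrightarrow> Q \<subseteq> carrier G \<Longrightarrow> \<epsilon> > 0 \<Longrightarrow>
      \<exists>m. continuous_map Y (Prob_topology G) m \<and>
        (\<forall>g\<in>Q. \<forall>y\<in>topspace Y. l1_dist G (translate_prob G g (m y)) (m (\<sigma> g y)) \<le> \<epsilon>)"
  shows "topologically_amenable G Y \<sigma>"
proof -
  define Q where "Q n = {g \<in> carrier G. to_nat_on (carrier G) g \<le> n}" for n
  have "finite (Q n)" for n
    by (rule inj_on_finite[of "to_nat_on (carrier G)" _ "{..n}"])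
      (use inj_on_to_nat_on[OF assms(1)] in \<open>auto simp: Q_def inj_on_def\<close>)
  then have "\<exists>m. continuous_map Y (Prob_topology G) m \<and>
      (\<forall>g\<in>Q n. \<forall>y\<in>topspace Y. l1_dist G (translate_prob G g (m y)) (m (\<sigma> g y)) \<le> inverse (Suc n))" for n
    by (intro ex) (auto simp: Q_def)
  then obtain m where m: "continuous_map Y (Prob_topology G) (m n)"
    "\<And>g y. g \<in> Q n \<Longrightarrow> y \<in> topspace Y \<Longrightarrow>
       l1_dist G (translate_prob G g (m n y)) (m n (\<sigma> g y)) \<le> inverse (Suc n)" for n
    by metis
  let ?F = "filtermap m sequentially"
  have "((\<lambda>m. SUP y\<in>topspace Y. ennreal (l1_dist G (translate_prob G g (m y)) (m (\<sigma> g y))))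
          \<longlongrightarrow> 0) ?F" if g: "g \<in> carrier G" for g
    unfolding filterlim_filtermap
  proof (rule tendsto_sandwich[OF _ _ tendsto_const])
    have "(\<lambda>n. ennreal (inverse (Suc n))) \<longlonglongrightarrow> ennreal 0"
      by (intro tendsto_ennrealI LIMSEQ_inverse_real_of_nat)
    then show "(\<lambda>n. ennreal (inverse (Suc n))) \<longlonglongrightarrow> 0" by simp
    show "\<forall>\<^sub>F n in sequentially. (SUP y\<in>topspace Y.
        ennreal (l1_dist G (translate_prob G g (m n y)) (m n (\<sigma> g y)))) \<le> ennreal (inverse (Suc n))"
      using eventually_ge_at_top[of "to_nat_on (carrier G) g"]
    proof eventually_elim
      case (elim n)
      then have "g \<in> Q n" using g by (simp add: Q_def)
      then show ?case
        by (intro SUP_least ennreal_leI m)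
    qed
  qed simp
  moreover have "\<forall>\<^sub>F m in ?F. continuous_map Y (Prob_topology G) m"
    by (simp add: eventually_filtermap m)
  ultimately show ?thesis
    unfolding topologically_amenable_def
    by (intro exI[of _ ?F]) (auto simp: filtermap_bot_iff)
qed

lemma topologically_amenableD:
  assumes "topologically_amenable G Y \<sigma>" "finite Q" "Q \<subseteq> carrier G" "\<epsilon> > 0"
  obtains m where "continuous_map Y (Prob_topology G) m"
    "\<And>g y. g \<in> Q \<Longrightarrow> y \<in> topspace Y \<Longrightarrow> l1_dist G (translate_prob G g (m y)) (m (\<sigma> g y)) \<le> \<epsilon>"
proof -
  let ?d = "\<lambda>g m y. l1_dist G (translate_prob G g (m y)) (m (\<sigma> g y))"
  obtain F where F: "F \<noteq> bot" "\<forall>\<^sub>F m in F. continuous_map Y (Prob_topology G) m"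
    and lim: "\<And>g. g \<in> carrier G \<Longrightarrow> ((\<lambda>m. SUP y\<in>topspace Y. ennreal (?d g m y)) \<longlongrightarrow> 0) F"
    using assms(1) by (auto simp: topologically_amenable_def)
  have "\<forall>\<^sub>F m in F. \<forall>g\<in>Q. (SUP y\<in>topspace Y. ennreal (?d g m y)) < ennreal \<epsilon>"
    using assms lim by (intro eventually_ball_finite ballI order_tendstoD) auto
  then have "\<forall>\<^sub>F m in F. continuous_map Y (Prob_topology G) m \<and>
      (\<forall>g\<in>Q. (SUP y\<in>topspace Y. ennreal (?d g m y)) < ennreal \<epsilon>)"
    using F(2) by eventually_elim simp
  then obtain m where m: "continuous_map Y (Prob_topology G) m"
    "\<forall>g\<in>Q. (SUP y\<in>topspace Y. ennreal (?d g m y)) < ennreal \<epsilon>"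
    using eventually_happens F(1) by blast
  have "?d g m y \<le> \<epsilon>" if "g \<in> Q" "y \<in> topspace Y" for g y
  proof -
    have "ennreal (?d g m y) \<le> (SUP y\<in>topspace Y. ennreal (?d g m y))"
      using that by (intro SUP_upper)
    also have "\<dots> \<le> ennreal \<epsilon>"
      using m(2) that by (auto intro: less_imp_le)
    finally show ?thesis
      using assms(4) by (simp add: ennreal_le_iff)
  qed
  then show ?thesis using m(1) that by blast
qed

section \<open>Algebras of bounded functions and their characters\<close>

lemma bounded_functionsI:
  assumes "f \<in> extensional X" "\<And>x. x \<in> X \<Longrightarrow> cmod (f x) \<le> B"
  shows "f \<in> bounded_functions X"
  using assms by (auto simp: bounded_functions_def bounded_iff)

lemma bounded_functionsE:
  assumes "f \<in> bounded_functions X"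
  obtains B where "B > 0" "\<And>x. x \<in> X \<Longrightarrow> cmod (f x) \<le> B"
  using assms unfolding bounded_functions_def bounded_pos by auto

lemma restrict_bounded_functions [simp]:
  "f \<in> bounded_functions X \<Longrightarrow> restrict f X = f"
  by (simp add: bounded_functions_def extensional_restrict)

locale function_star_algebra =
  fixes X :: "'x set" and S :: "('x \<Rightarrow> complex) set"
  assumes subset_bounded: "S \<subseteq> bounded_functions X"
    and const: "(\<lambda>x\<in>X. c) \<in> S"
    and add: "f \<in> S \<Longrightarrow> f' \<in> S \<Longrightarrow> (\<lambda>x\<in>X. f x + f' x) \<in> S"
    and mult: "f \<in> S \<Longrightarrow> f' \<in> S \<Longrightarrow> (\<lambda>x\<in>X. f x * f' x) \<in> S"
    and cnj: "f \<in> S \<Longrightarrow> (\<lambda>x\<in>X. cnj (f x)) \<in> S"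
    and inverse: "f \<in> S \<Longrightarrow> \<delta> > 0 \<Longrightarrow> (\<And>x. x \<in> X \<Longrightarrow> \<delta> \<le> cmod (f x)) \<Longrightarrow>
      (\<lambda>x\<in>X. inverse (f x)) \<in> S"
begin

abbreviation alg where "alg \<equiv> function_algebra X S"

lemma restrict_eq: "f \<in> S \<Longrightarrow> (\<lambda>x\<in>X. f x) = f"
  using subset_bounded by auto

lemma smult: "f \<in> S \<Longrightarrow> (\<lambda>x\<in>X. c * f x) \<in> S"
  using mult[OF const] by (auto cong: restrict_cong)

lemma cring_alg: "cring alg"
proof (rule cringI)
  show "abelian_group alg"
  proof (rule abelian_groupI)
    fix f assume "f \<in> carrier alg"
    then have f: "f \<in> S" by (simp add: function_algebra_def)
    then have "(\<lambda>x\<in>X. - 1 * f x) \<in> S" by (rule smult)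
    moreover have "(\<lambda>x\<in>X. (\<lambda>x\<in>X. - 1 * f x) x + f x) = (\<lambda>x\<in>X. 0)"
      by (auto cong: restrict_cong)
    ultimately show "\<exists>g\<in>carrier alg. g \<oplus>\<^bsub>alg\<^esub> f = \<zero>\<^bsub>alg\<^esub>"
      by (intro bexI) (auto simp: function_algebra_def)
  qed (auto simp: function_algebra_def add const restrict_eq algebra_simps cong: restrict_cong)
  show "comm_monoid alg"
    by (rule comm_monoidI)
      (auto simp: function_algebra_def mult const restrict_eq algebra_simps cong: restrict_cong)
qed (auto simp: function_algebra_def algebra_simps cong: restrict_cong)

lemma
  assumes "\<omega> \<in> characters alg"
  shows character_const: "\<omega> (\<lambda>x\<in>X. c) = c"
    and character_add: "f \<in> S \<Longrightarrow> f' \<in> S \<Longrightarrow> \<omega> (\<lambda>x\<in>X. f x + f' x) = \<omega> f + \<omega> f'"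
    and character_mult: "f \<in> S \<Longrightarrow> f' \<in> S \<Longrightarrow> \<omega> (\<lambda>x\<in>X. f x * f' x) = \<omega> f * \<omega> f'"
proof -
  have one: "\<omega> (\<lambda>x\<in>X. 1) = 1"
    and sm: "\<And>c f. f \<in> S \<Longrightarrow> \<omega> (\<lambda>x\<in>X. c * f x) = c * \<omega> f"
    using assms
    by (auto simp: characters_def ring_hom_def function_algebra_def complex_ring_def)
  have "\<omega> (\<lambda>x\<in>X. c * (\<lambda>x\<in>X. 1) x) = c * \<omega> (\<lambda>x\<in>X. 1)"
    by (rule sm) (rule const)
  then show "\<omega> (\<lambda>x\<in>X. c) = c"
    by (simp add: one cong: restrict_cong)
  show "f \<in> S \<Longrightarrow> f' \<in> S \<Longrightarrow> \<omega> (\<lambda>x\<in>X. f x + f' x) = \<omega> f + \<omega> f'"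
    and "f \<in> S \<Longrightarrow> f' \<in> S \<Longrightarrow> \<omega> (\<lambda>x\<in>X. f x * f' x) = \<omega> f * \<omega> f'"
    using assms
    by (auto simp: characters_def ring_hom_def function_algebra_def complex_ring_def)
qed

text \<open>Otherwise the sum of the \<open>\<bar>f - \<omega> f\<bar>\<^sup>2\<close>, which \<open>\<omega>\<close> annihilates, would be invertible.\<close>

lemma character_approx:
  assumes \<omega>: "\<omega> \<in> characters alg" and A: "finite A" "A \<subseteq> S" and "\<eta> > 0"
  obtains x where "x \<in> X" "\<And>f. f \<in> A \<Longrightarrow> cmod (f x - \<omega> f) < \<eta>"
proof -
  define F where "F A = (\<lambda>x\<in>X. \<Sum>f\<in>A. (f x - \<omega> f) * cnj (f x - \<omega> f))" for A
  have F: "F A \<in> S \<and> \<omega> (F A) = 0"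
    using A
  proof (induction A rule: finite_induct)
    case empty
    have "F {} = (\<lambda>x\<in>X. 0)" by (simp add: F_def)
    then show ?case using const character_const[OF \<omega>] by metis
  next
    case (insert f A)
    then have f: "f \<in> S" and IH: "F A \<in> S" "\<omega> (F A) = 0" by auto
    define d where "d = (\<lambda>x\<in>X. f x + (\<lambda>x\<in>X. - \<omega> f) x)"
    have d: "d \<in> S" unfolding d_def by (intro add f const)
    have "\<omega> d = 0" unfolding d_def
      by (subst character_add[OF \<omega> f const]) (simp add: character_const[OF \<omega>])
    define p where "p = (\<lambda>x\<in>X. d x * (\<lambda>x\<in>X. cnj (d x)) x)"
    have p: "p \<in> S" "\<omega> p = 0"
      unfolding p_def using mult[OF d cnj[OF d]] character_mult[OF \<omega> d cnj[OF d]] \<open>\<omega> d = 0\<close> by auto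
    have "F (insert f A) = (\<lambda>x\<in>X. p x + F A x)"
      using insert(1,2) by (auto simp: F_def p_def d_def cong: restrict_cong)
    then show ?case
      using add[OF p(1) IH(1)] character_add[OF \<omega> p(1) IH(1)] p IH by (metis add_0)
  qed
  have "\<exists>x\<in>X. \<forall>f\<in>A. cmod (f x - \<omega> f) < \<eta>"
  proof (rule ccontr)
    assume neg: "\<not> ?thesis"
    have "\<eta>\<^sup>2 \<le> cmod (F A x)" if x: "x \<in> X" for x
    proof -
      obtain f where f: "f \<in> A" "\<eta> \<le> cmod (f x - \<omega> f)"
        using neg x by force
      then have "\<eta>\<^sup>2 \<le> (cmod (f x - \<omega> f))\<^sup>2"
        using \<open>\<eta> > 0\<close> by (intro power_mono) auto
      also have "\<dots> \<le> (\<Sum>f\<in>A. (cmod (f x - \<omega> f))\<^sup>2)"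
        using f(1) A(1) member_le_sum[of f A "\<lambda>f. (cmod (f x - \<omega> f))\<^sup>2"] by auto
      also have "\<dots> = cmod (complex_of_real (\<Sum>f\<in>A. (cmod (f x - \<omega> f))\<^sup>2))"
        by (subst norm_of_real) (simp add: sum_nonneg)
      also have "complex_of_real (\<Sum>f\<in>A. (cmod (f x - \<omega> f))\<^sup>2) = F A x"
        unfolding of_real_sum F_def using x by (simp add: complex_norm_square[symmetric] del: complex_cnj_diff)
      finally show ?thesis .
    qed
    then have inv: "(\<lambda>x\<in>X. inverse (F A x)) \<in> S" and nz: "\<And>x. x \<in> X \<Longrightarrow> F A x \<noteq> 0"
      using inverse[of "F A" "\<eta>\<^sup>2"] F \<open>\<eta> > 0\<close> by fastforce+
    have "1 = \<omega> (\<lambda>x\<in>X. 1)" by (simp add: character_const[OF \<omega>])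
    also have "(\<lambda>x\<in>X. 1) = (\<lambda>x\<in>X. F A x * (\<lambda>x\<in>X. inverse (F A x)) x)"
      using nz by (auto cong: restrict_cong)
    also have "\<omega> \<dots> = 0"
      using F by (subst character_mult[OF \<omega> _ inv]) auto
    finally show False by simp
  qed
  then show ?thesis using that by blast
qed

lemma character_bound:
  assumes \<omega>: "\<omega> \<in> characters alg" and f: "f \<in> S" and B: "\<And>x. x \<in> X \<Longrightarrow> cmod (f x) \<le> B"
  shows "cmod (\<omega> f) \<le> B"
proof (rule field_le_epsilon)
  fix e :: real assume "e > 0"
  then obtain x where "x \<in> X" "cmod (f x - \<omega> f) < e"
    using character_approx[OF \<omega>, of "{f}" e] f by auto
  then show "cmod (\<omega> f) \<le> B + e"
    using B[of x] norm_triangle_ineq2[of "\<omega> f" "f x"] by (simp add: norm_minus_commute)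
qed

lemma evaluation_character:
  assumes "x \<in> X"
  shows "(\<lambda>f\<in>S. f x) \<in> characters alg"
proof -
  let ?e = "\<lambda>f\<in>S. f x"
  have "?e (\<lambda>x\<in>X. f x + f' x) = ?e f + ?e f'" "?e (\<lambda>x\<in>X. f x * f' x) = ?e f * ?e f'"
    "?e (\<lambda>x\<in>X. c * f x) = c * ?e f" "?e (\<lambda>x\<in>X. 1) = 1" if "f \<in> S" "f' \<in> S" for f f' c
    using that assms add[of f f'] mult[of f f'] smult[of f c] const[of 1] by simp_all
  moreover have "(\<lambda>x\<in>X. 0) \<in> S" by (rule const)
  ultimately show ?thesis
    unfolding characters_def ring_hom_def function_algebra_def complex_ring_def by force
qed

lemma compact_gelfand_spectrum: "compact_space (gelfand_spectrum alg)"
proof -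
  have "\<exists>B. \<forall>x\<in>X. cmod (f x) \<le> B" if "f \<in> S" for f
  proof -
    from that have "f \<in> bounded_functions X" using subset_bounded by auto
    then show ?thesis by (rule bounded_functionsE) auto
  qed
  then obtain B where B: "\<And>f x. f \<in> S \<Longrightarrow> x \<in> X \<Longrightarrow> cmod (f x) \<le> B f" by metis
  let ?T = "product_topology (\<lambda>_. euclidean :: complex topology) S"
  have pr: "continuous_map ?T euclidean (\<lambda>\<psi>. \<psi> f)" if "f \<in> S" for f
    using that by (rule continuous_map_product_projection)
  have mu: "continuous_map ?T euclidean (\<lambda>\<psi>. a \<psi> * b \<psi>)"
    if "continuous_map ?T euclidean a" "continuous_map ?T euclidean b" for a b :: "_ \<Rightarrow> complex"
    using that unfolding continuous_map_atin by (auto intro: tendsto_mult)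
  have eq: "closedin ?T {\<psi> \<in> topspace ?T. a \<psi> = b \<psi>}"
    if "continuous_map ?T euclidean a" "continuous_map ?T euclidean b" for a b :: "_ \<Rightarrow> complex"
    by (rule closedin_continuous_maps_eq[OF _ that]) (simp add: Hausdorff_space_euclidean)
  have "characters alg = {\<psi> \<in> topspace ?T. \<psi> (\<lambda>x\<in>X. 1) = 1} \<inter>
     (\<Inter>f\<in>S. \<Inter>f'\<in>S. {\<psi> \<in> topspace ?T. \<psi> (\<lambda>x\<in>X. f x * f' x) = \<psi> f * \<psi> f'} \<inter>
        {\<psi> \<in> topspace ?T. \<psi> (\<lambda>x\<in>X. f x + f' x) = \<psi> f + \<psi> f'}) \<inter>
     (\<Inter>c. \<Inter>f\<in>S. {\<psi> \<in> topspace ?T. \<psi> (\<lambda>x\<in>X. c * f x) = c * \<psi> f})"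
    using const by (auto simp: characters_def ring_hom_def function_algebra_def complex_ring_def PiE_def)
  also have "closedin ?T \<dots>"
    by (intro closedin_Int closedin_INT eq pr const add mult smult continuous_map_const[THEN iffD2]
 mu continuous_map_add) (use const in auto)
  finally have cl: "closedin ?T (characters alg)" .
  have "compactin ?T (PiE S (\<lambda>f. cball 0 (B f)))"
    by (simp add: compactin_PiE)
  moreover have "characters alg \<subseteq> PiE S (\<lambda>f. cball 0 (B f))"
  proof
    fix \<psi> assume \<psi>: "\<psi> \<in> characters alg"
    then have "cmod (\<psi> f) \<le> B f" if "f \<in> S" for f
      using character_bound[OF \<psi> that] B that by blast
    moreover have "\<psi> \<in> extensional S"
      using \<psi> by (simp add: characters_def function_algebra_def)
    ultimately show "\<psi> \<in> PiE S (\<lambda>f. cball 0 (B f))" by (auto simp: PiE_def)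
  qed
  ultimately have "compactin ?T (characters alg)"
    using cl closed_compactin by blast
  then have "compact_space (subtopology ?T (characters alg))"
    by (rule compact_space_subtopology)
  then show ?thesis
    by (simp add: gelfand_spectrum_def function_algebra_def)
qed

end

lemma function_star_algebra_bounded: "function_star_algebra X (bounded_functions X)"
proof
  show "(\<lambda>x\<in>X. c) \<in> bounded_functions X" for c
    by (rule bounded_functionsI[of _ _ "cmod c"]) auto
next
  fix f f' assume "f \<in> bounded_functions X" "f' \<in> bounded_functions X"
  then obtain B B' where B: "\<And>x. x \<in> X \<Longrightarrow> cmod (f x) \<le> B" "\<And>x. x \<in> X \<Longrightarrow> cmod (f' x) \<le> B'"
    by (metis bounded_functionsE)
  show "(\<lambda>x\<in>X. f x + f' x) \<in> bounded_functions X"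
    by (rule bounded_functionsI[of _ _ "B + B'"]) (use B in \<open>auto intro: norm_triangle_mono\<close>)
  show "(\<lambda>x\<in>X. f x * f' x) \<in> bounded_functions X"
    by (rule bounded_functionsI[of _ _ "B * B'"])
      (use B in \<open>auto simp: norm_mult intro!: mult_mono intro: order_trans[OF norm_ge_zero]\<close>)
  show "(\<lambda>x\<in>X. cnj (f x)) \<in> bounded_functions X"
    by (rule bounded_functionsI[of _ _ B]) (use B in auto)
next
  fix f :: "'a \<Rightarrow> complex" and \<delta> :: real
  assume "\<delta> > 0" "\<And>x. x \<in> X \<Longrightarrow> \<delta> \<le> cmod (f x)"
  then show "(\<lambda>x\<in>X. inverse (f x)) \<in> bounded_functions X"
    by (intro bounded_functionsI[of _ _ "inverse \<delta>"])
      (auto simp: norm_inverse intro!: le_imp_inverse_le)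
qed auto

section \<open>Amenability of a boundary action\<close>

text \<open>A function \<open>W\<close> on \<open>X\<close> determines the ideal of those subsets of \<open>X\<close> on which it is bounded.\<close>

definition vanishing :: "'x set \<Rightarrow> ('x \<Rightarrow> real) \<Rightarrow> ('x \<Rightarrow> complex) set" where
  "vanishing X W =
     {f \<in> bounded_functions X. \<forall>\<epsilon>>0. \<exists>C. \<forall>x\<in>X. cmod (f x) > \<epsilon> \<longrightarrow> W x \<le> C}"

definition almost_invariant ::
    "'x set \<Rightarrow> ('x \<Rightarrow> real) \<Rightarrow> ('x \<Rightarrow> 'x) set \<Rightarrow> ('x \<Rightarrow> complex) set" where
  "almost_invariant X W P =
     {f \<in> bounded_functions X. \<forall>\<tau>\<in>P. (\<lambda>x\<in>X. f (\<tau> x) - f x) \<in> vanishing X W}"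

lemma vanishing_bounded: "f \<in> vanishing X W \<Longrightarrow> f \<in> bounded_functions X"
  by (simp add: vanishing_def)

lemma vanishingE:
  assumes "f \<in> vanishing X W" "\<epsilon> > 0"
  obtains C where "\<And>x. x \<in> X \<Longrightarrow> cmod (f x) > \<epsilon> \<Longrightarrow> W x \<le> C"
  using assms unfolding vanishing_def by blast

lemma vanishing_dominated:
  assumes f: "f \<in> vanishing X W" and g: "g \<in> extensional X"
    and B: "\<And>x. x \<in> X \<Longrightarrow> cmod (g x) \<le> B * cmod (f x)"
  shows "g \<in> vanishing X W"
proof -
  obtain K where K: "K > 0" "\<And>x. x \<in> X \<Longrightarrow> cmod (f x) \<le> K"
    using bounded_functionsE vanishing_bounded[OF f] by metis
  have B': "cmod (g x) \<le> (\<bar>B\<bar> + 1) * cmod (f x)" if "x \<in> X" for x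
    by (rule order_trans[OF B[OF that]]) (auto intro: mult_right_mono)
  have "cmod (g x) \<le> (\<bar>B\<bar> + 1) * K" if "x \<in> X" for x
    by (rule order_trans[OF B'[OF that]]) (use K(2)[OF that] in \<open>auto intro: mult_left_mono\<close>)
  then have "g \<in> bounded_functions X"
    by (rule bounded_functionsI[OF g])
  moreover have "\<exists>C. \<forall>x\<in>X. cmod (g x) > \<epsilon> \<longrightarrow> W x \<le> C" if "\<epsilon> > 0" for \<epsilon>
  proof -
    obtain C where C: "\<And>x. x \<in> X \<Longrightarrow> cmod (f x) > \<epsilon> / (\<bar>B\<bar> + 1) \<Longrightarrow> W x \<le> C"
      using vanishingE[OF f, of "\<epsilon> / (\<bar>B\<bar> + 1)"] \<open>\<epsilon> > 0\<close> by (metis add_nonneg_pos abs_ge_zero divide_pos_pos zero_less_one)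
    have "cmod (f x) > \<epsilon> / (\<bar>B\<bar> + 1)" if "x \<in> X" "cmod (g x) > \<epsilon>" for x
      using B'[OF that(1)] that(2) by (simp add: divide_less_eq mult.commute)
    with C show ?thesis by blast
  qed
  ultimately show ?thesis by (simp add: vanishing_def)
qed

lemma vanishing_add:
  assumes "f \<in> vanishing X W" "g \<in> vanishing X W"
  shows "(\<lambda>x\<in>X. f x + g x) \<in> vanishing X W"
proof -
  have "(\<lambda>x\<in>X. f x + g x) \<in> bounded_functions X"
    using assms by (intro function_star_algebra.add[OF function_star_algebra_bounded] vanishing_bounded)
  moreover have "\<exists>C. \<forall>x\<in>X. cmod (f x + g x) > \<epsilon> \<longrightarrow> W x \<le> C" if "\<epsilon> > 0" for \<epsilon>
  proof -
    from \<open>\<epsilon> > 0\<close> have "\<epsilon> / 2 > 0" by simp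
    from vanishingE[OF assms(1) this] vanishingE[OF assms(2) this]
    obtain C D where C: "\<And>x. x \<in> X \<Longrightarrow> cmod (f x) > \<epsilon> / 2 \<Longrightarrow> W x \<le> C"
      and D: "\<And>x. x \<in> X \<Longrightarrow> cmod (g x) > \<epsilon> / 2 \<Longrightarrow> W x \<le> D" by metis
    have "W x \<le> max C D" if "x \<in> X" "cmod (f x + g x) > \<epsilon>" for x
    proof -
      have "cmod (f x) > \<epsilon> / 2 \<or> cmod (g x) > \<epsilon> / 2"
        using norm_triangle_ineq[of "f x" "g x"] that(2) by linarith
      then show ?thesis using C[OF that(1)] D[OF that(1)] by auto
    qed
    then show ?thesis by blast
  qed
  ultimately show ?thesis by (auto simp: vanishing_def)
qed

lemma vanishing_mult:
  assumes "f \<in> vanishing X W" "g \<in> bounded_functions X"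
  shows "(\<lambda>x\<in>X. f x * g x) \<in> vanishing X W"
proof -
  obtain B where "\<And>x. x \<in> X \<Longrightarrow> cmod (g x) \<le> B"
    using assms(2) bounded_functionsE by metis
  then have "cmod (f x * g x) \<le> B * cmod (f x)" if "x \<in> X" for x
    using that by (simp add: norm_mult) (metis mult.commute mult_right_mono norm_ge_zero)
  then show ?thesis
    by (intro vanishing_dominated[OF assms(1), of _ B]) auto
qed

lemma vanishing_indicator: "(\<lambda>x\<in>X. if W x \<le> C then 1 else 0) \<in> vanishing X W"
proof -
  have "(\<lambda>x\<in>X. if W x \<le> C then 1 else 0) \<in> bounded_functions X"
    by (rule bounded_functionsI[of _ _ 1]) auto
  then show ?thesis
    by (auto simp: vanishing_def intro!: exI[of _ C])
qed

lemma vanishing_compose: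
  assumes f: "f \<in> vanishing X W" and \<tau>: "\<tau> \<in> X \<rightarrow> X"
    and proper: "\<And>C. \<exists>C'. \<forall>x\<in>X. W (\<tau> x) \<le> C \<longrightarrow> W x \<le> C'"
  shows "(\<lambda>x\<in>X. f (\<tau> x)) \<in> vanishing X W"
proof -
  obtain B where "\<And>x. x \<in> X \<Longrightarrow> cmod (f x) \<le> B"
    using vanishing_bounded[OF f] bounded_functionsE by metis
  with \<tau> have "(\<lambda>x\<in>X. f (\<tau> x)) \<in> bounded_functions X"
    by (intro bounded_functionsI[of _ _ B]) auto
  moreover have "\<exists>C. \<forall>x\<in>X. cmod (f (\<tau> x)) > \<epsilon> \<longrightarrow> W x \<le> C" if "\<epsilon> > 0" for \<epsilon>
  proof -
    obtain C where C: "\<And>x. x \<in> X \<Longrightarrow> cmod (f x) > \<epsilon> \<Longrightarrow> W x \<le> C"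
      using vanishingE[OF f \<open>\<epsilon> > 0\<close>] by metis
    obtain C' where "\<forall>x\<in>X. W (\<tau> x) \<le> C \<longrightarrow> W x \<le> C'" using proper by blast
    then show ?thesis using C \<tau> by (intro exI[of _ C']) auto
  qed
  ultimately show ?thesis by (auto simp: vanishing_def)
qed

locale boundary_setting =
  fixes X :: "'x set" and W :: "'x \<Rightarrow> real" and P :: "('x \<Rightarrow> 'x) set"
  assumes P_closed: "\<tau> \<in> P \<Longrightarrow> \<tau> \<in> X \<rightarrow> X"
    and P_proper: "\<tau> \<in> P \<Longrightarrow> \<exists>C'. \<forall>x\<in>X. W (\<tau> x) \<le> C \<longrightarrow> W x \<le> C'"
begin

abbreviation S where "S \<equiv> almost_invariant X W P"
abbreviation J where "J \<equiv> vanishing X W"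

lemma S_bounded: "f \<in> S \<Longrightarrow> f \<in> bounded_functions X"
  by (simp add: almost_invariant_def)

lemma S_diff: "f \<in> S \<Longrightarrow> \<tau> \<in> P \<Longrightarrow> (\<lambda>x\<in>X. f (\<tau> x) - f x) \<in> J"
  by (simp add: almost_invariant_def)

lemma P_mem: "\<tau> \<in> P \<Longrightarrow> x \<in> X \<Longrightarrow> \<tau> x \<in> X"
  using P_closed by auto

lemma bounded_compose:
  assumes "f \<in> bounded_functions X" "\<tau> \<in> X \<rightarrow> X"
  shows "(\<lambda>x\<in>X. f (\<tau> x)) \<in> bounded_functions X"
proof -
  obtain B where "\<And>x. x \<in> X \<Longrightarrow> cmod (f x) \<le> B"
    using assms(1) bounded_functionsE by metis
  with assms(2) show ?thesis
    by (intro bounded_functionsI[of _ _ B]) auto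
qed

lemma star_algebra: "function_star_algebra X S"
proof
  interpret b: function_star_algebra X "bounded_functions X"
    by (rule function_star_algebra_bounded)
  have zero: "(\<lambda>x\<in>X. 0) \<in> J"
    using b.const[of 0] by (auto simp: vanishing_def)
  show "S \<subseteq> bounded_functions X" using S_bounded by auto
  show "(\<lambda>x\<in>X. c) \<in> S" for c
    using b.const[of c] zero P_mem by (auto simp: almost_invariant_def cong: restrict_cong)
  fix f f' assume f: "f \<in> S" and f': "f' \<in> S"
  note bdd = S_bounded[OF f] S_bounded[OF f']
  have "(\<lambda>x\<in>X. (\<lambda>x\<in>X. f x + f' x) (\<tau> x) - (\<lambda>x\<in>X. f x + f' x) x) \<in> J" if "\<tau> \<in> P" for \<tau>
    using vanishing_add[OF S_diff[OF f that] S_diff[OF f' that]] P_mem[OF that]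
    by (auto simp: algebra_simps cong: restrict_cong)
  with bdd show "(\<lambda>x\<in>X. f x + f' x) \<in> S"
    by (auto simp: almost_invariant_def intro: b.add)
  have "(\<lambda>x\<in>X. (\<lambda>x\<in>X. f x * f' x) (\<tau> x) - (\<lambda>x\<in>X. f x * f' x) x) \<in> J" if "\<tau> \<in> P" for \<tau>
    using vanishing_add[OF vanishing_mult[OF S_diff[OF f that] bounded_compose[OF bdd(2) P_closed[OF that]]]
        vanishing_mult[OF S_diff[OF f' that] bdd(1)]] P_mem[OF that]
    by (auto simp: algebra_simps cong: restrict_cong)
  with bdd show "(\<lambda>x\<in>X. f x * f' x) \<in> S"
    by (auto simp: almost_invariant_def intro: b.mult)
  have "(\<lambda>x\<in>X. (\<lambda>x\<in>X. cnj (f x)) (\<tau> x) - (\<lambda>x\<in>X. cnj (f x)) x) \<in> J" if "\<tau> \<in> P" for \<tau>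
    by (rule vanishing_dominated[OF S_diff[OF f that], of _ 1])
      (use P_mem[OF that] in \<open>auto simp flip: complex_cnj_diff\<close>)
  with bdd show "(\<lambda>x\<in>X. cnj (f x)) \<in> S"
    by (auto simp: almost_invariant_def intro: b.cnj)
  fix \<delta> :: real assume \<delta>: "\<delta> > 0" "\<And>x. x \<in> X \<Longrightarrow> \<delta> \<le> cmod (f x)"
  have "(\<lambda>x\<in>X. (\<lambda>x\<in>X. inverse (f x)) (\<tau> x) - (\<lambda>x\<in>X. inverse (f x)) x) \<in> J" if "\<tau> \<in> P" for \<tau>
  proof (rule vanishing_dominated[OF S_diff[OF f that], of _ "inverse (\<delta> * \<delta>)"])
    fix x assume x: "x \<in> X"
    define a b where "a = f (\<tau> x)" and "b = f x"
    have ab: "\<delta> \<le> cmod a" "\<delta> \<le> cmod b" using \<delta>(2) x P_mem[OF that x] by (auto simp: a_def b_def)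
    then have nz: "a \<noteq> 0" "b \<noteq> 0" using \<delta>(1) by auto
    have "inverse a - inverse b = inverse (a * b) * (b - a)"
      using nz by (simp add: field_simps)
    then have "cmod (inverse a - inverse b) = inverse (cmod a * cmod b) * cmod (a - b)"
      by (simp add: norm_mult norm_inverse norm_minus_commute)
    also have "\<dots> \<le> inverse (\<delta> * \<delta>) * cmod (a - b)"
      using ab \<delta>(1) by (intro mult_right_mono le_imp_inverse_le mult_mono) auto
    finally show "cmod ((\<lambda>x\<in>X. (\<lambda>x\<in>X. inverse (f x)) (\<tau> x) - (\<lambda>x\<in>X. inverse (f x)) x) x)
        \<le> inverse (\<delta> * \<delta>) * cmod ((\<lambda>x\<in>X. f (\<tau> x) - f x) x)"
      using x P_mem[OF that x] by (simp add: a_def b_def)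
  qed auto
  with bdd b.inverse[OF bdd(1) \<delta>] show "(\<lambda>x\<in>X. inverse (f x)) \<in> S"
    by (auto simp: almost_invariant_def)
qed

sublocale function_star_algebra X S
  by (rule star_algebra)

lemma J_subset_S: "J \<subseteq> S"
proof
  fix f assume f: "f \<in> J"
  have "(\<lambda>x\<in>X. f (\<tau> x) - f x) \<in> J" if "\<tau> \<in> P" for \<tau>
  proof -
    have "(\<lambda>x\<in>X. (- 1) * f x) \<in> J"
      by (rule vanishing_dominated[OF f, of _ 1]) auto
    from vanishing_add[OF vanishing_compose[OF f P_closed[OF that] P_proper[OF that]] this]
    show ?thesis by (simp cong: restrict_cong)
  qed
  then show "f \<in> S" using vanishing_bounded[OF f] by (simp add: almost_invariant_def)
qed

lemma ideal_J: "ideal J alg"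
proof -
  interpret cring alg by (rule cring_alg)
  show ?thesis
  proof (rule idealI[OF ring_axioms])
    show "subgroup J (add_monoid alg)"
    proof (rule add.subgroupI)
      show "J \<subseteq> carrier alg" using J_subset_S by (simp add: function_algebra_def)
      have "(\<lambda>x\<in>X. 0) \<in> J"
        by (rule vanishing_dominated[OF vanishing_indicator[where C = 0 and X = X and W = W], of _ 0]) auto
      then show "J \<noteq> {}" by auto
    next
      fix f assume f: "f \<in> J"
      have g: "(\<lambda>x\<in>X. (- 1) * f x) \<in> J"
        by (rule vanishing_dominated[OF f, of _ 1]) auto
      have "\<ominus>\<^bsub>alg\<^esub> f = (\<lambda>x\<in>X. (- 1) * f x)"
        by (rule minus_equality)
          (use f g J_subset_S in \<open>auto simp: function_algebra_def cong: restrict_cong\<close>)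
      with g show "\<ominus>\<^bsub>alg\<^esub> f \<in> J" by simp
    next
      fix f g assume "f \<in> J" "g \<in> J"
      then show "f \<oplus>\<^bsub>alg\<^esub> g \<in> J"
        using vanishing_add by (simp add: function_algebra_def)
    qed
  next
    fix f g assume "f \<in> J" "g \<in> carrier alg"
    then show "g \<otimes>\<^bsub>alg\<^esub> f \<in> J" "f \<otimes>\<^bsub>alg\<^esub> g \<in> J"
      using vanishing_mult[of f X W g] S_bounded
      by (auto simp: function_algebra_def mult.commute cong: restrict_cong)
  qed
qed

abbreviation quot where "quot \<equiv> quotient_algebra alg J"
abbreviation coset where "coset f \<equiv> J +>\<^bsub>alg\<^esub> f"

lemma coset_eq: "coset f = {\<lambda>x\<in>X. j x + f x | j. j \<in> J}"
  by (auto simp: a_r_coset_def r_coset_def function_algebra_def)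

lemma coset_carrier: "f \<in> S \<Longrightarrow> coset f \<in> carrier quot"
  by (auto simp: quotient_algebra_def FactRing_def A_RCOSETS_def RCOSETS_def a_r_coset_def function_algebra_def)

lemma character_lift:
  assumes "\<psi> \<in> characters quot"
  shows "(\<lambda>f\<in>S. \<psi> (coset f)) \<in> characters alg"
    and "f \<in> J \<Longrightarrow> \<psi> (coset f) = 0"
proof -
  interpret ideal J alg by (rule ideal_J)
  have car: "carrier alg = S" by (simp add: function_algebra_def)
  have hom: "\<psi> \<in> ring_hom (alg Quot J) complex_ring"
    using assms unfolding characters_def ring_hom_def quotient_algebra_def by auto
  have comp: "(\<lambda>f. \<psi> (coset f)) \<in> ring_hom alg complex_ring"
    using ring_hom_trans[OF rcos_ring_hom hom] by (simp add: o_def)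
  have sm: "\<psi> (coset (\<lambda>x\<in>X. c * f x)) = c * \<psi> (coset f)" if f: "f \<in> S" for c f
  proof -
    have indep: "coset (c \<odot>\<^bsub>alg\<^esub> a) = coset (c \<odot>\<^bsub>alg\<^esub> f)" if a: "a \<in> coset f" for a
    proof -
      obtain j where j: "j \<in> J" "a = (\<lambda>x\<in>X. j x + f x)"
        using a by (auto simp: coset_eq)
      have "(\<lambda>x\<in>X. c * j x) \<in> J"
        by (rule vanishing_dominated[OF j(1), of _ "cmod c"]) (auto simp: norm_mult)
      then have "c \<odot>\<^bsub>alg\<^esub> a \<in> coset (c \<odot>\<^bsub>alg\<^esub> f)"
        unfolding coset_eq j(2)
        by (auto simp: function_algebra_def algebra_simps intro!: exI[of _ "\<lambda>x\<in>X. c * j x"] cong: restrict_cong)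
      moreover have "c \<odot>\<^bsub>alg\<^esub> f \<in> carrier alg"
        using smult[OF f, of c] by (simp add: function_algebra_def)
      ultimately show ?thesis
        using a_repr_independence a_subgroup by metis
    qed
    have "f \<in> coset f"
      using a_rcos_self[of f] f car by simp
    have "c \<odot>\<^bsub>quot\<^esub> (coset f) = (\<Union>a\<in>coset f. coset (c \<odot>\<^bsub>alg\<^esub> a))"
      by (simp add: quotient_algebra_def)
    also have "\<dots> = (\<Union>a\<in>coset f. coset (c \<odot>\<^bsub>alg\<^esub> f))"
      by (rule SUP_cong[OF refl indep])
    also have "\<dots> = coset (c \<odot>\<^bsub>alg\<^esub> f)"
      using \<open>f \<in> coset f\<close> by (intro UN_constant_eq) auto
    finally have "c \<odot>\<^bsub>quot\<^esub> (coset f) = coset (c \<odot>\<^bsub>alg\<^esub> f)" .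
    moreover have "\<psi> (c \<odot>\<^bsub>quot\<^esub> (coset f)) = c * \<psi> (coset f)"
      using assms coset_carrier[OF f] unfolding characters_def by blast
    ultimately show ?thesis by (simp add: function_algebra_def)
  qed
  have "\<psi> (coset (\<lambda>x\<in>X. f x * f' x)) = \<psi> (coset f) * \<psi> (coset f')"
    "\<psi> (coset (\<lambda>x\<in>X. f x + f' x)) = \<psi> (coset f) + \<psi> (coset f')" if "f \<in> S" "f' \<in> S" for f f'
    using ring_hom_mult[OF comp, of f f'] ring_hom_add[OF comp, of f f'] that
    by (simp_all add: function_algebra_def complex_ring_def)
  moreover have "\<psi> (coset (\<lambda>x\<in>X. 1)) = 1"
    using ring_hom_one[OF comp] by (simp add: function_algebra_def complex_ring_def)
  ultimately show "(\<lambda>f\<in>S. \<psi> (coset f)) \<in> characters alg"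
    unfolding characters_def ring_hom_def
    using sm const add mult smult by (simp add: function_algebra_def complex_ring_def)
  assume f: "f \<in> J"
  have z: "\<zero>\<^bsub>alg\<^esub> \<in> carrier alg" by simp
  have "f \<in> carrier alg" using f J_subset_S car by auto
  then have "coset f = J" using a_coset_join2[OF _ a_subgroup f] by blast
  also have "J = coset \<zero>\<^bsub>alg\<^esub>" using a_coset_add_zero[OF a_subset] by simp
  finally have "coset f = coset \<zero>\<^bsub>alg\<^esub>" .
  moreover have "\<psi> (coset \<zero>\<^bsub>alg\<^esub>) = 0"
    using ring_hom_add[OF comp z(1) z(1)] by (simp add: complex_ring_def)
  ultimately show "\<psi> (coset f) = 0" by simp
qed

lemma quotient_character_approx:
  assumes \<psi>: "\<psi> \<in> characters quot" and A: "finite A" "A \<subseteq> S" and "\<eta> > 0"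
  obtains x where "x \<in> X" "W x > C" "\<And>f. f \<in> A \<Longrightarrow> cmod (f x - \<psi> (coset f)) < \<eta>"
proof -
  let ?i = "\<lambda>x\<in>X. if W x \<le> C then 1 else 0 :: complex"
  have i: "?i \<in> J" by (rule vanishing_indicator)
  then have iS: "?i \<in> S" using J_subset_S by auto
  obtain x where x: "x \<in> X"
    "\<And>f. f \<in> insert ?i A \<Longrightarrow> cmod (f x - (\<lambda>f\<in>S. \<psi> (coset f)) f) < min \<eta> 1"
    using character_approx[OF character_lift(1)[OF \<psi>], of "insert ?i A" "min \<eta> 1"] A iS \<open>\<eta> > 0\<close>
    by auto
  show ?thesis
  proof
    show "x \<in> X" by fact
    show "W x > C"
      using x(2)[of ?i] x(1) iS character_lift(2)[OF \<psi> i] by (auto split: if_splits)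
    show "cmod (f x - \<psi> (coset f)) < \<eta>" if "f \<in> A" for f
      using x(2)[of f] that A(2) by auto
  qed
qed

lemma S_compose:
  assumes f: "f \<in> S" and \<rho>: "\<rho> \<in> X \<rightarrow> X"
    and proper: "\<And>C. \<exists>C'. \<forall>x\<in>X. W (\<rho> x) \<le> C \<longrightarrow> W x \<le> C'"
    and comm: "\<And>\<tau>. \<tau> \<in> P \<Longrightarrow> \<exists>\<tau>'\<in>P. \<forall>x\<in>X. \<rho> (\<tau> x) = \<tau>' (\<rho> x)"
  shows "(\<lambda>x\<in>X. f (\<rho> x)) \<in> S"
proof -
  have "(\<lambda>x\<in>X. (\<lambda>x\<in>X. f (\<rho> x)) (\<tau> x) - (\<lambda>x\<in>X. f (\<rho> x)) x) \<in> J" if \<tau>: "\<tau> \<in> P" for \<tau>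
  proof -
    obtain \<tau>' where \<tau>': "\<tau>' \<in> P" "\<And>x. x \<in> X \<Longrightarrow> \<rho> (\<tau> x) = \<tau>' (\<rho> x)"
      using comm[OF \<tau>] by blast
    have "(\<lambda>x\<in>X. (\<lambda>x\<in>X. f (\<tau>' x) - f x) (\<rho> x)) \<in> J"
      by (rule vanishing_compose[OF S_diff[OF f \<tau>'(1)] \<rho> proper])
    also have "(\<lambda>x\<in>X. (\<lambda>x\<in>X. f (\<tau>' x) - f x) (\<rho> x)) =
        (\<lambda>x\<in>X. (\<lambda>x\<in>X. f (\<rho> x)) (\<tau> x) - (\<lambda>x\<in>X. f (\<rho> x)) x)"
      using \<tau>'(2) \<rho> P_mem[OF \<tau>] by (intro restrict_ext) auto
    finally show ?thesis .
  qed
  then show ?thesis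
    using bounded_compose[OF S_bounded[OF f] \<rho>] by (simp add: almost_invariant_def)
qed

theorem amenable_boundary:
  fixes G (structure)
  assumes "group G" "countable (carrier G)"
    and \<rho>_closed: "\<And>g. g \<in> carrier G \<Longrightarrow> \<rho> g \<in> X \<rightarrow> X"
    and \<rho>_inv: "\<And>g x. g \<in> carrier G \<Longrightarrow> x \<in> X \<Longrightarrow> \<rho> (inv g) (\<rho> g x) = x"
    and \<rho>_proper: "\<And>g C. g \<in> carrier G \<Longrightarrow> \<exists>C'. \<forall>x\<in>X. W (\<rho> g x) \<le> C \<longrightarrow> W x \<le> C'"
    and \<rho>_P: "\<And>g \<tau>. g \<in> carrier G \<Longrightarrow> \<tau> \<in> P \<Longrightarrow> \<exists>\<tau>'\<in>P. \<forall>x\<in>X. \<rho> g (\<tau> x) = \<tau>' (\<rho> g x)"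
    and \<alpha>: "\<And>g f. g \<in> carrier G \<Longrightarrow> f \<in> bounded_functions X \<Longrightarrow> \<alpha> (inv g) f = (\<lambda>x\<in>X. f (\<rho> g x))"
    and ex: "\<And>Q \<epsilon>. finite Q \<Longrightarrow> Q \<subseteq> carrier G \<Longrightarrow> \<epsilon> > 0 \<Longrightarrow>
      \<exists>M T. finite T \<and> T \<subseteq> carrier G \<and> (\<forall>t\<in>T. \<forall>x\<in>X. 0 \<le> M t x) \<and>
        (\<forall>t\<in>carrier G - T. \<forall>x\<in>X. M t x = 0) \<and>
        (\<forall>t\<in>T. (\<lambda>x\<in>X. complex_of_real (M t x)) \<in> S) \<and>
        (\<exists>C. \<forall>x\<in>X. W x > C \<longrightarrow> (\<Sum>t\<in>T. M t x) = 1) \<and>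
        (\<forall>g\<in>Q. \<exists>C. \<forall>x\<in>X. W x > C \<longrightarrow> (\<forall>U. finite U \<longrightarrow> U \<subseteq> carrier G \<longrightarrow>
           (\<Sum>t\<in>U. \<bar>M (inv g \<otimes> t) x - M t (\<rho> g x)\<bar>) \<le> \<epsilon>))"
  shows "amenable_action G quot (quotient_action \<alpha>)"
  unfolding amenable_action_def
proof (rule topologically_amenableI)
  interpret group G by fact
  fix Q and \<epsilon> :: real
  assume Q: "finite Q" "Q \<subseteq> carrier G" and "\<epsilon> > 0"
  then obtain M T C where M_nonneg: "\<forall>t\<in>T. \<forall>x\<in>X. 0 \<le> M t x"
    and T: "finite T" "T \<subseteq> carrier G"
    and M_0: "\<forall>t\<in>carrier G - T. \<forall>x\<in>X. M t x = 0"
    and M_S: "\<forall>t\<in>T. (\<lambda>x\<in>X. complex_of_real (M t x)) \<in> S"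
    and M_sum: "\<forall>x\<in>X. W x > C \<longrightarrow> (\<Sum>t\<in>T. M t x) = 1"
    and M_equiv: "\<forall>g\<in>Q. \<exists>C. \<forall>x\<in>X. W x > C \<longrightarrow> (\<forall>U. finite U \<longrightarrow> U \<subseteq> carrier G \<longrightarrow>
           (\<Sum>t\<in>U. \<bar>M (inv g \<otimes> t) x - M t (\<rho> g x)\<bar>) \<le> \<epsilon>)"
    using ex[OF Q \<open>\<epsilon> > 0\<close>] by (elim exE conjE) (rule that)
  define F where "F t = (\<lambda>x\<in>X. complex_of_real (M t x))" for t
  have F_0: "F t = (\<lambda>x\<in>X. 0)" if "t \<in> carrier G" "t \<notin> T" for t
    using M_0 that by (auto simp: F_def cong: restrict_cong)
  have F_S: "F t \<in> S" if "t \<in> carrier G" for t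
    using M_S F_0[OF that] const[of 0] by (cases "t \<in> T") (auto simp: F_def)
  have zero_J: "(\<lambda>x\<in>X. 0) \<in> J"
    by (rule vanishing_dominated[OF vanishing_indicator[where C = 0 and X = X and W = W], of _ 0]) auto
  define m where "m \<psi> = (\<lambda>t\<in>carrier G. Re (\<psi> (coset (F t))))" for \<psi>
  have m_0: "m \<psi> t = 0" if "\<psi> \<in> characters quot" "t \<in> carrier G" "t \<notin> T" for \<psi> t
    using character_lift(2)[OF that(1) zero_J] that F_0 by (simp add: m_def)
  have approx: "\<exists>x\<in>X. W x > C' \<and> (\<forall>t\<in>U. \<bar>M t x - m \<psi> t\<bar> < \<eta>)"
    if \<psi>: "\<psi> \<in> characters quot" and U: "finite U" "U \<subseteq> carrier G" and "\<eta> > 0" for \<psi> U C' \<eta>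
  proof -
    have A: "finite (F ` U)" "F ` U \<subseteq> S" using U F_S by auto
    obtain x where x: "x \<in> X" "W x > C'" "\<And>f. f \<in> F ` U \<Longrightarrow> cmod (f x - \<psi> (coset f)) < \<eta>"
      using quotient_character_approx[OF \<psi> A \<open>\<eta> > 0\<close>] by metis
    have "\<bar>M t x - m \<psi> t\<bar> < \<eta>" if t: "t \<in> U" for t
    proof -
      have "\<bar>M t x - m \<psi> t\<bar> = \<bar>Re (F t x - \<psi> (coset (F t)))\<bar>"
        using t U x(1) by (auto simp: m_def F_def)
      also have "\<dots> < \<eta>" using abs_Re_le_cmod x(3) t le_less_trans by blast
      finally show ?thesis .
    qed
    with x show ?thesis by blast
  qed
  have Prob: "m \<psi> \<in> Prob G" if \<psi>: "\<psi> \<in> characters quot" for \<psi>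
  proof (rule Prob_finite_support[OF T])
    show "m \<psi> \<in> extensional (carrier G)" by (simp add: m_def)
    show "m \<psi> t = 0" if "t \<in> carrier G - T" for t using m_0[OF \<psi>] that by auto
    show "0 \<le> m \<psi> t" if t: "t \<in> T" for t
    proof (rule ccontr)
      assume "\<not> 0 \<le> m \<psi> t"
      then show False
        using approx[OF \<psi>, of "{t}" "- m \<psi> t"] M_nonneg t T(2) by force
    qed
    have "\<bar>sum (m \<psi>) T - 1\<bar> \<le> 0"
    proof (rule field_le_epsilon)
      fix e :: real assume "e > 0"
      then have "e / (card T + 1) > 0" by simp
      then obtain x where x: "x \<in> X" "W x > C" "\<And>t. t \<in> T \<Longrightarrow> \<bar>M t x - m \<psi> t\<bar> < e / (card T + 1)"
        using approx[OF \<psi> T] by metis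
      have "\<bar>sum (m \<psi>) T - 1\<bar> = \<bar>\<Sum>t\<in>T. M t x - m \<psi> t\<bar>"
        using M_sum x(1,2) by (simp add: sum_subtractf)
      also have "\<dots> \<le> (\<Sum>t\<in>T. \<bar>M t x - m \<psi> t\<bar>)" by (rule sum_abs)
      also have "\<dots> \<le> card T * (e / (card T + 1))"
        using x(3) by (intro sum_bounded_above[of T _ "e / (card T + 1)"]) (auto intro: less_imp_le)
      also have "\<dots> \<le> e" using \<open>e > 0\<close> by (simp add: field_simps)
      finally show "\<bar>sum (m \<psi>) T - 1\<bar> \<le> 0 + e" by simp
    qed
    then show "sum (m \<psi>) T = 1" by simp
  qed
  let ?Y = "gelfand_spectrum quot"
  have Y: "topspace ?Y = characters quot"
    by (auto simp: gelfand_spectrum_def characters_def PiE_def)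
  interpret P: Metric_space "Prob G" "l1_dist G" by (rule Metric_space_Prob)
  have "continuous_map ?Y (Prob_topology G) m"
    unfolding Prob_topology_def P.continuous_map_to_metric
  proof (intro ballI allI impI)
    fix \<psi>0 and e :: real assume \<psi>0: "\<psi>0 \<in> topspace ?Y" and "e > 0"
    define D where "D \<psi> = (\<Sum>t\<in>T. \<bar>m \<psi>0 t - m \<psi> t\<bar>)" for \<psi>
    have "continuous_map ?Y euclideanreal (\<lambda>\<psi>. m \<psi> t)" if t: "t \<in> T" for t
    proof -
      have "continuous_map ?Y euclidean (\<lambda>\<psi>. \<psi> (coset (F t)))"
        unfolding gelfand_spectrum_def using t T(2)
        by (intro continuous_map_from_subtopology continuous_map_product_projection coset_carrier F_S) auto
      moreover have "continuous_map euclidean euclideanreal Re"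
        by (simp add: continuous_on_Re)
      ultimately have "continuous_map ?Y euclideanreal (Re \<circ> (\<lambda>\<psi>. \<psi> (coset (F t))))"
        by (rule continuous_map_compose)
      moreover have "(\<lambda>\<psi>. m \<psi> t) = Re \<circ> (\<lambda>\<psi>. \<psi> (coset (F t)))"
        using t T(2) by (auto simp: m_def fun_eq_iff)
      ultimately show ?thesis by simp
    qed
    then have "continuous_map ?Y euclideanreal D"
      unfolding D_def
      by (intro continuous_map_sum T continuous_map_real_abs continuous_map_diff) auto
    then have "openin ?Y {\<psi> \<in> topspace ?Y. D \<psi> \<in> {..<e}}"
      by (rule openin_continuous_map_preimage) simp
    moreover have "l1_dist G (m \<psi>0) (m \<psi>) = D \<psi>" if "\<psi> \<in> topspace ?Y" for \<psi>
      unfolding D_def by (rule l1_dist_finite_support[OF T]) (use m_0 Y \<psi>0 that in auto)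
    ultimately show "\<exists>U. openin ?Y U \<and> \<psi>0 \<in> U \<and> (\<forall>\<psi>\<in>U. m \<psi> \<in> P.mball (m \<psi>0) e)"
      using \<psi>0 \<open>e > 0\<close> Prob Y
      by (intro exI[of _ "{\<psi> \<in> topspace ?Y. D \<psi> \<in> {..<e}}"]) (auto simp: D_def)
  qed
  moreover have "l1_dist G (translate_prob G g (m \<psi>)) (m (spectrum_action G quot (quotient_action \<alpha>) g \<psi>)) \<le> \<epsilon>"
    if g: "g \<in> Q" and "\<psi> \<in> topspace ?Y" for g \<psi>
  proof -
    have \<psi>: "\<psi> \<in> characters quot" using that Y by simp
    have gG: "g \<in> carrier G" using g Q by auto
    define F' where "F' t = (\<lambda>x\<in>X. F t (\<rho> g x))" for t
    have F'_S: "F' t \<in> S" if "t \<in> carrier G" for t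
      unfolding F'_def using S_compose[OF F_S[OF that] \<rho>_closed[OF gG] \<rho>_proper[OF gG] \<rho>_P[OF gG]] .
    have act: "quotient_action \<alpha> (inv g) (coset (F t)) = coset (F' t)" if t: "t \<in> carrier G" for t
    proof -
      have \<rho>X: "\<rho> g x \<in> X" "\<rho> (inv g) x \<in> X" if "x \<in> X" for x
        using \<rho>_closed gG that by auto
      have 1: "\<alpha> (inv g) (\<lambda>x\<in>X. j x + F t x) = (\<lambda>x\<in>X. (\<lambda>x\<in>X. j (\<rho> g x)) x + F' t x)"
        if "j \<in> J" for j
      proof -
        have "(\<lambda>x\<in>X. j x + F t x) \<in> bounded_functions X"
          using that J_subset_S F_S[OF t] add S_bounded by blast
        then show ?thesis
          by (subst \<alpha>[OF gG]) (use \<rho>X in \<open>auto simp: F'_def cong: restrict_cong\<close>)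
      qed
      have 2: "(\<lambda>x\<in>X. j (\<rho> g x)) \<in> J" if "j \<in> J" for j
        by (rule vanishing_compose[OF that \<rho>_closed[OF gG] \<rho>_proper[OF gG]])
      have 3: "\<exists>j'\<in>J. j = (\<lambda>x\<in>X. j' (\<rho> g x))" if "j \<in> J" for j
      proof (intro bexI)
        show "(\<lambda>x\<in>X. j (\<rho> (inv g) x)) \<in> J"
          using vanishing_compose[OF that \<rho>_closed \<rho>_proper] gG by simp
        show "j = (\<lambda>x\<in>X. (\<lambda>x\<in>X. j (\<rho> (inv g) x)) (\<rho> g x))"
        proof (rule extensionalityI[of _ X])
          show "j \<in> extensional X"
            using vanishing_bounded[OF that] by (simp add: bounded_functions_def)
        qed (use \<rho>X \<rho>_inv[OF gG] in auto)
      qed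
      show ?thesis
        unfolding quotient_action_def coset_eq
      proof (intro equalityI subsetI)
        fix f assume "f \<in> \<alpha> (inv g) ` {\<lambda>x\<in>X. j x + F t x | j. j \<in> J}"
        then obtain j where "j \<in> J" "f = \<alpha> (inv g) (\<lambda>x\<in>X. j x + F t x)" by blast
        then show "f \<in> {\<lambda>x\<in>X. j x + F' t x | j. j \<in> J}" using 1 2 by blast
      next
        fix f assume "f \<in> {\<lambda>x\<in>X. j x + F' t x | j. j \<in> J}"
        then obtain j where j: "j \<in> J" "f = (\<lambda>x\<in>X. j x + F' t x)" by blast
        obtain j' where j': "j' \<in> J" "j = (\<lambda>x\<in>X. j' (\<rho> g x))" using 3[OF j(1)] by blast
        have "f = \<alpha> (inv g) (\<lambda>x\<in>X. j' x + F t x)"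
          unfolding 1[OF j'(1)] j(2) j'(2)[symmetric] ..
        then show "f \<in> \<alpha> (inv g) ` {\<lambda>x\<in>X. j x + F t x | j. j \<in> J}" using j'(1) by blast
      qed
    qed
    define U where "U = T \<union> (\<lambda>t. g \<otimes> t) ` T"
    have U: "finite U" "U \<subseteq> carrier G" using T gG by (auto simp: U_def)
    define p where "p t = Re (\<psi> (coset (F (inv g \<otimes> t))))" for t
    define q where "q t = Re (\<psi> (coset (F' t)))" for t
    have tr: "translate_prob G g (m \<psi>) t = p t" if "t \<in> carrier G" for t
      using that gG by (simp add: translate_prob_def m_def p_def)
    have sp: "m (spectrum_action G quot (quotient_action \<alpha>) g \<psi>) t = q t" if "t \<in> carrier G" for t
      using that coset_carrier[OF F_S[OF that]] act[OF that]
      by (simp add: m_def spectrum_action_def q_def)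
    have out: "translate_prob G g (m \<psi>) t = 0" "m (spectrum_action G quot (quotient_action \<alpha>) g \<psi>) t = 0"
      if t: "t \<in> carrier G - U" for t
    proof -
      have "inv g \<otimes> t \<notin> T"
      proof
        assume "inv g \<otimes> t \<in> T"
        then have "g \<otimes> (inv g \<otimes> t) \<in> U" by (auto simp: U_def)
        with t gG show False by (simp flip: m_assoc)
      qed
      then show "translate_prob G g (m \<psi>) t = 0"
        using m_0[OF \<psi>, of "inv g \<otimes> t"] t gG by (simp add: translate_prob_def)
      have "F' t = (\<lambda>x\<in>X. 0)"
        unfolding F'_def using F_0[of t] t \<rho>_closed[OF gG] by (intro restrict_ext) (auto simp: U_def)
      then show "m (spectrum_action G quot (quotient_action \<alpha>) g \<psi>) t = 0"
        using t character_lift(2)[OF \<psi> zero_J] by (simp add: sp q_def)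
    qed
    have "l1_dist G (translate_prob G g (m \<psi>)) (m (spectrum_action G quot (quotient_action \<alpha>) g \<psi>))
        = (\<Sum>t\<in>U. \<bar>translate_prob G g (m \<psi>) t - m (spectrum_action G quot (quotient_action \<alpha>) g \<psi>) t\<bar>)"
      by (rule l1_dist_finite_support[OF U out])
    also have "\<dots> = (\<Sum>t\<in>U. \<bar>p t - q t\<bar>)"
      using U tr sp by (intro sum.cong) auto
    also have "\<dots> \<le> \<epsilon>"
    proof (rule field_le_epsilon)
      fix e :: real assume "e > 0"
      define \<eta> where "\<eta> = e / (2 * card U + 1)"
      have "\<eta> > 0" using \<open>e > 0\<close> by (simp add: \<eta>_def)
      obtain C' where C': "\<And>x. x \<in> X \<Longrightarrow> W x > C' \<Longrightarrow> (\<Sum>t\<in>U. \<bar>M (inv g \<otimes> t) x - M t (\<rho> g x)\<bar>) \<le> \<epsilon>"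
        using bspec[OF M_equiv g] U by blast
      have A: "finite ((\<lambda>t. F (inv g \<otimes> t)) ` U \<union> F' ` U)" "(\<lambda>t. F (inv g \<otimes> t)) ` U \<union> F' ` U \<subseteq> S"
        using U F_S F'_S gG by auto
      obtain x where x: "x \<in> X" "W x > C'"
        and close: "\<And>f. f \<in> (\<lambda>t. F (inv g \<otimes> t)) ` U \<union> F' ` U \<Longrightarrow> cmod (f x - \<psi> (coset f)) < \<eta>"
        using quotient_character_approx[OF \<psi> A \<open>\<eta> > 0\<close>] by metis
      have "\<bar>p t - q t\<bar> \<le> \<bar>M (inv g \<otimes> t) x - M t (\<rho> g x)\<bar> + 2 * \<eta>" if t: "t \<in> U" for t
      proof -
        have "\<bar>Re (F (inv g \<otimes> t) x - \<psi> (coset (F (inv g \<otimes> t))))\<bar> < \<eta>"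
          and "\<bar>Re (F' t x - \<psi> (coset (F' t)))\<bar> < \<eta>"
          using close t by (blast intro: le_less_trans[OF abs_Re_le_cmod])+
        moreover have "Re (F (inv g \<otimes> t) x) = M (inv g \<otimes> t) x" "Re (F' t x) = M t (\<rho> g x)"
          using x(1) \<rho>_closed[OF gG] by (auto simp: F_def F'_def)
        ultimately show ?thesis by (simp add: p_def q_def)
      qed
      then have "(\<Sum>t\<in>U. \<bar>p t - q t\<bar>) \<le> (\<Sum>t\<in>U. \<bar>M (inv g \<otimes> t) x - M t (\<rho> g x)\<bar> + 2 * \<eta>)"
        by (rule sum_mono)
      also have "\<dots> \<le> \<epsilon> + card U * (2 * \<eta>)"
        using C'[OF x] by (simp add: sum.distrib)
      also have "\<dots> \<le> \<epsilon> + e"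
        using \<open>e > 0\<close> by (simp add: \<eta>_def field_simps)
      finally show "(\<Sum>t\<in>U. \<bar>p t - q t\<bar>) \<le> \<epsilon> + e" .
    qed
    finally show ?thesis .
  qed
  ultimately show "\<exists>m. continuous_map ?Y (Prob_topology G) m \<and>
      (\<forall>g\<in>Q. \<forall>\<psi>\<in>topspace ?Y. l1_dist G (translate_prob G g (m \<psi>))
        (m (spectrum_action G quot (quotient_action \<alpha>) g \<psi>)) \<le> \<epsilon>)"
    by blast
qed (rule assms(2))

end

section \<open>Almost invariant families of finitely supported probability measures\<close>

definition finite_probs :: "'g set \<Rightarrow> ('g \<Rightarrow> real) set" where
  "finite_probs T = {p. (\<forall>t. 0 \<le> p t) \<and> (\<forall>t. t \<notin> T \<longrightarrow> p t = 0) \<and> sum p T = 1}"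

lemma sum_finite_probs_le:
  assumes "p \<in> finite_probs T" "finite T" "finite U"
  shows "sum p U \<le> 1"
proof -
  have "sum p U = sum p (U \<inter> T)"
    using assms by (intro sum.mono_neutral_right) (auto simp: finite_probs_def)
  also have "\<dots> \<le> sum p T"
    using assms by (intro sum_mono2) (auto simp: finite_probs_def)
  finally show ?thesis using assms(1) by (simp add: finite_probs_def)
qed

lemma finite_probs_bounds:
  assumes "p \<in> finite_probs T" "finite T"
  shows "0 \<le> p t" "p t \<le> 1"
  using sum_finite_probs_le[OF assms, of "{t}"] assms by (auto simp: finite_probs_def)

definition almost_equivariant ::
    "('g, 'b) monoid_scheme \<Rightarrow> 'g set \<Rightarrow> real \<Rightarrow> ('g \<Rightarrow> 'x \<Rightarrow> 'x) \<Rightarrow> 'x set \<Rightarrow> ('x \<Rightarrow> 'g \<Rightarrow> real) \<Rightarrow> bool"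
  where "almost_equivariant G Q \<epsilon> \<phi> E \<mu> \<longleftrightarrow>
    (\<forall>g\<in>Q. \<forall>x\<in>E. \<forall>U. finite U \<longrightarrow> U \<subseteq> carrier G \<longrightarrow>
       (\<Sum>t\<in>U. \<bar>\<mu> x (inv\<^bsub>G\<^esub> g \<otimes>\<^bsub>G\<^esub> t) - \<mu> (\<phi> g x) t\<bar>) \<le> \<epsilon>)"

lemma (in group) sum_translate:
  assumes "g \<in> carrier G" "finite U" "U \<subseteq> carrier G"
  obtains V where "finite V" "V \<subseteq> carrier G" "\<And>f. (\<Sum>t\<in>U. f (g \<otimes> t)) = sum f V"
proof
  show "(\<Sum>t\<in>U. f (g \<otimes> t)) = sum f ((\<lambda>t. g \<otimes> t) ` U)" for f
  proof -
    have "inj_on (\<lambda>t. g \<otimes> t) U"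
      using assms by (intro inj_onI) (metis Units_eq Units_l_cancel subsetD)
    then show ?thesis by (simp add: sum.reindex)
  qed
qed (use assms in auto)

lemma openin_Prob_sum_greater:
  assumes "finite T" "T \<subseteq> carrier G"
  shows "openin (Prob_topology G) {p \<in> Prob G. c < sum p T}"
proof -
  interpret P: Metric_space "Prob G" "l1_dist G" by (rule Metric_space_Prob)
  have "\<exists>r>0. P.mball p r \<subseteq> {p \<in> Prob G. c < sum p T}" if p: "p \<in> Prob G" "c < sum p T" for p
  proof (intro exI conjI subsetI)
    show "sum p T - c > 0" using p by simp
    fix q assume "q \<in> P.mball p (sum p T - c)"
    then have q: "q \<in> Prob G" "l1_dist G p q < sum p T - c" by auto
    have "sum p T - sum q T \<le> (\<Sum>h\<in>T. \<bar>p h - q h\<bar>)"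
      unfolding sum_subtractf[symmetric] by (rule sum_mono) auto
    also have "\<dots> \<le> l1_dist G p q"
      by (rule sum_le_l1_dist[OF p(1) q(1) assms])
    finally show "q \<in> {p \<in> Prob G. c < sum p T}" using q by auto
  qed
  then show ?thesis
    unfolding Prob_topology_def P.openin_mtopology by auto
qed

lemma Prob_tail:
  assumes "p \<in> Prob G" "\<delta> > 0"
  shows "\<exists>T. finite T \<and> T \<subseteq> carrier G \<and> 1 - \<delta> < sum p T"
proof -
  have "(sum p \<longlongrightarrow> 1) (finite_subsets_at_top (carrier G))"
    using assms(1) by (simp add: Prob_def has_sum_def)
  then have "\<forall>\<^sub>F T in finite_subsets_at_top (carrier G). 1 - \<delta> < sum p T"
    using assms(2) by (intro order_tendstoD) auto
  then show ?thesis
    unfolding eventually_finite_subsets_at_top by blast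
qed

lemma compact_uniformly_tight:
  assumes "compact_space Y" "continuous_map Y (Prob_topology G) m" "\<delta> > 0"
  obtains T where "finite T" "T \<subseteq> carrier G" "\<And>y. y \<in> topspace Y \<Longrightarrow> 1 - \<delta> < sum (m y) T"
proof -
  interpret P: Metric_space "Prob G" "l1_dist G" by (rule Metric_space_Prob)
  have Prob: "m y \<in> Prob G" if "y \<in> topspace Y" for y
    using continuous_map_funspace[OF assms(2)] that by (auto simp: Prob_topology_def)
  define V where "V T = {y \<in> topspace Y. m y \<in> {p \<in> Prob G. 1 - \<delta> < sum p T}}" for T
  define \<T> where "\<T> = {T. finite T \<and> T \<subseteq> carrier G}"
  have "openin Y (V T)" if "T \<in> \<T>" for T
    unfolding V_def using that
    by (intro openin_continuous_map_preimage[OF assms(2)] openin_Prob_sum_greater) (auto simp: \<T>_def)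
  moreover have "topspace Y \<subseteq> \<Union>(V ` \<T>)"
    using Prob Prob_tail[OF _ assms(3)] by (force simp: V_def \<T>_def)
  ultimately obtain \<F> where \<F>: "finite \<F>" "\<F> \<subseteq> V ` \<T>" "topspace Y \<subseteq> \<Union>\<F>"
    using assms(1) unfolding compact_space_alt by (metis (no_types, lifting) imageE)
  then obtain \<S> where \<S>: "finite \<S>" "\<S> \<subseteq> \<T>" "\<F> = V ` \<S>"
    by (meson finite_subset_image)
  show ?thesis
  proof
    show T: "finite (\<Union>\<S>)" "\<Union>\<S> \<subseteq> carrier G" using \<S> by (auto simp: \<T>_def)
    fix y assume y: "y \<in> topspace Y"
    then obtain T where "T \<in> \<S>" "y \<in> V T" using \<F>(3) \<S>(3) by auto
    then have "1 - \<delta> < sum (m y) T" by (simp add: V_def)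
    also have "\<dots> \<le> sum (m y) (\<Union>\<S>)"
      using T \<open>T \<in> \<S>\<close> Prob[OF y] by (intro sum_mono2) (auto simp: Prob_def)
    finally show "1 - \<delta> < sum (m y) (\<Union>\<S>)" .
  qed
qed

lemma Prob_truncate:
  assumes p: "p \<in> Prob G" and T: "finite T" "T \<subseteq> carrier G" and \<delta>: "1 - \<delta> < sum p T" "\<delta> < 1"
  defines "q \<equiv> \<lambda>t. if t \<in> T then p t / sum p T else 0"
  shows "q \<in> finite_probs T"
    and "finite U \<Longrightarrow> U \<subseteq> carrier G \<Longrightarrow> (\<Sum>t\<in>U. \<bar>q t - p t\<bar>) \<le> 2 * \<delta>"
proof -
  define s where "s = sum p T"
  have s: "s > 0" "1 - \<delta> < s" "s \<le> 1"
    using \<delta> sum_Prob_le_1[OF p T] by (auto simp: s_def)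
  have nonneg: "0 \<le> p t" if "t \<in> carrier G" for t using p that by (simp add: Prob_def)
  have "sum q T = (\<Sum>t\<in>T. p t / s)" by (rule sum.cong) (auto simp: q_def s_def)
  also have "\<dots> = 1" using s by (simp add: s_def flip: sum_divide_distrib)
  finally show "q \<in> finite_probs T"
    using nonneg T s by (auto simp: finite_probs_def q_def s_def)
  assume U: "finite U" "U \<subseteq> carrier G"
  have "(\<Sum>t\<in>U. \<bar>q t - p t\<bar>) \<le> (\<Sum>t\<in>U \<union> T. \<bar>q t - p t\<bar>)"
    using U T by (intro sum_mono2) auto
  also have "U \<union> T = (U - T) \<union> T" by auto
  also have "(\<Sum>t\<in>(U - T) \<union> T. \<bar>q t - p t\<bar>) = (\<Sum>t\<in>U - T. \<bar>q t - p t\<bar>) + (\<Sum>t\<in>T. \<bar>q t - p t\<bar>)"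
    using U T by (intro sum.union_disjoint) auto
  also have "(\<Sum>t\<in>U - T. \<bar>q t - p t\<bar>) = sum p (U - T)"
    using U nonneg by (intro sum.cong) (auto simp: q_def)
  also have "(\<Sum>t\<in>T. \<bar>q t - p t\<bar>) = (\<Sum>t\<in>T. p t / s - p t)"
  proof (rule sum.cong[OF refl])
    fix t assume t: "t \<in> T"
    have "p t \<le> p t / s" using s nonneg[of t] t T by (auto simp: le_divide_eq mult_left_le)
    then show "\<bar>q t - p t\<bar> = p t / s - p t" using t by (simp add: q_def s_def)
  qed
  also have "\<dots> = 1 - s" using s by (simp add: sum_subtractf s_def flip: sum_divide_distrib)
  also have "sum p (U - T) \<le> 1 - s"
  proof -
    have "sum p (U - T) + s = sum p ((U - T) \<union> T)"
      unfolding s_def using U T by (intro sum.union_disjoint[symmetric]) auto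
    also have "\<dots> \<le> 1" by (rule sum_Prob_le_1[OF p]) (use U T in auto)
    finally show ?thesis by simp
  qed
  finally show "(\<Sum>t\<in>U. \<bar>q t - p t\<bar>) \<le> 2 * \<delta>" using s by simp
qed

lemma (in group) exact_group_almost_equivariant:
  assumes "exact_group G" "finite Q" "Q \<subseteq> carrier G" "\<epsilon> > 0"
  obtains \<mu> T where "finite T" "T \<subseteq> carrier G" "\<And>x. x \<in> carrier G \<Longrightarrow> \<mu> x \<in> finite_probs T"
    "almost_equivariant G Q \<epsilon> (\<lambda>g x. g \<otimes> x) (carrier G) \<mu>"
proof -
  let ?S = "bounded_functions (carrier G)"
  interpret S: function_star_algebra "carrier G" ?S by (rule function_star_algebra_bounded)
  let ?Y = "gelfand_spectrum S.alg"
  let ?\<alpha> = "\<lambda>g f. \<lambda>x\<in>carrier G. f (inv g \<otimes> x) :: complex"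
  have Y: "topspace ?Y = characters S.alg"
    by (auto simp: gelfand_spectrum_def characters_def PiE_def)
  obtain m where m: "continuous_map ?Y (Prob_topology G) m"
    and m_equiv: "\<And>g y. g \<in> Q \<Longrightarrow> y \<in> topspace ?Y \<Longrightarrow>
      l1_dist G (translate_prob G g (m y)) (m (spectrum_action G S.alg ?\<alpha> g y)) \<le> \<epsilon> / 2"
    using topologically_amenableD[of G ?Y _ Q "\<epsilon> / 2"] assms
    unfolding exact_group_def amenable_action_def by (metis half_gt_zero)
  define \<delta> where "\<delta> = min (\<epsilon> / 8) (1 / 2)"
  have \<delta>: "\<delta> > 0" "\<delta> < 1" "4 * \<delta> \<le> \<epsilon> / 2" using assms(4) by (auto simp: \<delta>_def)
  obtain T where T: "finite T" "T \<subseteq> carrier G" "\<And>y. y \<in> topspace ?Y \<Longrightarrow> 1 - \<delta> < sum (m y) T"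
    using compact_uniformly_tight[OF S.compact_gelfand_spectrum m \<delta>(1)] by metis
  define ev where "ev x = (\<lambda>f\<in>?S. f x)" for x
  have ev: "ev x \<in> topspace ?Y" if "x \<in> carrier G" for x
    using S.evaluation_character[OF that] by (simp add: Y ev_def)
  have act: "spectrum_action G S.alg ?\<alpha> g (ev x) = ev (g \<otimes> x)"
    if "g \<in> carrier G" "x \<in> carrier G" for g x
  proof -
    have "?\<alpha> (inv g) f \<in> ?S" if "f \<in> ?S" for f
    proof -
      obtain B where "\<And>x. x \<in> carrier G \<Longrightarrow> cmod (f x) \<le> B" using \<open>f \<in> ?S\<close> bounded_functionsE by metis
      then show ?thesis
        using \<open>g \<in> carrier G\<close> by (intro bounded_functionsI[of _ _ B]) auto
    qed
    then show ?thesis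
      using that by (auto simp: spectrum_action_def ev_def function_algebra_def fun_eq_iff)
  qed
  define p where "p x = m (ev x)" for x
  have p: "p x \<in> Prob G" "1 - \<delta> < sum (p x) T" if "x \<in> carrier G" for x
    using T(3)[OF ev[OF that]] continuous_map_funspace[OF m] ev[OF that]
      Metric_space.topspace_mtopology[OF Metric_space_Prob]
    by (auto simp: p_def Prob_topology_def)
  define \<mu> where "\<mu> x t = (if t \<in> T then p x t / sum (p x) T else 0)" for x t
  have \<mu>: "\<mu> x \<in> finite_probs T"
    "finite U \<Longrightarrow> U \<subseteq> carrier G \<Longrightarrow> (\<Sum>t\<in>U. \<bar>\<mu> x t - p x t\<bar>) \<le> 2 * \<delta>" if "x \<in> carrier G" for x U
    using Prob_truncate[OF p(1)[OF that] T(1,2) p(2)[OF that] \<delta>(2)] by (simp_all add: \<mu>_def[abs_def])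
  have "almost_equivariant G Q \<epsilon> (\<lambda>g x. g \<otimes> x) (carrier G) \<mu>"
    unfolding almost_equivariant_def
  proof (intro ballI allI impI)
    fix g x U assume g: "g \<in> Q" and x: "x \<in> carrier G" and U: "finite U" "U \<subseteq> carrier G"
    have gG: "g \<in> carrier G" using g assms(3) by auto
    obtain V where V: "finite V" "V \<subseteq> carrier G" "\<And>f::_ \<Rightarrow> real. (\<Sum>t\<in>U. f (inv g \<otimes> t)) = sum f V"
      using sum_translate[OF _ U, of "inv g"] gG by (metis inv_closed)
    have "(\<Sum>t\<in>U. \<bar>p x (inv g \<otimes> t) - p (g \<otimes> x) t\<bar>) =
        (\<Sum>t\<in>U. \<bar>translate_prob G g (p x) t - p (g \<otimes> x) t\<bar>)"
      using U by (intro sum.cong) (auto simp: translate_prob_def)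
    also have "\<dots> \<le> l1_dist G (translate_prob G g (p x)) (p (g \<otimes> x))"
      using gG x by (intro sum_le_l1_dist[OF _ _ U] translate_prob_Prob p) auto
    also have "\<dots> \<le> \<epsilon> / 2"
      using m_equiv[OF g ev[OF x]] act[OF gG x] by (simp add: p_def)
    finally have 1: "(\<Sum>t\<in>U. \<bar>p x (inv g \<otimes> t) - p (g \<otimes> x) t\<bar>) \<le> \<epsilon> / 2" .
    have "(\<Sum>t\<in>U. \<bar>\<mu> x (inv g \<otimes> t) - \<mu> (g \<otimes> x) t\<bar>) \<le>
        (\<Sum>t\<in>U. \<bar>\<mu> x (inv g \<otimes> t) - p x (inv g \<otimes> t)\<bar> + \<bar>p x (inv g \<otimes> t) - p (g \<otimes> x) t\<bar>
          + \<bar>\<mu> (g \<otimes> x) t - p (g \<otimes> x) t\<bar>)"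
      by (rule sum_mono) linarith
    also have "\<dots> = (\<Sum>t\<in>V. \<bar>\<mu> x t - p x t\<bar>) + (\<Sum>t\<in>U. \<bar>p x (inv g \<otimes> t) - p (g \<otimes> x) t\<bar>)
          + (\<Sum>t\<in>U. \<bar>\<mu> (g \<otimes> x) t - p (g \<otimes> x) t\<bar>)"
      by (simp add: sum.distrib V(3)[of "\<lambda>t. \<bar>\<mu> x t - p x t\<bar>"])
    also have "\<dots> \<le> 2 * \<delta> + \<epsilon> / 2 + 2 * \<delta>"
      using gG x by (intro add_mono \<mu>(2) 1 V U) auto
    also have "\<dots> \<le> \<epsilon>" using \<delta> by simp
    finally show "(\<Sum>t\<in>U. \<bar>\<mu> x (inv g \<otimes> t) - \<mu> (g \<otimes> x) t\<bar>) \<le> \<epsilon>" .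
  qed
  with T(1,2) \<mu>(1) show ?thesis using that by blast
qed

text \<open>The set of \<open>g\<close> that carry a chosen point of the orbit of \<open>x\<close> to \<open>x\<close> is a coset of a
  finite stabilizer; averaging over it moves a family on the group to a family on \<open>E\<close>.\<close>

lemma (in group_action) exact_group_action_almost_equivariant:
  assumes "exact_group G" "\<forall>x\<in>E. finite (stabilizer G \<phi> x)"
    and Q: "finite Q" "Q \<subseteq> carrier G" and "\<epsilon> > 0"
  obtains \<mu> T where "finite T" "T \<subseteq> carrier G" "\<And>x. x \<in> E \<Longrightarrow> \<mu> x \<in> finite_probs T"
    "almost_equivariant G Q \<epsilon> \<phi> E \<mu>"
proof -
  interpret group G using group_hom group_hom.axioms(1) by blast
  obtain \<mu> T where T: "finite T" "T \<subseteq> carrier G" and \<mu>: "\<And>x. x \<in> carrier G \<Longrightarrow> \<mu> x \<in> finite_probs T"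
    and equiv: "almost_equivariant G Q \<epsilon> (\<lambda>g x. g \<otimes> x) (carrier G) \<mu>"
    using exact_group_almost_equivariant[OF assms(1) Q \<open>\<epsilon> > 0\<close>] by metis
  define r where "r x = (SOME y. y \<in> orbit G \<phi> x)" for x
  define C where "C x = {g \<in> carrier G. \<phi> g (r x) = x}" for x
  have act: "\<phi> g x \<in> E" if "g \<in> carrier G" "x \<in> E" for g x
    using element_image that by blast
  have r: "\<exists>h\<in>carrier G. r x = \<phi> h x" if "x \<in> E" for x
    using someI[of "\<lambda>y. y \<in> orbit G \<phi> x" x] orbit_refl[OF that] by (auto simp: r_def orbit_def)
  have rE: "r x \<in> E" if "x \<in> E" for x using r[OF that] act that by auto
  have C_ne: "C x \<noteq> {}" if x: "x \<in> E" for x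
  proof -
    obtain h where h: "h \<in> carrier G" "r x = \<phi> h x" using r[OF x] by blast
    then have "inv h \<in> C x" using orbit_sym_aux[OF h(1) x] by (simp add: C_def)
    then show ?thesis by auto
  qed
  have C_fin: "finite (C x)" if x: "x \<in> E" for x
  proof -
    obtain g0 where g0: "g0 \<in> carrier G" "\<phi> g0 (r x) = x" using C_ne[OF x] by (auto simp: C_def)
    have "C x \<subseteq> (\<lambda>s. g0 \<otimes> s) ` stabilizer G \<phi> (r x)"
    proof
      fix g assume g: "g \<in> C x"
      have "\<phi> (inv g0 \<otimes> g) (r x) = \<phi> (inv g0) x"
        using g g0 rE[OF x] by (simp add: composition_rule C_def)
      also have "\<dots> = r x" using orbit_sym_aux[OF g0(1) rE[OF x] g0(2)] .
      finally have "inv g0 \<otimes> g \<in> stabilizer G \<phi> (r x)"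
        using g g0 by (auto simp: stabilizer_def C_def)
      moreover have "g = g0 \<otimes> (inv g0 \<otimes> g)" using g g0 by (simp add: C_def flip: m_assoc)
      ultimately show "g \<in> (\<lambda>s. g0 \<otimes> s) ` stabilizer G \<phi> (r x)" by blast
    qed
    then show ?thesis using assms(2) rE[OF x] finite_subset by blast
  qed
  have r_act: "r (\<phi> k x) = r x" if "k \<in> carrier G" "x \<in> E" for k x
  proof -
    have "orbit G \<phi> (\<phi> k x) = orbit G \<phi> x"
    proof (intro equalityI subsetI)
      fix y assume "y \<in> orbit G \<phi> (\<phi> k x)"
      then show "y \<in> orbit G \<phi> x"
        using that by (auto simp: orbit_def simp flip: composition_rule)
    next
      fix y assume "y \<in> orbit G \<phi> x"
      then obtain g where g: "g \<in> carrier G" "y = \<phi> g x" by (auto simp: orbit_def)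
      then have "y = \<phi> (g \<otimes> inv k) (\<phi> k x)"
        using that act by (simp add: composition_rule orbit_sym_aux)
      with g that show "y \<in> orbit G \<phi> (\<phi> k x)"
        unfolding orbit_def by (intro CollectI exI[of _ "g \<otimes> inv k"]) simp
    qed
    then show ?thesis by (simp add: r_def)
  qed
  have C_act: "C (\<phi> k x) = (\<lambda>g. k \<otimes> g) ` C x" if kx: "k \<in> carrier G" "x \<in> E" for k x
  proof (intro equalityI subsetI)
    fix g assume "g \<in> C (\<phi> k x)"
    then have g: "g \<in> carrier G" "\<phi> g (r x) = \<phi> k x" using r_act[OF kx] by (auto simp: C_def)
    then have "inv k \<otimes> g \<in> C x"
      using kx rE by (simp add: C_def composition_rule orbit_sym_aux)
    moreover have "g = k \<otimes> (inv k \<otimes> g)" using g kx by (simp flip: m_assoc)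
    ultimately show "g \<in> (\<lambda>g. k \<otimes> g) ` C x" by blast
  next
    fix g assume "g \<in> (\<lambda>g. k \<otimes> g) ` C x"
    then show "g \<in> C (\<phi> k x)" using kx rE by (auto simp: C_def r_act composition_rule)
  qed
  define \<nu> where "\<nu> x t = (\<Sum>g\<in>C x. \<mu> g t) / card (C x)" for x t
  have CG: "g \<in> carrier G" if "g \<in> C x" for g x using that by (simp add: C_def)
  have card_pos: "card (C x) > 0" if "x \<in> E" for x
    using C_ne C_fin that by (simp add: card_gt_0_iff)
  have "\<nu> x \<in> finite_probs T" if x: "x \<in> E" for x
  proof -
    have "sum (\<nu> x) T = (\<Sum>g\<in>C x. sum (\<mu> g) T) / card (C x)"
      unfolding \<nu>_def by (subst sum.swap) (simp add: sum_divide_distrib)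
    also have "(\<Sum>g\<in>C x. sum (\<mu> g) T) = (\<Sum>g\<in>C x. 1)"
      using \<mu> CG by (intro sum.cong) (auto simp: finite_probs_def)
    finally have "sum (\<nu> x) T = 1" using card_pos[OF x] by simp
    moreover have "0 \<le> \<nu> x t" for t
      unfolding \<nu>_def using finite_probs_bounds[OF \<mu>[OF CG] T(1)] by (intro divide_nonneg_nonneg sum_nonneg) auto
    moreover have "\<nu> x t = 0" if "t \<notin> T" for t
    proof -
      have "\<mu> g t = 0" if "g \<in> C x" for g using \<mu>[OF CG[OF that]] \<open>t \<notin> T\<close> by (auto simp: finite_probs_def)
      then show ?thesis by (simp add: \<nu>_def)
    qed
    ultimately show ?thesis by (simp add: finite_probs_def)
  qed
  moreover have "almost_equivariant G Q \<epsilon> \<phi> E \<nu>"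
    unfolding almost_equivariant_def
  proof (intro ballI allI impI)
    fix k x U assume k: "k \<in> Q" and x: "x \<in> E" and U: "finite U" "U \<subseteq> carrier G"
    have kG: "k \<in> carrier G" using k Q by auto
    let ?n = "card (C x)"
    have inj: "inj_on (\<lambda>g. k \<otimes> g) (C x)" using kG CG by (auto intro!: inj_onI)
    have \<nu>k: "\<nu> (\<phi> k x) t = (\<Sum>g\<in>C x. \<mu> (k \<otimes> g) t) / ?n" for t
      unfolding \<nu>_def C_act[OF kG x] by (simp add: card_image[OF inj] sum.reindex[OF inj])
    have "(\<Sum>t\<in>U. \<bar>\<nu> x (inv k \<otimes> t) - \<nu> (\<phi> k x) t\<bar>) =
        (\<Sum>t\<in>U. \<bar>\<Sum>g\<in>C x. \<mu> g (inv k \<otimes> t) - \<mu> (k \<otimes> g) t\<bar>) / ?n"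
      unfolding \<nu>k unfolding \<nu>_def sum_divide_distrib
      by (intro sum.cong refl) (simp add: sum_subtractf flip: diff_divide_distrib sum_divide_distrib)
    also have "\<dots> \<le> (\<Sum>t\<in>U. \<Sum>g\<in>C x. \<bar>\<mu> g (inv k \<otimes> t) - \<mu> (k \<otimes> g) t\<bar>) / ?n"
      by (intro divide_right_mono sum_mono sum_abs) auto
    also have "\<dots> = (\<Sum>g\<in>C x. \<Sum>t\<in>U. \<bar>\<mu> g (inv k \<otimes> t) - \<mu> (k \<otimes> g) t\<bar>) / ?n"
      by (subst sum.swap) simp
    also have "\<dots> \<le> (\<Sum>g\<in>C x. \<epsilon>) / ?n"
      using equiv k U CG by (intro divide_right_mono sum_mono) (auto simp: almost_equivariant_def)
    also have "\<dots> = \<epsilon>" using card_pos[OF x] by simp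
    finally show "(\<Sum>t\<in>U. \<bar>\<nu> x (inv k \<otimes> t) - \<nu> (\<phi> k x) t\<bar>) \<le> \<epsilon>" .
  qed
  ultimately show ?thesis using that T by blast
qed


section \<open>Proper length functions\<close>

lemma (in group) ex_length_function:
  assumes "countable (carrier G)"
  obtains L :: "'a \<Rightarrow> nat" where "\<And>n. finite {g \<in> carrier G. L g \<le> n}"
    "\<And>g h. g \<in> carrier G \<Longrightarrow> h \<in> carrier G \<Longrightarrow> L (g \<otimes> h) \<le> L g + L h"
proof -
  define e where "e g = to_nat_on (carrier G) g + 1" for g
  define pr where "pr ws = foldr (\<otimes>) ws \<one>" for ws
  define V where "V g = {ws. set ws \<subseteq> carrier G \<and> pr ws = g}" for g
  define L where "L g = (LEAST n. \<exists>ws\<in>V g. n = sum_list (map e ws))" for g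
  have L_ex: "\<exists>ws\<in>V g. L g = sum_list (map e ws)" if "g \<in> carrier G" for g
  proof -
    have "[g] \<in> V g" using that by (simp add: V_def pr_def)
    then have "\<exists>n. \<exists>ws\<in>V g. n = sum_list (map e ws)" by blast
    then show ?thesis
      unfolding L_def by (rule LeastI_ex)
  qed
  have L_le: "L g \<le> sum_list (map e ws)" if "ws \<in> V g" for g ws
    unfolding L_def using that by (intro Least_le) blast
  have pr_closed: "pr ws \<in> carrier G" if "set ws \<subseteq> carrier G" for ws
    using that by (induction ws) (auto simp: pr_def)
  have pr_append: "pr (us @ ws) = pr us \<otimes> pr ws" if "set us \<subseteq> carrier G" "set ws \<subseteq> carrier G" for us ws
    using that
  proof (induction us)
    case Nil
    then show ?case using pr_closed[of ws] by (simp add: pr_def)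
  next
    case (Cons u us)
    then show ?case using pr_closed[of us] pr_closed[of ws] by (simp add: pr_def m_assoc)
  qed
  show ?thesis
  proof
    fix n
    have fin: "finite {g \<in> carrier G. e g \<le> n}"
      by (rule inj_on_finite[of "to_nat_on (carrier G)" _ "{..n}"])
        (use inj_on_to_nat_on[OF assms] in \<open>auto simp: e_def inj_on_def\<close>)
    have "{g \<in> carrier G. L g \<le> n} \<subseteq> pr ` {ws. set ws \<subseteq> {g \<in> carrier G. e g \<le> n} \<and> length ws \<le> n}"
    proof
      fix g assume "g \<in> {g \<in> carrier G. L g \<le> n}"
      then obtain ws where ws: "ws \<in> V g" "sum_list (map e ws) \<le> n" using L_ex[of g] by auto
      have "length ws \<le> sum_list (map e ws)" by (induction ws) (auto simp: e_def)
      moreover have "e w \<le> sum_list (map e ws)" if "w \<in> set ws" for w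
        using that by (intro member_le_sum_list) auto
      ultimately show "g \<in> pr ` {ws. set ws \<subseteq> {g \<in> carrier G. e g \<le> n} \<and> length ws \<le> n}"
        using ws by (force simp: V_def)
    qed
    then show "finite {g \<in> carrier G. L g \<le> n}"
      using finite_lists_length_le[OF fin] finite_subset by blast
  next
    fix g h assume "g \<in> carrier G" "h \<in> carrier G"
    then obtain us ws where *: "us \<in> V g" "L g = sum_list (map e us)" "ws \<in> V h" "L h = sum_list (map e ws)"
      using L_ex by metis
    then have "us @ ws \<in> V (g \<otimes> h)" by (auto simp: V_def pr_append)
    from L_le[OF this] * show "L (g \<otimes> h) \<le> L g + L h" by simp
  qed
qed

lemma (in group_action) ex_length_function_action:
  assumes "countable E" and L: "\<And>n. finite {g \<in> carrier G. L g \<le> n}"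
    "\<And>g h. g \<in> carrier G \<Longrightarrow> h \<in> carrier G \<Longrightarrow> L (g \<otimes> h) \<le> L g + L h"
  obtains l :: "_ \<Rightarrow> nat" where "\<And>n. finite {x \<in> E. l x \<le> n}"
    "\<And>g x. g \<in> carrier G \<Longrightarrow> x \<in> E \<Longrightarrow> l (\<phi> g x) \<le> L g + l x"
proof -
  interpret group G using group_hom group_hom.axioms(1) by blast
  define e where "e = to_nat_on E"
  define l where "l x = (LEAST n. \<exists>g\<in>carrier G. \<exists>y\<in>E. x = \<phi> g y \<and> n = L g + e y)" for x
  have l_ex: "\<exists>g\<in>carrier G. \<exists>y\<in>E. x = \<phi> g y \<and> l x = L g + e y" if "x \<in> E" for x
  proof -
    have "x = \<phi> \<one> x" using id_eq_one that by (metis restrict_apply')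
    then have "\<exists>n. \<exists>g\<in>carrier G. \<exists>y\<in>E. x = \<phi> g y \<and> n = L g + e y"
      using that by (intro exI[of _ "L \<one> + e x"] bexI[of _ "\<one>"] bexI[of _ x]) auto
    then show ?thesis
      unfolding l_def by (rule LeastI_ex)
  qed
  have l_le: "l (\<phi> g y) \<le> L g + e y" if "g \<in> carrier G" "y \<in> E" for g y
    unfolding l_def using that by (intro Least_le) blast
  show ?thesis
  proof
    fix n
    have "finite {x \<in> E. e x \<le> n}"
      by (rule inj_on_finite[of e _ "{..n}"])
        (use inj_on_to_nat_on[OF assms(1)] in \<open>auto simp: e_def inj_on_def\<close>)
    then have "finite ((\<lambda>(g, y). \<phi> g y) ` ({g \<in> carrier G. L g \<le> n} \<times> {x \<in> E. e x \<le> n}))"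
      using L(1) by blast
    moreover have "{x \<in> E. l x \<le> n} \<subseteq> (\<lambda>(g, y). \<phi> g y) ` ({g \<in> carrier G. L g \<le> n} \<times> {x \<in> E. e x \<le> n})"
    proof
      fix x assume "x \<in> {x \<in> E. l x \<le> n}"
      then obtain g y where "g \<in> carrier G" "y \<in> E" "x = \<phi> g y" "L g + e y \<le> n" using l_ex by force
      then show "x \<in> (\<lambda>(g, y). \<phi> g y) ` ({g \<in> carrier G. L g \<le> n} \<times> {x \<in> E. e x \<le> n})" by force
    qed
    ultimately show "finite {x \<in> E. l x \<le> n}" by (rule rev_finite_subset)
  next
    fix g x assume g: "g \<in> carrier G" and "x \<in> E"
    then obtain h y where h: "h \<in> carrier G" "y \<in> E" "x = \<phi> h y" "l x = L h + e y" using l_ex by blast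
    have "l (\<phi> g x) = l (\<phi> (g \<otimes> h) y)" using g h by (simp add: composition_rule)
    also have "\<dots> \<le> L (g \<otimes> h) + e y" using g h by (intro l_le) auto
    also have "\<dots> \<le> L g + l x" using L(2)[OF g h(1)] h(4) by simp
    finally show "l (\<phi> g x) \<le> L g + l x" .
  qed
qed

section \<open>Letter sums of reduced words\<close>

abbreviation word_mult :: "('d, 'b) monoid_scheme \<Rightarrow> ('i \<times> 'd) list \<Rightarrow> ('i \<times> 'd) list \<Rightarrow> ('i \<times> 'd) list" where
  "word_mult D u v \<equiv> foldr (letter_mult D) u v"

definition letter_sum :: "('i \<times> 'd \<Rightarrow> real) \<Rightarrow> ('i \<times> 'd) list \<Rightarrow> real" where
  "letter_sum f y = sum_list (map f y)"

lemma letter_sum_simps [simp]: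
  "letter_sum f [] = 0" "letter_sum f (a # y) = f a + letter_sum f y"
  "letter_sum f (y @ z) = letter_sum f y + letter_sum f z"
  by (simp_all add: letter_sum_def)

lemma letter_sum_mono:
  assumes "\<And>a. a \<in> set y \<Longrightarrow> f a \<le> f' a"
  shows "letter_sum f y \<le> letter_sum f' y"
  using assms unfolding letter_sum_def by (rule sum_list_mono)

lemma letter_sum_cong:
  assumes "\<And>a. a \<in> set y \<Longrightarrow> f a = f' a"
  shows "letter_sum f y = letter_sum f' y"
  using assms by (induction y) auto

lemma letter_sum_const: "letter_sum (\<lambda>_. c) y = real (length y) * c"
  by (induction y) (auto simp: algebra_simps)

lemma letter_sum_add: "letter_sum (\<lambda>a. f a + f' a) y = letter_sum f y + letter_sum f' y"
  by (induction y) auto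

lemma letter_sum_diff: "letter_sum (\<lambda>a. f a - f' a) y = letter_sum f y - letter_sum f' y"
  by (induction y) auto

lemma letter_sum_cmult: "letter_sum (\<lambda>a. c * f a) y = c * letter_sum f y"
  by (induction y) (auto simp: algebra_simps)

lemma letter_sum_abs: "\<bar>letter_sum f y\<bar> \<le> letter_sum (\<lambda>a. \<bar>f a\<bar>) y"
  by (induction y) auto

lemma sum_letter_sum: "(\<Sum>t\<in>U. letter_sum (f t) y) = letter_sum (\<lambda>a. \<Sum>t\<in>U. f t a) y"
  by (induction y) (auto simp: sum.distrib)

lemma letter_sum_abs_le:
  assumes "\<And>a. a \<in> set y \<Longrightarrow> \<bar>f a\<bar> \<le> c"
  shows "\<bar>letter_sum f y\<bar> \<le> real (length y) * c"
  using order_trans[OF letter_sum_abs letter_sum_mono[of y _ "\<lambda>_. c"]] assms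
  by (simp add: letter_sum_const)

lemma letter_sum_nonneg:
  assumes "\<And>a. a \<in> set y \<Longrightarrow> 0 \<le> f a"
  shows "0 \<le> letter_sum f y"
  using letter_sum_mono[of y "\<lambda>_. 0" f] assms letter_sum_const[of 0 y] by simp

lemma letter_le_letter_sum:
  assumes "\<And>a. a \<in> set y \<Longrightarrow> 0 \<le> f a" "b \<in> set y"
  shows "f b \<le> letter_sum f y"
proof -
  obtain u v where y: "y = u @ b # v" using assms(2) split_list by metis
  have "0 \<le> letter_sum f u" "0 \<le> letter_sum f v"
    by (rule letter_sum_nonneg; use assms y in auto)+
  then show ?thesis by (simp add: y)
qed

lemma reduced_Nil [simp]: "[] \<in> reduced_words D I"
  by (simp add: reduced_words_def)

lemma reduced_Cons_iff:
  "(i, d) # w \<in> reduced_words D I \<longleftrightarrow> i \<in> I \<and> d \<in> carrier D \<and> d \<noteq> \<one>\<^bsub>D\<^esub> \<and>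
     w \<in> reduced_words D I \<and> (w = [] \<or> fst (hd w) \<noteq> i)"
  by (cases w) (auto simp: reduced_words_def)

lemma reduced_append_iff:
  "u @ v \<in> reduced_words D I \<longleftrightarrow> u \<in> reduced_words D I \<and> v \<in> reduced_words D I \<and>
     (u = [] \<or> v = [] \<or> fst (last u) \<noteq> fst (hd v))"
  by (auto simp: reduced_words_def distinct_adj_append_iff last_map hd_map)

lemma word_mult_append:
  assumes "u @ v \<in> reduced_words D I"
  shows "word_mult D u v = u @ v"
  using assms
proof (induction u)
  case (Cons a u)
  obtain i d where a: "a = (i, d)" by (cases a)
  have r: "u @ v \<in> reduced_words D I" "u @ v = [] \<or> fst (hd (u @ v)) \<noteq> i"
    using Cons.prems by (auto simp: a reduced_Cons_iff)
  have "letter_mult D (i, d) w = (i, d) # w" if "w = [] \<or> fst (hd w) \<noteq> i" for w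
    using that by (cases w) auto
  then show ?case using r Cons.IH by (simp add: a)
qed simp

lemma word_mult_Nil: "u \<in> reduced_words D I \<Longrightarrow> word_mult D u [] = u"
  using word_mult_append[of u "[]"] by simp

lemma reduced_letter:
  assumes "w \<in> reduced_words D I" "(i, d) \<in> set w"
  shows "i \<in> I" "d \<in> carrier D" "d \<noteq> \<one>\<^bsub>D\<^esub>"
  using assms by (auto simp: reduced_words_def)

text \<open>Multiplying by a letter in a fixed copy changes a letter sum boundedly: a letter is
  added, cancelled, or merged with a neighbour.\<close>

definition tame :: "('d, 'b) monoid_scheme \<Rightarrow> ('i \<times> 'd \<Rightarrow> real) \<Rightarrow> real \<Rightarrow> 'i \<times> 'd \<Rightarrow> bool" where
  "tame D f c = (\<lambda>(i, d). \<bar>f (i, d)\<bar> \<le> c \<and> \<bar>f (i, inv\<^bsub>D\<^esub> d)\<bar> \<le> c \<and>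
     (\<forall>e\<in>carrier D. \<bar>f (i, d \<otimes>\<^bsub>D\<^esub> e) - f (i, e)\<bar> \<le> c \<and> \<bar>f (i, e \<otimes>\<^bsub>D\<^esub> d) - f (i, e)\<bar> \<le> c))"

context group
begin

lemma letter_mult_reduced:
  assumes "i \<in> I" "d \<in> carrier G" "d \<noteq> \<one>" "w \<in> reduced_words G I"
  shows "letter_mult G (i, d) w \<in> reduced_words G I"
  using assms
  by (cases w) (auto simp: reduced_Cons_iff)

lemma word_mult_reduced:
  assumes "u \<in> reduced_words G I" "v \<in> reduced_words G I"
  shows "word_mult G u v \<in> reduced_words G I"
  using assms
proof (induction u)
  case (Cons a u)
  then show ?case by (cases a) (auto simp: reduced_Cons_iff intro!: letter_mult_reduced)
qed simp

lemma letter_sum_letter_mult: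
  assumes "d \<in> carrier G" "w \<in> reduced_words G I" "tame G f c (i, d)"
  shows "\<bar>letter_sum f (letter_mult G (i, d) w) - letter_sum f w\<bar> \<le> c"
proof (cases w)
  case Nil
  then show ?thesis using assms by (simp add: tame_def)
next
  case (Cons a w')
  obtain j e where a: "a = (j, e)" by (cases a)
  have e: "e \<in> carrier G" using assms(2) by (simp add: Cons a reduced_Cons_iff)
  have "e = inv d" if "d \<otimes> e = \<one>"
    using that e assms(1) by (metis inv_equality inv_inv inv_closed)
  then show ?thesis using assms(3) e by (auto simp: Cons a tame_def)
qed

lemma letter_sum_mult_left:
  assumes "x \<in> reduced_words G I" "y \<in> reduced_words G I" "\<And>a. a \<in> set x \<Longrightarrow> tame G f c a"
  shows "\<bar>letter_sum f (word_mult G x y) - letter_sum f y\<bar> \<le> real (length x) * c"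
  using assms
proof (induction x)
  case (Cons a x)
  obtain i d where a: "a = (i, d)" by (cases a)
  let ?w = "word_mult G x y"
  have x: "x \<in> reduced_words G I" "d \<in> carrier G" using Cons.prems by (auto simp: a reduced_Cons_iff)
  have "\<bar>letter_sum f (letter_mult G (i, d) ?w) - letter_sum f ?w\<bar> \<le> c"
    using x Cons.prems by (intro letter_sum_letter_mult word_mult_reduced) (auto simp: a)
  moreover have "\<bar>letter_sum f ?w - letter_sum f y\<bar> \<le> real (length x) * c"
    using Cons x by auto
  ultimately show ?case by (simp add: a algebra_simps)
qed simp

lemma letter_sum_mult_right:
  assumes "y \<in> reduced_words G I" "v \<in> reduced_words G I" "\<And>a. a \<in> set v \<Longrightarrow> tame G f c a"
  shows "\<bar>letter_sum f (word_mult G y v) - letter_sum f y\<bar> \<le> real (length v) * c"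
  using assms
proof (induction v arbitrary: y)
  case Nil
  then show ?case by (simp add: word_mult_Nil)
next
  case (Cons a v)
  obtain i d where a: "a = (i, d)" by (cases a)
  have v: "v \<in> reduced_words G I" "i \<in> I" "d \<in> carrier G" "d \<noteq> \<one>" "v = [] \<or> fst (hd v) \<noteq> i"
    using Cons.prems by (auto simp: a reduced_Cons_iff)
  have t: "\<And>a. a \<in> set v \<Longrightarrow> tame G f c a" "tame G f c (i, d)" using Cons.prems a by auto
  have f_le: "\<bar>f b\<bar> \<le> c" if "b \<in> set v" for b using t(1)[OF that] by (cases b) (simp add: tame_def)
  have fv: "\<bar>letter_sum f v\<bar> \<le> real (length v) * c" using f_le by (rule letter_sum_abs_le)
  show ?case
  proof (cases "y = [] \<or> fst (last y) \<noteq> i")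
    case True
    then have "word_mult G y (a # v) = y @ a # v"
      using Cons.prems by (intro word_mult_append) (auto simp: reduced_append_iff a)
    then show ?thesis using fv t(2) by (simp add: a tame_def algebra_simps abs_le_iff)
  next
    case False
    then obtain y' e where y: "y = y' @ [(i, e)]"
      by (metis append_butlast_last_id prod.collapse)
    have y': "y' \<in> reduced_words G I" "e \<in> carrier G" "e \<noteq> \<one>" "y' = [] \<or> fst (last y') \<noteq> i"
      using Cons.prems(1) by (auto simp: y reduced_append_iff reduced_Cons_iff)
    show ?thesis
    proof (cases "e \<otimes> d = \<one>")
      case True
      have "e = inv d" using True y' v by (simp add: inv_equality)
      moreover have "\<bar>letter_sum f (word_mult G y' v) - letter_sum f y'\<bar> \<le> real (length v) * c"
        by (rule Cons.IH[OF y'(1) v(1) t(1)])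
      moreover have "\<bar>f (i, inv d)\<bar> \<le> c" using t(2) by (simp add: tame_def)
      ultimately show ?thesis using True by (simp add: y a algebra_simps abs_le_iff)
    next
      case False
      then have "word_mult G y (a # v) = y' @ (i, e \<otimes> d) # v"
        using y' v
        by (simp add: y a) (subst word_mult_append, auto simp: reduced_append_iff reduced_Cons_iff)
      moreover have "\<bar>f (i, e \<otimes> d) - f (i, e)\<bar> \<le> c"
        using t(2) y'(2) by (auto simp: tame_def)
      ultimately show ?thesis using fv by (simp add: y a algebra_simps)
    qed
  qed
qed

end

lemma letter_sum_shift: "letter_sum f (shift \<phi> g y) = letter_sum (\<lambda>(i, d). f (\<phi> g i, d)) y"
  by (induction y) (auto simp: shift_def)

lemma length_shift [simp]: "length (shift \<phi> g y) = length y"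
  by (simp add: shift_def)

lemma length_eq_letter_sum: "real (length y) = letter_sum (\<lambda>_. 1) y"
  by (simp add: letter_sum_const)

context group_action
begin

lemma action_closed: "g \<in> carrier G \<Longrightarrow> x \<in> E \<Longrightarrow> \<phi> g x \<in> E"
  using element_image by blast

lemma shift_reduced:
  assumes "g \<in> carrier G" "y \<in> reduced_words D E"
  shows "shift \<phi> g y \<in> reduced_words D E"
  using assms(2)
proof (induction y)
  case (Cons a y)
  obtain i d where a: "a = (i, d)" by (cases a)
  have *: "y \<in> reduced_words D E" "i \<in> E" "d \<in> carrier D" "d \<noteq> \<one>\<^bsub>D\<^esub>" "y = [] \<or> fst (hd y) \<noteq> i"
    using Cons.prems by (auto simp: a reduced_Cons_iff)
  have "\<phi> g j \<noteq> \<phi> g i" if "y = (j, e) # y'" for j e y'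
    using inj_onD[OF inj_prop[OF assms(1)], of j i] * that by (auto simp: reduced_Cons_iff)
  with * Cons.IH show ?case
    by (cases y) (auto simp: a shift_def reduced_Cons_iff action_closed[OF assms(1)])
qed (simp add: shift_def)

lemma shift_letter_mult:
  assumes "g \<in> carrier G" "i \<in> E" "w \<in> reduced_words D E"
  shows "shift \<phi> g (letter_mult D (i, d) w) = letter_mult D (\<phi> g i, d) (shift \<phi> g w)"
proof (cases w)
  case (Cons a w')
  obtain j e where a: "a = (j, e)" by (cases a)
  have "j \<in> E" using assms(3) by (simp add: Cons a reduced_Cons_iff)
  then have "\<phi> g i = \<phi> g j \<longleftrightarrow> i = j"
    using inj_prop[OF assms(1)] assms(2) by (auto dest: inj_onD)
  then show ?thesis by (simp add: Cons a shift_def)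
qed (simp add: shift_def)

lemma shift_word_mult:
  assumes "group D" "g \<in> carrier G" "u \<in> reduced_words D E" "v \<in> reduced_words D E"
  shows "shift \<phi> g (word_mult D u v) = word_mult D (shift \<phi> g u) (shift \<phi> g v)"
  using assms(3)
proof (induction u)
  case (Cons a u)
  obtain i d where a: "a = (i, d)" by (cases a)
  have *: "u \<in> reduced_words D E" "i \<in> E" using Cons.prems by (auto simp: a reduced_Cons_iff)
  have "shift \<phi> g (letter_mult D (i, d) (word_mult D u v)) =
      letter_mult D (\<phi> g i, d) (shift \<phi> g (word_mult D u v))"
    using * assms by (intro shift_letter_mult group.word_mult_reduced) auto
  then show ?case using Cons.IH[OF *(1)] by (simp add: a shift_def)
qed (simp add: shift_def)

lemma shift_mult:
  assumes "g \<in> carrier G" "h \<in> carrier G" "y \<in> reduced_words D E"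
  shows "shift \<phi> (g \<otimes> h) y = shift \<phi> g (shift \<phi> h y)"
  using assms by (auto simp: shift_def composition_rule reduced_letter(1))

lemma shift_one:
  assumes "y \<in> reduced_words D E"
  shows "shift \<phi> \<one> y = y"
  using assms unfolding shift_def
  by (intro map_idI) (auto simp: reduced_words_def simp flip: id_eq_one)

end

section \<open>Weights on the semidirect product\<close>

lemma slow_growth:
  fixes C \<epsilon> :: real
  assumes "0 \<le> C" "\<epsilon> > 0"
  obtains K where "K > 0" "\<And>n w. 0 \<le> n \<Longrightarrow> n\<^sup>2 \<le> w \<Longrightarrow> w > K \<Longrightarrow> C * (n + 1) \<le> \<epsilon> * w"
proof
  let ?K = "max 1 ((2 * C / \<epsilon>)\<^sup>2)"
  show "?K > 0" by simp
  fix n w :: real assume n: "0 \<le> n" "n\<^sup>2 \<le> w" "w > ?K"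
  have w: "1 \<le> w" "(2 * C / \<epsilon>)\<^sup>2 \<le> w" using n by auto
  have "n + 1 \<le> 2 * sqrt w" using real_le_rsqrt[OF n(2)] real_sqrt_ge_one[OF w(1)] by linarith
  then have "C * (n + 1) \<le> (2 * C) * sqrt w" using assms(1) mult_left_mono by fastforce
  also have "\<dots> \<le> (\<epsilon> * sqrt w) * sqrt w"
  proof (rule mult_right_mono)
    show "2 * C \<le> \<epsilon> * sqrt w" using real_le_rsqrt[OF w(2)] assms(2) by (simp add: field_simps)
  qed (use w in auto)
  also have "\<dots> = \<epsilon> * w" using w by simp
  finally show "C * (n + 1) \<le> \<epsilon> * w" .
qed

lemma normalize_diff:
  fixes w w' :: real
  assumes "finite U" "w > 0" "w' \<ge> 0" "\<And>t. t \<in> U \<Longrightarrow> 0 \<le> f' t" "sum f' U \<le> w'"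
  shows "(\<Sum>t\<in>U. \<bar>f t / w - f' t / w'\<bar>) \<le> ((\<Sum>t\<in>U. \<bar>f t - f' t\<bar>) + \<bar>w - w'\<bar>) / w"
proof (cases "w' = 0")
  case True
  then have "f' t = 0" if "t \<in> U" for t
    using assms that sum_nonneg_0[of U f'] sum_nonneg[of U f'] by (metis order_antisym)
  then have "(\<Sum>t\<in>U. \<bar>f t / w - f' t / w'\<bar>) = (\<Sum>t\<in>U. \<bar>f t - f' t\<bar>) / w"
    using assms(2) by (simp add: sum_divide_distrib)
  then show ?thesis using assms(2) by (simp add: divide_right_mono)
next
  case False
  then have w': "w' > 0" using assms(3) by simp
  have "\<bar>f t / w - f' t / w'\<bar> \<le> \<bar>f t - f' t\<bar> / w + f' t * (\<bar>w - w'\<bar> / (w * w'))" if "t \<in> U" for t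
  proof -
    have "f t / w - f' t / w' = (f t - f' t) / w + f' t * ((w' - w) / (w * w'))"
      using assms(2) w' by (simp add: field_simps)
    also have "\<bar>\<dots>\<bar> \<le> \<bar>(f t - f' t) / w\<bar> + \<bar>f' t * ((w' - w) / (w * w'))\<bar>"
      by (rule abs_triangle_ineq)
    also have "\<dots> = \<bar>f t - f' t\<bar> / w + f' t * (\<bar>w - w'\<bar> / (w * w'))"
      using assms(2,4) w' that by (simp add: abs_mult abs_minus_commute)
    finally show ?thesis .
  qed
  then have "(\<Sum>t\<in>U. \<bar>f t / w - f' t / w'\<bar>) \<le>
      (\<Sum>t\<in>U. \<bar>f t - f' t\<bar> / w + f' t * (\<bar>w - w'\<bar> / (w * w')))"
    by (rule sum_mono)
  also have "\<dots> = (\<Sum>t\<in>U. \<bar>f t - f' t\<bar>) / w + sum f' U * (\<bar>w - w'\<bar> / (w * w'))"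
    by (simp add: sum.distrib sum_divide_distrib sum_distrib_right)
  also have "\<dots> \<le> (\<Sum>t\<in>U. \<bar>f t - f' t\<bar>) / w + w' * (\<bar>w - w'\<bar> / (w * w'))"
    using assms w' by (intro add_left_mono mult_right_mono) auto
  also have "\<dots> = ((\<Sum>t\<in>U. \<bar>f t - f' t\<bar>) + \<bar>w - w'\<bar>) / w"
    using assms(2) w' by (simp add: field_simps)
  finally show ?thesis .
qed

locale wreath_lengths =
  \<Gamma>: group \<Gamma> + \<Delta>: group \<Delta> + act: group_action \<Gamma> I \<phi>
  for \<Gamma> :: "('g, 'b) monoid_scheme" and \<Delta> :: "('d, 'c) monoid_scheme"
    and I :: "'i set" and \<phi> :: "'g \<Rightarrow> 'i \<Rightarrow> 'i" +
  fixes L :: "'g \<Rightarrow> nat" and LD :: "'d \<Rightarrow> nat" and l :: "'i \<Rightarrow> nat"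
  assumes LD_finite: "finite {d \<in> carrier \<Delta>. LD d \<le> n}"
    and LD_mult: "d \<in> carrier \<Delta> \<Longrightarrow> e \<in> carrier \<Delta> \<Longrightarrow> LD (d \<otimes>\<^bsub>\<Delta>\<^esub> e) \<le> LD d + LD e"
    and l_finite: "finite {i \<in> I. l i \<le> n}"
    and l_act: "g \<in> carrier \<Gamma> \<Longrightarrow> i \<in> I \<Longrightarrow> l (\<phi> g i) \<le> L g + l i"
begin

abbreviation X where "X \<equiv> carrier (free_wreath \<Gamma> \<Delta> I \<phi>)"
abbreviation words where "words \<equiv> reduced_words \<Delta> I"

lemma X_eq: "X = words \<times> carrier \<Gamma>"
  by (simp add: free_wreath_def semidirect_product_def free_product_def)

definition weight :: "'g \<Rightarrow> 'i \<times> 'd \<Rightarrow> real" where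
  "weight g = (\<lambda>(i, d). real (LD d) + real (min (l i) (l (\<phi> (inv\<^bsub>\<Gamma>\<^esub> g) i))))"

text \<open>The summand \<open>length y\<close> makes the number of letters, and with it the effect of a bounded
  change of every weight, negligible compared to the total weight.\<close>

definition N :: "('i \<Rightarrow> 'i \<Rightarrow> real) \<Rightarrow> ('i \<times> 'd) list \<times> 'g \<Rightarrow> real" where
  "N q = (\<lambda>(y, g). letter_sum (\<lambda>(i, d). (weight g (i, d) + length y) * q i (\<phi> (inv\<^bsub>\<Gamma>\<^esub> g) i)) y)"

abbreviation W where "W \<equiv> N (\<lambda>_ _. 1)"

definition transl :: "('i \<times> 'd) list \<Rightarrow> ('i \<times> 'd) list \<Rightarrow> 'g \<Rightarrow> ('i \<times> 'd) list \<times> 'g \<Rightarrow> ('i \<times> 'd) list \<times> 'g"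
  where "transl x u h = (\<lambda>(y, g). (word_mult \<Delta> (word_mult \<Delta> x y) (shift \<phi> g u), g \<otimes>\<^bsub>\<Gamma>\<^esub> h))"

definition \<rho> :: "'g \<Rightarrow> 'g \<Rightarrow> ('i \<times> 'd) list \<times> 'g \<Rightarrow> ('i \<times> 'd) list \<times> 'g" where
  "\<rho> k m = (\<lambda>(y, g). (shift \<phi> k y, k \<otimes>\<^bsub>\<Gamma>\<^esub> g \<otimes>\<^bsub>\<Gamma>\<^esub> inv\<^bsub>\<Gamma>\<^esub> m))"

lemma weight_nonneg: "0 \<le> weight g a"
  by (cases a) (simp add: weight_def)

lemma inv_act: "g \<in> carrier \<Gamma> \<Longrightarrow> i \<in> I \<Longrightarrow> \<phi> (inv\<^bsub>\<Gamma>\<^esub> g) i \<in> I"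
  by (simp add: act.action_closed)

lemma N_split:
  "N q (y, g) = letter_sum (\<lambda>(i, d). weight g (i, d) * q i (\<phi> (inv\<^bsub>\<Gamma>\<^esub> g) i)) y +
     length y * letter_sum (\<lambda>(i, d). q i (\<phi> (inv\<^bsub>\<Gamma>\<^esub> g) i)) y"
  unfolding N_def letter_sum_cmult[symmetric] letter_sum_add[symmetric]
  by (auto simp: algebra_simps intro!: letter_sum_cong)

lemma length_le_W: "(real (length y))\<^sup>2 \<le> W (y, g)"
proof -
  have "0 \<le> letter_sum (weight g) y" by (rule letter_sum_nonneg) (rule weight_nonneg)
  then show ?thesis
    by (simp add: N_split letter_sum_const power2_eq_square case_prod_unfold)
qed

lemma W_nonneg: "0 \<le> W z"
  using length_le_W[of "fst z" "snd z"] by (metis order_trans prod.collapse zero_le_power2)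

lemma
  assumes "z \<in> X" "\<And>i j. i \<in> I \<Longrightarrow> j \<in> I \<Longrightarrow> 0 \<le> q i j \<and> q i j \<le> 1"
  shows N_nonneg: "0 \<le> N q z" and N_le_W: "N q z \<le> W z"
proof -
  obtain y g where z: "z = (y, g)" "y \<in> words" "g \<in> carrier \<Gamma>"
    using assms(1) by (auto simp: X_eq)
  have q: "0 \<le> q i (\<phi> (inv\<^bsub>\<Gamma>\<^esub> g) i) \<and> q i (\<phi> (inv\<^bsub>\<Gamma>\<^esub> g) i) \<le> 1" if "(i, d) \<in> set y" for i d
    using assms(2) reduced_letter(1)[OF z(2) that] inv_act[OF z(3)] by blast
  show "0 \<le> N q z"
    unfolding z(1) N_def using q weight_nonneg by (auto intro!: letter_sum_nonneg)
  show "N q z \<le> W z"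
    unfolding z(1) N_def using q weight_nonneg by (auto intro!: letter_sum_mono mult_left_le)
qed

lemma sum_N: "(\<Sum>t\<in>U. N (p t) z) = N (\<lambda>i j. \<Sum>t\<in>U. p t i j) z"
  by (cases z) (auto simp: N_def sum_letter_sum sum_distrib_left intro!: letter_sum_cong)

lemma N_cong:
  assumes "z \<in> X" "\<And>i j. i \<in> I \<Longrightarrow> j \<in> I \<Longrightarrow> q i j = q' i j"
  shows "N q z = N q' z"
proof -
  obtain y g where z: "z = (y, g)" "y \<in> words" "g \<in> carrier \<Gamma>"
    using assms(1) by (auto simp: X_eq)
  show ?thesis
    unfolding z(1) N_def using assms(2) reduced_letter(1)[OF z(2)] inv_act[OF z(3)]
    by (auto intro!: letter_sum_cong)
qed

lemma transl_closed:
  assumes "x \<in> words" "u \<in> words" "h \<in> carrier \<Gamma>"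
  shows "transl x u h \<in> X \<rightarrow> X"
  using assms by (auto simp: X_eq transl_def intro!: \<Delta>.word_mult_reduced act.shift_reduced)

lemma \<rho>_closed:
  assumes "k \<in> carrier \<Gamma>" "m \<in> carrier \<Gamma>"
  shows "\<rho> k m \<in> X \<rightarrow> X"
  using assms by (auto simp: X_eq \<rho>_def intro!: act.shift_reduced)

lemma \<rho>_inverse:
  assumes "k \<in> carrier \<Gamma>" "m \<in> carrier \<Gamma>" "z \<in> X"
  shows "\<rho> (inv\<^bsub>\<Gamma>\<^esub> k) (inv\<^bsub>\<Gamma>\<^esub> m) (\<rho> k m z) = z"
proof -
  obtain y g where z: "z = (y, g)" "y \<in> words" "g \<in> carrier \<Gamma>"
    using assms(3) by (auto simp: X_eq)
  have "inv\<^bsub>\<Gamma>\<^esub> k \<otimes>\<^bsub>\<Gamma>\<^esub> (k \<otimes>\<^bsub>\<Gamma>\<^esub> g \<otimes>\<^bsub>\<Gamma>\<^esub> inv\<^bsub>\<Gamma>\<^esub> m) = g \<otimes>\<^bsub>\<Gamma>\<^esub> inv\<^bsub>\<Gamma>\<^esub> m"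
    using assms z by (simp flip: \<Gamma>.m_assoc)
  moreover have "shift \<phi> (inv\<^bsub>\<Gamma>\<^esub> k) (shift \<phi> k y) = y"
    using assms z by (simp add: act.shift_one flip: act.shift_mult)
  ultimately show ?thesis using assms z by (simp add: \<rho>_def \<Gamma>.m_assoc)
qed

lemma \<rho>_transl:
  assumes "k \<in> carrier \<Gamma>" "m \<in> carrier \<Gamma>" "x \<in> words" "u \<in> words" "h \<in> carrier \<Gamma>" "z \<in> X"
  shows "\<rho> k m (transl x u h z) =
    transl (shift \<phi> k x) (shift \<phi> m u) (m \<otimes>\<^bsub>\<Gamma>\<^esub> h \<otimes>\<^bsub>\<Gamma>\<^esub> inv\<^bsub>\<Gamma>\<^esub> m) (\<rho> k m z)"
proof -
  obtain y g where z: "z = (y, g)" "y \<in> words" "g \<in> carrier \<Gamma>"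
    using assms(6) by (auto simp: X_eq)
  have "k \<otimes>\<^bsub>\<Gamma>\<^esub> g = k \<otimes>\<^bsub>\<Gamma>\<^esub> g \<otimes>\<^bsub>\<Gamma>\<^esub> inv\<^bsub>\<Gamma>\<^esub> m \<otimes>\<^bsub>\<Gamma>\<^esub> m"
    using assms z by (simp add: \<Gamma>.m_assoc)
  then have "shift \<phi> k (shift \<phi> g u) = shift \<phi> (k \<otimes>\<^bsub>\<Gamma>\<^esub> g \<otimes>\<^bsub>\<Gamma>\<^esub> inv\<^bsub>\<Gamma>\<^esub> m) (shift \<phi> m u)"
    using assms z by (simp flip: act.shift_mult)
  then have "shift \<phi> k (word_mult \<Delta> (word_mult \<Delta> x y) (shift \<phi> g u)) =
      word_mult \<Delta> (word_mult \<Delta> (shift \<phi> k x) (shift \<phi> k y))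
        (shift \<phi> (k \<otimes>\<^bsub>\<Gamma>\<^esub> g \<otimes>\<^bsub>\<Gamma>\<^esub> inv\<^bsub>\<Gamma>\<^esub> m) (shift \<phi> m u))"
    using assms z
    by (simp add: act.shift_word_mult \<Delta>.is_group \<Delta>.word_mult_reduced act.shift_reduced)
  moreover have "k \<otimes>\<^bsub>\<Gamma>\<^esub> (g \<otimes>\<^bsub>\<Gamma>\<^esub> h) \<otimes>\<^bsub>\<Gamma>\<^esub> inv\<^bsub>\<Gamma>\<^esub> m =
      k \<otimes>\<^bsub>\<Gamma>\<^esub> g \<otimes>\<^bsub>\<Gamma>\<^esub> inv\<^bsub>\<Gamma>\<^esub> m \<otimes>\<^bsub>\<Gamma>\<^esub> (m \<otimes>\<^bsub>\<Gamma>\<^esub> h \<otimes>\<^bsub>\<Gamma>\<^esub> inv\<^bsub>\<Gamma>\<^esub> m)"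
  proof -
    have "inv\<^bsub>\<Gamma>\<^esub> m \<otimes>\<^bsub>\<Gamma>\<^esub> (m \<otimes>\<^bsub>\<Gamma>\<^esub> (h \<otimes>\<^bsub>\<Gamma>\<^esub> inv\<^bsub>\<Gamma>\<^esub> m)) = h \<otimes>\<^bsub>\<Gamma>\<^esub> inv\<^bsub>\<Gamma>\<^esub> m"
      using assms by (simp flip: \<Gamma>.m_assoc)
    then show ?thesis using assms z by (simp add: \<Gamma>.m_assoc)
  qed
  ultimately show ?thesis by (simp add: z(1) transl_def \<rho>_def)
qed

lemma weight_tame:
  assumes "d \<in> carrier \<Delta>" "0 \<le> r i" "r i \<le> 1" "min (l i) (l (\<phi> (inv\<^bsub>\<Gamma>\<^esub> g) i)) \<le> m"
    and "real (m + LD d + LD (inv\<^bsub>\<Delta>\<^esub> d)) \<le> c"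
  shows "tame \<Delta> (\<lambda>(i, d). weight g (i, d) * r i) c (i, d)"
proof -
  define w where "w = real (min (l i) (l (\<phi> (inv\<^bsub>\<Gamma>\<^esub> g) i)))"
  have w: "0 \<le> w" "w \<le> m" using assms(4) by (auto simp: w_def simp flip: of_nat_min)
  have wt: "weight g (i, e) = LD e + w" for e by (simp add: weight_def w_def)
  have 1: "\<bar>weight g (i, e) * r i\<bar> \<le> c" if "LD e + m \<le> c" for e
  proof -
    have "\<bar>weight g (i, e) * r i\<bar> \<le> weight g (i, e) * 1"
      using assms(2,3) weight_nonneg[of g] by (simp add: abs_mult mult_left_le)
    then show ?thesis using that w by (simp add: wt)
  qed
  have 2: "\<bar>weight g (i, e') * r i - weight g (i, e) * r i\<bar> \<le> c" if "\<bar>real (LD e') - real (LD e)\<bar> \<le> c" for e e'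
  proof -
    have "\<bar>weight g (i, e') * r i - weight g (i, e) * r i\<bar> = \<bar>real (LD e') - real (LD e)\<bar> * r i"
      using assms(2) by (simp add: wt abs_mult flip: left_diff_distrib)
    also have "\<dots> \<le> \<bar>real (LD e') - real (LD e)\<bar>" using assms(2,3) by (simp add: mult_left_le)
    finally show ?thesis using that by simp
  qed
  have "\<bar>real (LD (d \<otimes>\<^bsub>\<Delta>\<^esub> e)) - real (LD e)\<bar> \<le> c" "\<bar>real (LD (e \<otimes>\<^bsub>\<Delta>\<^esub> d)) - real (LD e)\<bar> \<le> c"
    if e: "e \<in> carrier \<Delta>" for e
  proof -
    have "LD e \<le> LD (inv\<^bsub>\<Delta>\<^esub> d) + LD (d \<otimes>\<^bsub>\<Delta>\<^esub> e)" "LD e \<le> LD (e \<otimes>\<^bsub>\<Delta>\<^esub> d) + LD (inv\<^bsub>\<Delta>\<^esub> d)"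
      using LD_mult[of "inv\<^bsub>\<Delta>\<^esub> d" "d \<otimes>\<^bsub>\<Delta>\<^esub> e"] LD_mult[of "e \<otimes>\<^bsub>\<Delta>\<^esub> d" "inv\<^bsub>\<Delta>\<^esub> d"] e assms(1)
      by (simp_all add: \<Delta>.m_assoc) (simp flip: \<Delta>.m_assoc)
    then show "\<bar>real (LD (d \<otimes>\<^bsub>\<Delta>\<^esub> e)) - real (LD e)\<bar> \<le> c" "\<bar>real (LD (e \<otimes>\<^bsub>\<Delta>\<^esub> d)) - real (LD e)\<bar> \<le> c"
      using LD_mult[OF assms(1) e] LD_mult[OF e assms(1)] assms(5) by linarith+
  qed
  then show ?thesis
    using 1 2 assms(5) by (simp add: tame_def)
qed

lemma N_transl:
  assumes x: "x \<in> words" and u: "u \<in> words" and h: "h \<in> carrier \<Gamma>"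
    and q: "\<And>i j. i \<in> I \<Longrightarrow> j \<in> I \<Longrightarrow> 0 \<le> q i j \<and> q i j \<le> 1"
    and qh: "\<And>i j. i \<in> I \<Longrightarrow> j \<in> I \<Longrightarrow> q i (\<phi> (inv\<^bsub>\<Gamma>\<^esub> h) j) = q i j"
  obtains C where "0 \<le> C"
    "\<And>y g. (y, g) \<in> X \<Longrightarrow> \<bar>N q (transl x u h (y, g)) - N q (y, g)\<bar> \<le> C * (real (length y) + 1)"
proof -
  define cl where "cl = (\<lambda>(i, d). real (l i + LD d + LD (inv\<^bsub>\<Delta>\<^esub> d)))"
  define c where "c = letter_sum cl x + letter_sum cl u"
  have cl: "0 \<le> cl a" for a by (cases a) (simp add: cl_def)
  then have "0 \<le> letter_sum cl x" "0 \<le> letter_sum cl u" by (simp_all add: letter_sum_nonneg)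
  then have c: "cl a \<le> c" if "a \<in> set x \<union> set u" for a
    using that letter_le_letter_sum[of x cl a] letter_le_letter_sum[of u cl a] cl by (auto simp: c_def)
  have c0: "0 \<le> c" using \<open>0 \<le> letter_sum cl x\<close> \<open>0 \<le> letter_sum cl u\<close> by (simp add: c_def)
  define k where "k = real (length x) + real (length u)"
  have k0: "0 \<le> k" by (simp add: k_def)
  define lh where "lh = real (L h) + real (L (inv\<^bsub>\<Gamma>\<^esub> h))"
  define C where "C = k * c + k + k * k + k + lh + k * lh"
  have "0 \<le> C" using k0 c0 by (simp add: C_def lh_def)
  moreover have "\<bar>N q (transl x u h (y, g)) - N q (y, g)\<bar> \<le> C * (real (length y) + 1)"
    if yg: "(y, g) \<in> X" for y g
  proof -
    have y: "y \<in> words" and g: "g \<in> carrier \<Gamma>" using yg by (auto simp: X_eq)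
    define y' where "y' = word_mult \<Delta> (word_mult \<Delta> x y) (shift \<phi> g u)"
    have gu: "shift \<phi> g u \<in> words" by (rule act.shift_reduced[OF g u])
    have xy: "word_mult \<Delta> x y \<in> words" by (rule \<Delta>.word_mult_reduced[OF x y])
    have y': "y' \<in> words" unfolding y'_def by (rule \<Delta>.word_mult_reduced[OF xy gu])
    define r where "r i = q i (\<phi> (inv\<^bsub>\<Gamma>\<^esub> g) i)" for i
    have r: "0 \<le> r i" "r i \<le> 1" if "i \<in> I" for i
      using q[OF that inv_act[OF g that]] by (auto simp: r_def)
    then have r_abs: "\<bar>r i\<bar> \<le> 1" if "i \<in> I" for i using that by auto
    have change: "\<bar>letter_sum f y' - letter_sum f y\<bar> \<le> k * c'"
      if "\<And>a. a \<in> set x \<Longrightarrow> tame \<Delta> f c' a" "\<And>a. a \<in> set (shift \<phi> g u) \<Longrightarrow> tame \<Delta> f c' a" for f c'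
      using \<Delta>.letter_sum_mult_left[OF x y that(1)] \<Delta>.letter_sum_mult_right[OF xy gu that(2)]
      by (auto simp: y'_def k_def algebra_simps abs_le_iff)
    let ?a = "\<lambda>(i, d). weight g (i, d) * r i"
    let ?b = "\<lambda>(i, d :: 'd). r i"
    have gu_mem: "\<exists>j. (j, d) \<in> set u \<and> i = \<phi> g j" if "(i, d) \<in> set (shift \<phi> g u)" for i d
      using that by (auto simp: shift_def)
    have A: "\<bar>letter_sum ?a y' - letter_sum ?a y\<bar> \<le> k * c"
    proof (rule change)
      fix a assume a: "a \<in> set x"
      obtain i d where [simp]: "a = (i, d)" by (cases a)
      show "tame \<Delta> ?a c a"
        using c[of a] a reduced_letter[OF x, of i d] r by (auto intro!: weight_tame[where m = "l i"] simp: cl_def)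
    next
      fix a assume a: "a \<in> set (shift \<phi> g u)"
      obtain i d where [simp]: "a = (i, d)" by (cases a)
      obtain j where j: "(j, d) \<in> set u" "i = \<phi> g j" using gu_mem a by auto
      have "\<phi> (inv\<^bsub>\<Gamma>\<^esub> g) i = j" "i \<in> I"
        using act.orbit_sym_aux[OF g _ j(2)[symmetric]] reduced_letter[OF u j(1)] g j(2) act.action_closed by auto
      then show "tame \<Delta> ?a c a"
        using c[of "(j, d)"] j reduced_letter[OF u j(1)] r by (auto intro!: weight_tame[where m = "l j"] simp: cl_def)
    qed
    have B: "\<bar>letter_sum ?b y' - letter_sum ?b y\<bar> \<le> k * 1"
    proof (rule change)
      fix a assume "a \<in> set x"
      then show "tame \<Delta> ?b 1 a" using reduced_letter(1)[OF x] r_abs by (cases a) (auto simp: tame_def)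
    next
      fix a assume "a \<in> set (shift \<phi> g u)"
      then show "tame \<Delta> ?b 1 a" using reduced_letter(1)[OF gu] r_abs by (cases a) (auto simp: tame_def)
    qed
    have len: "\<bar>real (length y') - real (length y)\<bar> \<le> k * 1"
      unfolding length_eq_letter_sum by (rule change) (auto simp: tame_def)
    define n where "n = real (length y)"
    define n' where "n' = real (length y')"
    have nn: "0 \<le> n" "\<bar>n' - n\<bar> \<le> k" using len by (auto simp: n_def n'_def)
    have By: "\<bar>letter_sum ?b y\<bar> \<le> n * 1"
      unfolding n_def by (rule letter_sum_abs_le) (use reduced_letter(1)[OF y] r in auto)
    have nB: "\<bar>n' * letter_sum ?b y' - n * letter_sum ?b y\<bar> \<le> (n + k) * k + k * n"
    proof -
      have "n' * letter_sum ?b y' - n * letter_sum ?b y =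
          n' * (letter_sum ?b y' - letter_sum ?b y) + (n' - n) * letter_sum ?b y"
        by (simp add: algebra_simps)
      also have "\<bar>\<dots>\<bar> \<le> \<bar>n'\<bar> * \<bar>letter_sum ?b y' - letter_sum ?b y\<bar> + \<bar>n' - n\<bar> * \<bar>letter_sum ?b y\<bar>"
        by (metis abs_mult abs_triangle_ineq)
      also have "\<dots> \<le> (n + k) * k + k * n"
        using nn B By k0 by (intro add_mono mult_mono) auto
      finally show ?thesis .
    qed
    have N1: "\<bar>N q (y', g) - N q (y, g)\<bar> \<le> k * c + (n + k) * k + k * n"
      using A nB by (simp add: N_split r_def n_def n'_def abs_le_iff)
    have inv_gh: "\<phi> (inv\<^bsub>\<Gamma>\<^esub> (g \<otimes>\<^bsub>\<Gamma>\<^esub> h)) i = \<phi> (inv\<^bsub>\<Gamma>\<^esub> h) (\<phi> (inv\<^bsub>\<Gamma>\<^esub> g) i)" if "i \<in> I" for i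
      using that g h by (simp add: \<Gamma>.inv_mult_group act.composition_rule)
    have "\<bar>N q (y', g \<otimes>\<^bsub>\<Gamma>\<^esub> h) - N q (y', g)\<bar> \<le> n' * lh"
    proof -
      have "N q (y', g \<otimes>\<^bsub>\<Gamma>\<^esub> h) - N q (y', g) =
          letter_sum (\<lambda>(i, d). (weight (g \<otimes>\<^bsub>\<Gamma>\<^esub> h) (i, d) - weight g (i, d)) * r i) y'"
        unfolding N_def letter_sum_diff[symmetric] prod.case
      proof (rule letter_sum_cong)
        fix a assume a: "a \<in> set y'"
        obtain i d where [simp]: "a = (i, d)" by (cases a)
        have i: "i \<in> I" using reduced_letter(1)[OF y'] a by simp
        have "q i (\<phi> (inv\<^bsub>\<Gamma>\<^esub> (g \<otimes>\<^bsub>\<Gamma>\<^esub> h)) i) = r i"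
          using qh[OF i inv_act[OF g i]] inv_gh[OF i] by (simp add: r_def)
        then show "(case a of (i, d) \<Rightarrow> (weight (g \<otimes>\<^bsub>\<Gamma>\<^esub> h) (i, d) + length y') * q i (\<phi> (inv\<^bsub>\<Gamma>\<^esub> (g \<otimes>\<^bsub>\<Gamma>\<^esub> h)) i))
            - (case a of (i, d) \<Rightarrow> (weight g (i, d) + length y') * q i (\<phi> (inv\<^bsub>\<Gamma>\<^esub> g) i)) =
            (case a of (i, d) \<Rightarrow> (weight (g \<otimes>\<^bsub>\<Gamma>\<^esub> h) (i, d) - weight g (i, d)) * r i)"
          by (simp add: r_def algebra_simps)
      qed
      also have "\<bar>\<dots>\<bar> \<le> real (length y') * lh"
      proof (rule letter_sum_abs_le)
        fix a assume a: "a \<in> set y'"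
        obtain i d where [simp]: "a = (i, d)" by (cases a)
        have i: "i \<in> I" using reduced_letter(1)[OF y'] a by simp
        define j where "j = \<phi> (inv\<^bsub>\<Gamma>\<^esub> g) i"
        have j: "j \<in> I" using inv_act[OF g i] by (simp add: j_def)
        have "l (\<phi> (inv\<^bsub>\<Gamma>\<^esub> h) j) \<le> L (inv\<^bsub>\<Gamma>\<^esub> h) + l j" using l_act h j by simp
        moreover have "l j \<le> L h + l (\<phi> (inv\<^bsub>\<Gamma>\<^esub> h) j)"
          using l_act[OF h inv_act[OF h j]] h j by (simp flip: act.composition_rule act.id_eq_one)
        ultimately have "\<bar>weight (g \<otimes>\<^bsub>\<Gamma>\<^esub> h) (i, d) - weight g (i, d)\<bar> \<le> lh"
          by (simp add: weight_def inv_gh[OF i] lh_def flip: j_def)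
        then have "\<bar>weight (g \<otimes>\<^bsub>\<Gamma>\<^esub> h) (i, d) - weight g (i, d)\<bar> * r i \<le> lh * 1"
          using r[OF i] by (intro mult_mono) auto
        then show "\<bar>case a of (i, d) \<Rightarrow> (weight (g \<otimes>\<^bsub>\<Gamma>\<^esub> h) (i, d) - weight g (i, d)) * r i\<bar> \<le> lh"
          using r[OF i] by (simp add: abs_mult)
      qed
      finally show ?thesis by (simp add: n'_def)
    qed
    also have "n' * lh \<le> (n + k) * lh"
      using nn by (intro mult_right_mono) (auto simp: lh_def)
    finally have "\<bar>N q (y', g \<otimes>\<^bsub>\<Gamma>\<^esub> h) - N q (y, g)\<bar> \<le> k * c + (n + k) * k + k * n + (n + k) * lh"
      using N1 by linarith
    also have "\<dots> \<le> C * (n + 1)"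
    proof -
      have "0 \<le> n * (k * c)" "0 \<le> n * (k * k)" "0 \<le> n * (k * lh)" "0 \<le> k" "0 \<le> lh"
        using nn k0 c0 by (auto simp: lh_def)
      then show ?thesis by (simp add: C_def algebra_simps)
    qed
    finally show ?thesis by (simp add: transl_def n_def flip: y'_def)
  qed
  ultimately show ?thesis using that by blast
qed

end

lemma shift_Nil [simp]: "shift \<phi> g [] = []"
  by (simp add: shift_def)

context wreath_lengths
begin

lemma W_transl:
  assumes "x \<in> words" "u \<in> words" "h \<in> carrier \<Gamma>"
  obtains C where "0 \<le> C"
    "\<And>y g. (y, g) \<in> X \<Longrightarrow> \<bar>W (transl x u h (y, g)) - W (y, g)\<bar> \<le> C * (real (length y) + 1)"
  using N_transl[OF assms, of "\<lambda>_ _. 1"] by auto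

lemma length_slow:
  assumes "0 \<le> C" "\<epsilon> > 0"
  obtains K where "K > 0" "\<And>y g. W (y, g) > K \<Longrightarrow> C * (real (length y) + 1) \<le> \<epsilon> * W (y, g)"
proof -
  obtain K where "K > 0" "\<And>n w. 0 \<le> n \<Longrightarrow> n\<^sup>2 \<le> w \<Longrightarrow> w > K \<Longrightarrow> C * (n + 1) \<le> \<epsilon> * w"
    using slow_growth[OF assms] by metis
  then show ?thesis using that[of K] length_le_W by simp
qed

lemma W_proper:
  assumes "0 \<le> C" and \<tau>: "\<And>y g. (y, g) \<in> X \<Longrightarrow> \<bar>W (\<tau> (y, g)) - W (y, g)\<bar> \<le> C * (real (length y) + 1)"
  shows "\<exists>C'. \<forall>z\<in>X. W (\<tau> z) \<le> C0 \<longrightarrow> W z \<le> C'"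
proof -
  obtain K where K: "K > 0" "\<And>y g. W (y, g) > K \<Longrightarrow> C * (real (length y) + 1) \<le> 1 / 2 * W (y, g)"
    using length_slow[OF assms(1), of "1 / 2"] by auto
  have "W (y, g) \<le> max K (2 * C0)" if "(y, g) \<in> X" "W (\<tau> (y, g)) \<le> C0" for y g
    using K(2)[of y g] \<tau>[OF that(1)] that(2) by (cases "W (y, g) > K") auto
  then show ?thesis by (intro exI[of _ "max K (2 * C0)"]) auto
qed


definition act_const :: "'g \<Rightarrow> 'g \<Rightarrow> real" where
  "act_const k m = real (L k) + real (L (inv\<^bsub>\<Gamma>\<^esub> k)) + real (L m) + real (L (inv\<^bsub>\<Gamma>\<^esub> m))"

lemma l_act_diff:
  assumes "k \<in> carrier \<Gamma>" "i \<in> I"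
  shows "l (\<phi> k i) \<le> L k + l i" "l i \<le> L (inv\<^bsub>\<Gamma>\<^esub> k) + l (\<phi> k i)"
proof -
  show "l (\<phi> k i) \<le> L k + l i" using l_act assms by simp
  have "\<phi> (inv\<^bsub>\<Gamma>\<^esub> k) (\<phi> k i) = i" using act.orbit_sym_aux assms by blast
  then show "l i \<le> L (inv\<^bsub>\<Gamma>\<^esub> k) + l (\<phi> k i)"
    using l_act[of "inv\<^bsub>\<Gamma>\<^esub> k" "\<phi> k i"] assms act.action_closed by simp
qed

lemma sum_N_\<rho>:
  assumes k: "k \<in> carrier \<Gamma>" and m: "m \<in> carrier \<Gamma>" and yg: "(y, g) \<in> X"
    and close: "\<And>i j. i \<in> I \<Longrightarrow> j \<in> I \<Longrightarrow> (\<Sum>t\<in>U. \<bar>p t i j - p' t (\<phi> k i) (\<phi> m j)\<bar>) \<le> \<epsilon>"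
    and p': "\<And>t i j. t \<in> U \<Longrightarrow> i \<in> I \<Longrightarrow> j \<in> I \<Longrightarrow> 0 \<le> p' t i j"
      "\<And>i j. i \<in> I \<Longrightarrow> j \<in> I \<Longrightarrow> (\<Sum>t\<in>U. p' t i j) \<le> 1"
  shows "(\<Sum>t\<in>U. \<bar>N (p t) (y, g) - N (p' t) (\<rho> k m (y, g))\<bar>) \<le>
    \<epsilon> * W (y, g) + act_const k m * length y"
proof -
  have y: "y \<in> words" and g: "g \<in> carrier \<Gamma>" using yg by (auto simp: X_eq)
  define j where "j i = \<phi> (inv\<^bsub>\<Gamma>\<^esub> g) i" for i
  have jI: "j i \<in> I" if "i \<in> I" for i using inv_act[OF g that] by (simp add: j_def)
  define g' where "g' = k \<otimes>\<^bsub>\<Gamma>\<^esub> g \<otimes>\<^bsub>\<Gamma>\<^esub> inv\<^bsub>\<Gamma>\<^esub> m"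
  have inv_g': "\<phi> (inv\<^bsub>\<Gamma>\<^esub> g') (\<phi> k i) = \<phi> m (j i)" if "i \<in> I" for i
  proof -
    have "inv\<^bsub>\<Gamma>\<^esub> g' \<otimes>\<^bsub>\<Gamma>\<^esub> k = m \<otimes>\<^bsub>\<Gamma>\<^esub> inv\<^bsub>\<Gamma>\<^esub> g"
      using k m g by (simp add: g'_def \<Gamma>.inv_mult_group \<Gamma>.m_assoc)
    then show ?thesis
      using that k m g by (simp add: j_def g'_def flip: act.composition_rule)
  qed
  define w where "w = (\<lambda>(i, d). weight g (i, d) + real (length y))"
  define w' where "w' = (\<lambda>(i, d). weight g' (\<phi> k i, d) + real (length y))"
  have w: "0 \<le> w a" "0 \<le> w' a" for a
    by (cases a; simp add: w_def w'_def add_nonneg_nonneg weight_nonneg)+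
  have ww': "\<bar>w (i, d) - w' (i, d)\<bar> \<le> act_const k m" if i: "i \<in> I" for i d
    using l_act_diff[OF k i] l_act_diff[OF m jI[OF i]]
    by (simp add: w_def w'_def weight_def inv_g'[OF i] act_const_def flip: j_def)
  have "(\<Sum>t\<in>U. \<bar>N (p t) (y, g) - N (p' t) (\<rho> k m (y, g))\<bar>) =
      (\<Sum>t\<in>U. \<bar>letter_sum (\<lambda>(i, d). w (i, d) * p t i (j i) - w' (i, d) * p' t (\<phi> k i) (\<phi> m (j i))) y\<bar>)"
  proof (intro sum.cong refl arg_cong[where f = abs])
    fix t
    have "N (p' t) (\<rho> k m (y, g)) = letter_sum (\<lambda>(i, d). w' (i, d) * p' t (\<phi> k i) (\<phi> m (j i))) y"
      unfolding \<rho>_def prod.case N_def g'_def[symmetric] letter_sum_shift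
      by (rule letter_sum_cong) (use reduced_letter(1)[OF y] inv_g' in \<open>auto simp: w'_def\<close>)
    then show "N (p t) (y, g) - N (p' t) (\<rho> k m (y, g)) =
        letter_sum (\<lambda>(i, d). w (i, d) * p t i (j i) - w' (i, d) * p' t (\<phi> k i) (\<phi> m (j i))) y"
      by (simp add: N_def w_def j_def case_prod_unfold flip: letter_sum_diff)
  qed
  also have "\<dots> \<le> (\<Sum>t\<in>U. letter_sum (\<lambda>(i, d).
      w (i, d) * \<bar>p t i (j i) - p' t (\<phi> k i) (\<phi> m (j i))\<bar> + act_const k m * p' t (\<phi> k i) (\<phi> m (j i))) y)"
  proof (intro sum_mono order_trans[OF letter_sum_abs] letter_sum_mono)
    fix t a assume t: "t \<in> U" and a: "a \<in> set y"
    obtain i d where [simp]: "a = (i, d)" by (cases a)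
    have i: "i \<in> I" using reduced_letter(1)[OF y] a by simp
    define s s' where "s = p t i (j i)" and "s' = p' t (\<phi> k i) (\<phi> m (j i))"
    have s': "0 \<le> s'" unfolding s'_def using p'(1)[OF t] act.action_closed k m i jI by simp
    have "w (i, d) * s - w' (i, d) * s' = w (i, d) * (s - s') + (w (i, d) - w' (i, d)) * s'"
      by (simp add: algebra_simps)
    also have "\<bar>\<dots>\<bar> \<le> \<bar>w (i, d) * (s - s')\<bar> + \<bar>(w (i, d) - w' (i, d)) * s'\<bar>" by (rule abs_triangle_ineq)
    also have "\<dots> \<le> w (i, d) * \<bar>s - s'\<bar> + act_const k m * s'"
      using w s' ww'[OF i] by (simp add: abs_mult mult_right_mono)
    finally show "\<bar>case a of (i, d) \<Rightarrow> w (i, d) * p t i (j i) - w' (i, d) * p' t (\<phi> k i) (\<phi> m (j i))\<bar> \<le>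
        (case a of (i, d) \<Rightarrow> w (i, d) * \<bar>p t i (j i) - p' t (\<phi> k i) (\<phi> m (j i))\<bar> +
           act_const k m * p' t (\<phi> k i) (\<phi> m (j i)))"
      by (simp add: s_def s'_def)
  qed
  also have "\<dots> = letter_sum (\<lambda>(i, d).
      w (i, d) * (\<Sum>t\<in>U. \<bar>p t i (j i) - p' t (\<phi> k i) (\<phi> m (j i))\<bar>) +
      act_const k m * (\<Sum>t\<in>U. p' t (\<phi> k i) (\<phi> m (j i)))) y"
    unfolding sum_letter_sum
    by (rule letter_sum_cong) (auto simp: sum.distrib sum_distrib_left)
  also have "\<dots> \<le> letter_sum (\<lambda>a. \<epsilon> * w a + act_const k m) y"
  proof (rule letter_sum_mono)
    fix a assume a: "a \<in> set y"
    obtain i d where [simp]: "a = (i, d)" by (cases a)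
    have i: "i \<in> I" using reduced_letter(1)[OF y] a by simp
    have "w (i, d) * (\<Sum>t\<in>U. \<bar>p t i (j i) - p' t (\<phi> k i) (\<phi> m (j i))\<bar>) \<le> w (i, d) * \<epsilon>"
      using close[OF i jI[OF i]] w by (intro mult_left_mono) auto
    moreover have "act_const k m * (\<Sum>t\<in>U. p' t (\<phi> k i) (\<phi> m (j i))) \<le> act_const k m * 1"
      using p'(2) act.action_closed k m i jI by (intro mult_left_mono) (auto simp: act_const_def)
    ultimately show "(case a of (i, d) \<Rightarrow> w (i, d) * (\<Sum>t\<in>U. \<bar>p t i (j i) - p' t (\<phi> k i) (\<phi> m (j i))\<bar>) +
      act_const k m * (\<Sum>t\<in>U. p' t (\<phi> k i) (\<phi> m (j i)))) \<le> \<epsilon> * w a + act_const k m"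
      by (simp add: mult.commute)
  qed
  also have "\<dots> = \<epsilon> * W (y, g) + act_const k m * length y"
    by (simp add: letter_sum_add letter_sum_cmult letter_sum_const N_def w_def case_prod_unfold mult.commute)
  finally show ?thesis .
qed

lemma W_\<rho>:
  assumes "k \<in> carrier \<Gamma>" "m \<in> carrier \<Gamma>" "(y, g) \<in> X"
  shows "\<bar>W (\<rho> k m (y, g)) - W (y, g)\<bar> \<le> act_const k m * length y"
  using sum_N_\<rho>[OF assms, where U = "{()}" and p = "\<lambda>_ _ _. 1" and p' = "\<lambda>_ _ _. 1" and \<epsilon> = 0] by (simp add: abs_minus_commute)

lemma act_const_nonneg: "0 \<le> act_const k m"
  by (simp add: act_const_def)

theorem amenable_weighted:
  fixes H (structure) and P
  assumes H: "group H" "countable (carrier H)"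
    and a: "a \<in> hom H \<Gamma>" and b: "b \<in> hom H \<Gamma>"
    and P_sub: "P \<subseteq> words \<times> words \<times> carrier \<Gamma>"
    and P_conj: "\<And>\<gamma> x u h. \<gamma> \<in> carrier H \<Longrightarrow> (x, u, h) \<in> P \<Longrightarrow>
      (shift \<phi> (a \<gamma>) x, shift \<phi> (b \<gamma>) u, b \<gamma> \<otimes>\<^bsub>\<Gamma>\<^esub> h \<otimes>\<^bsub>\<Gamma>\<^esub> inv\<^bsub>\<Gamma>\<^esub> (b \<gamma>)) \<in> P"
    and \<alpha>: "\<And>\<gamma> f. \<gamma> \<in> carrier H \<Longrightarrow> f \<in> bounded_functions X \<Longrightarrow>
      \<alpha> (inv \<gamma>) f = (\<lambda>z\<in>X. f (\<rho> (a \<gamma>) (b \<gamma>) z))"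
    and ex: "\<And>Q \<epsilon>. finite Q \<Longrightarrow> Q \<subseteq> carrier H \<Longrightarrow> \<epsilon> > 0 \<Longrightarrow>
      \<exists>\<nu> T. finite T \<and> T \<subseteq> carrier H \<and> (\<forall>i\<in>I. \<forall>j\<in>I. \<nu> i j \<in> finite_probs T) \<and>
        (\<forall>(x, u, h)\<in>P. \<forall>i\<in>I. \<forall>j\<in>I. \<nu> i (\<phi> (inv\<^bsub>\<Gamma>\<^esub> h) j) = \<nu> i j) \<and>
        (\<forall>\<gamma>\<in>Q. \<forall>i\<in>I. \<forall>j\<in>I. \<forall>U. finite U \<longrightarrow> U \<subseteq> carrier H \<longrightarrow>
          (\<Sum>t\<in>U. \<bar>\<nu> i j (inv \<gamma> \<otimes> t) - \<nu> (\<phi> (a \<gamma>) i) (\<phi> (b \<gamma>) j) t\<bar>) \<le> \<epsilon>)"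
  shows "amenable_action H (quotient_algebra (function_algebra X
      (almost_invariant X W ((\<lambda>(x, u, h). transl x u h) ` P))) (vanishing X W)) (quotient_action \<alpha>)"
proof -
  interpret H: group H by fact
  have ab: "a \<gamma> \<in> carrier \<Gamma>" "b \<gamma> \<in> carrier \<Gamma>" if "\<gamma> \<in> carrier H" for \<gamma>
    using a b that by (auto simp: hom_def)
  interpret a: group_hom H \<Gamma> a using a by (intro group_hom.intro group_hom_axioms.intro H \<Gamma>.is_group)
  interpret b: group_hom H \<Gamma> b using b by (intro group_hom.intro group_hom_axioms.intro H \<Gamma>.is_group)
  have \<rho>_proper: "\<exists>C'. \<forall>z\<in>X. W (\<rho> k m z) \<le> C \<longrightarrow> W z \<le> C'"
    if "k \<in> carrier \<Gamma>" "m \<in> carrier \<Gamma>" for k m C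
  proof (rule W_proper[OF act_const_nonneg])
    fix y g assume "(y, g) \<in> X"
    from W_\<rho>[OF that this] show "\<bar>W (\<rho> k m (y, g)) - W (y, g)\<bar> \<le> act_const k m * (real (length y) + 1)"
      using act_const_nonneg[of k m] by (simp add: algebra_simps)
  qed
  interpret bs: boundary_setting X W "(\<lambda>(x, u, h). transl x u h) ` P"
  proof
    fix \<tau> C assume "\<tau> \<in> (\<lambda>(x, u, h). transl x u h) ` P"
    then obtain x u h where \<tau>: "\<tau> = transl x u h" "x \<in> words" "u \<in> words" "h \<in> carrier \<Gamma>"
      using P_sub by auto
    show "\<tau> \<in> X \<rightarrow> X" unfolding \<tau>(1) by (rule transl_closed[OF \<tau>(2-4)])
    show "\<exists>C'. \<forall>z\<in>X. W (\<tau> z) \<le> C \<longrightarrow> W z \<le> C'"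
      unfolding \<tau>(1) using W_transl[OF \<tau>(2-4)] W_proper by metis
  qed
  show ?thesis
  proof (rule bs.amenable_boundary[where \<rho> = "\<lambda>\<gamma>. \<rho> (a \<gamma>) (b \<gamma>)"])
    show "\<rho> (a \<gamma>) (b \<gamma>) \<in> X \<rightarrow> X" if "\<gamma> \<in> carrier H" for \<gamma>
      by (rule \<rho>_closed[OF ab[OF that]])
    show "\<rho> (a (inv \<gamma>)) (b (inv \<gamma>)) (\<rho> (a \<gamma>) (b \<gamma>) z) = z" if "\<gamma> \<in> carrier H" "z \<in> X" for \<gamma> z
      using \<rho>_inverse[OF ab[OF that(1)] that(2)] that(1) by simp
    show "\<exists>C'. \<forall>z\<in>X. W (\<rho> (a \<gamma>) (b \<gamma>) z) \<le> C \<longrightarrow> W z \<le> C'" if "\<gamma> \<in> carrier H" for \<gamma> C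
      by (rule \<rho>_proper[OF ab[OF that]])
    show "\<exists>\<tau>'\<in>(\<lambda>(x, u, h). transl x u h) ` P. \<forall>z\<in>X. \<rho> (a \<gamma>) (b \<gamma>) (\<tau> z) = \<tau>' (\<rho> (a \<gamma>) (b \<gamma>) z)"
      if \<gamma>: "\<gamma> \<in> carrier H" and \<tau>: "\<tau> \<in> (\<lambda>(x, u, h). transl x u h) ` P" for \<gamma> \<tau>
    proof -
      obtain x u h where xuh: "(x, u, h) \<in> P" "\<tau> = transl x u h" using \<tau> by auto
      then have *: "x \<in> words" "u \<in> words" "h \<in> carrier \<Gamma>" using P_sub by auto
      show ?thesis
        using P_conj[OF \<gamma> xuh(1)] \<rho>_transl[OF ab[OF \<gamma>] *] unfolding xuh(2) by (intro bexI[rotated] imageI) auto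
    qed
    show "\<exists>M T. finite T \<and> T \<subseteq> carrier H \<and> (\<forall>t\<in>T. \<forall>z\<in>X. 0 \<le> M t z) \<and>
        (\<forall>t\<in>carrier H - T. \<forall>z\<in>X. M t z = 0) \<and>
        (\<forall>t\<in>T. (\<lambda>z\<in>X. complex_of_real (M t z)) \<in> bs.S) \<and>
        (\<exists>C. \<forall>z\<in>X. W z > C \<longrightarrow> (\<Sum>t\<in>T. M t z) = 1) \<and>
        (\<forall>\<gamma>\<in>Q. \<exists>C. \<forall>z\<in>X. W z > C \<longrightarrow> (\<forall>U. finite U \<longrightarrow> U \<subseteq> carrier H \<longrightarrow>
           (\<Sum>t\<in>U. \<bar>M (inv \<gamma> \<otimes> t) z - M t (\<rho> (a \<gamma>) (b \<gamma>) z)\<bar>) \<le> \<epsilon>))"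
      if Q: "finite Q" "Q \<subseteq> carrier H" and "\<epsilon> > 0" for Q \<epsilon>
    proof -
      obtain \<nu> T where \<nu>_P: "\<forall>(x, u, h)\<in>P. \<forall>i\<in>I. \<forall>j\<in>I. \<nu> i (\<phi> (inv\<^bsub>\<Gamma>\<^esub> h) j) = \<nu> i j"
        and T: "finite T" "T \<subseteq> carrier H"
        and \<nu>_T: "\<forall>i\<in>I. \<forall>j\<in>I. \<nu> i j \<in> finite_probs T"
        and \<nu>_Q: "\<forall>\<gamma>\<in>Q. \<forall>i\<in>I. \<forall>j\<in>I. \<forall>U. finite U \<longrightarrow> U \<subseteq> carrier H \<longrightarrow>
          (\<Sum>t\<in>U. \<bar>\<nu> i j (inv \<gamma> \<otimes> t) - \<nu> (\<phi> (a \<gamma>) i) (\<phi> (b \<gamma>) j) t\<bar>) \<le> \<epsilon> / 2"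
        using ex[OF Q half_gt_zero[OF \<open>\<epsilon> > 0\<close>]] by (elim exE conjE) (rule that)
      have \<nu>: "\<nu> i j \<in> finite_probs T" if "i \<in> I" "j \<in> I" for i j
        using \<nu>_T that by blast
      define p where "p t i j = \<nu> i j t" for t i j
      have p: "0 \<le> p t i j \<and> p t i j \<le> 1" if "i \<in> I" "j \<in> I" for t i j
        using finite_probs_bounds[OF \<nu>[OF that] T(1)] by (simp add: p_def)
      have sum_p: "(\<Sum>t\<in>U. p t i j) \<le> 1" if "finite U" "i \<in> I" "j \<in> I" for U i j
        using sum_finite_probs_le[OF \<nu>[OF that(2,3)] T(1) that(1)] by (simp add: p_def)
      define M where "M t z = N (p t) z / W z" for t z
      have N_p: "0 \<le> N (p t) z" "N (p t) z \<le> W z" if "z \<in> X" for t z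
        using N_nonneg[OF that, of "p t"] N_le_W[OF that, of "p t"] p by auto
      have sum_N_p: "(\<Sum>t\<in>U. N (p t) z) \<le> W z" if "finite U" "z \<in> X" for U z
        unfolding sum_N by (rule N_le_W[OF that(2)]) (use p sum_p[OF that(1)] in \<open>auto intro!: sum_nonneg\<close>)
      have M_bounds: "0 \<le> M t z" "M t z \<le> 1" if "z \<in> X" for t z
        using N_p[OF that, of t] W_nonneg[of z] by (auto simp: M_def divide_le_eq_1)
      have "M t z = 0" if "t \<in> carrier H - T" "z \<in> X" for t z
      proof -
        have "N (p t) z = N (\<lambda>_ _. 0) z"
          by (rule N_cong[OF that(2)]) (use \<nu> that(1) in \<open>auto simp: p_def finite_probs_def\<close>)
        also have "\<dots> = 0" by (cases z) (simp add: N_def letter_sum_const case_prod_unfold)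
        finally show ?thesis by (simp add: M_def)
      qed
      moreover have "(\<Sum>t\<in>T. M t z) = 1" if "z \<in> X" "W z > 0" for z
      proof -
        have "(\<Sum>t\<in>T. N (p t) z) = W z"
          unfolding sum_N by (rule N_cong[OF that(1)]) (use \<nu> in \<open>auto simp: p_def finite_probs_def\<close>)
        then show ?thesis using that(2) by (simp add: M_def flip: sum_divide_distrib)
      qed
      moreover have "(\<lambda>z\<in>X. complex_of_real (M t z)) \<in> bs.S" for t
      proof -
        have bdd: "(\<lambda>z\<in>X. complex_of_real (M t z)) \<in> bounded_functions X"
          by (rule bounded_functionsI[of _ _ 1]) (use M_bounds in auto)
        have "(\<lambda>z\<in>X. (\<lambda>z\<in>X. complex_of_real (M t z)) (transl x u h z) - (\<lambda>z\<in>X. complex_of_real (M t z)) z)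
            \<in> vanishing X W" if xuh: "(x, u, h) \<in> P" for x u h
        proof -
          have *: "x \<in> words" "u \<in> words" "h \<in> carrier \<Gamma>" using P_sub xuh by auto
          have cl: "transl x u h z \<in> X" if "z \<in> X" for z using transl_closed[OF *] that by auto
          have pm: "p t i (\<phi> (inv\<^bsub>\<Gamma>\<^esub> h) j) = p t i j" if "i \<in> I" "j \<in> I" for i j
            using bspec[OF \<nu>_P xuh] that by (simp add: p_def)
          obtain C where C: "0 \<le> C" "\<And>y g. (y, g) \<in> X \<Longrightarrow>
              \<bar>N (p t) (transl x u h (y, g)) - N (p t) (y, g)\<bar> \<le> C * (real (length y) + 1)"
            using N_transl[OF *, of "p t", OF p pm] by metis
          obtain C' where C': "0 \<le> C'" "\<And>y g. (y, g) \<in> X \<Longrightarrow>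
              \<bar>W (transl x u h (y, g)) - W (y, g)\<bar> \<le> C' * (real (length y) + 1)"
            using W_transl[OF *] by metis
          have "\<exists>K. \<forall>z\<in>X. \<bar>M t (transl x u h z) - M t z\<bar> > e \<longrightarrow> W z \<le> K" if e: "e > 0" for e
          proof -
            obtain K where K: "K > 0" "\<And>y g. W (y, g) > K \<Longrightarrow> (C + C') * (real (length y) + 1) \<le> e * W (y, g)"
              using length_slow[of "C + C'" e] C(1) C'(1) e by (metis add_nonneg_nonneg)
            have "\<bar>M t (transl x u h (y, g)) - M t (y, g)\<bar> \<le> e" if yg: "(y, g) \<in> X" "W (y, g) > K" for y g
            proof -
              let ?z = "(y, g)" and ?z' = "transl x u h (y, g)"
              have "\<bar>M t ?z - M t ?z'\<bar> \<le> (\<bar>N (p t) ?z - N (p t) ?z'\<bar> + \<bar>W ?z - W ?z'\<bar>) / W ?z"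
                using normalize_diff[of "{()}" "W ?z" "W ?z'" "\<lambda>_. N (p t) ?z'" "\<lambda>_. N (p t) ?z"]
                  N_p[OF cl[OF yg(1)], of t] yg(2) K(1) W_nonneg[of ?z'] by (simp add: M_def)
              also have "\<dots> \<le> ((C + C') * (real (length y) + 1)) / W ?z"
                using C(2)[OF yg(1)] C'(2)[OF yg(1)] yg(2) K(1)
                by (intro divide_right_mono) (auto simp: algebra_simps abs_minus_commute)
              also have "\<dots> \<le> e" using K(2)[OF yg(2)] yg(2) K(1) by (simp add: divide_le_eq)
              finally show ?thesis by (simp add: abs_minus_commute)
            qed
            then show ?thesis by (intro exI[of _ K]) force
          qed
          moreover have "(\<lambda>z\<in>X. (\<lambda>z\<in>X. complex_of_real (M t z)) (transl x u h z) - (\<lambda>z\<in>X. complex_of_real (M t z)) z)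
              = (\<lambda>z\<in>X. complex_of_real (M t (transl x u h z) - M t z))"
            using cl by (intro restrict_ext) simp
          moreover have "(\<lambda>z\<in>X. complex_of_real (M t (transl x u h z) - M t z)) \<in> bounded_functions X"
            by (rule bounded_functionsI[of _ _ 1])
              (use M_bounds cl in \<open>auto simp: abs_le_iff simp del: of_real_diff, smt+\<close>)
          ultimately show ?thesis
            by (simp add: vanishing_def del: of_real_diff)
        qed
        with bdd show ?thesis by (auto simp: almost_invariant_def)
      qed
      moreover have "\<exists>C. \<forall>z\<in>X. W z > C \<longrightarrow> (\<forall>U. finite U \<longrightarrow> U \<subseteq> carrier H \<longrightarrow>
           (\<Sum>t\<in>U. \<bar>M (inv \<gamma> \<otimes> t) z - M t (\<rho> (a \<gamma>) (b \<gamma>) z)\<bar>) \<le> \<epsilon>)" if \<gamma>: "\<gamma> \<in> Q" for \<gamma>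
      proof -
        have \<gamma>H: "\<gamma> \<in> carrier H" using \<gamma> Q by auto
        note km = ab[OF \<gamma>H]
        let ?c = "act_const (a \<gamma>) (b \<gamma>)"
        obtain K where K: "K > 0" "\<And>y g. W (y, g) > K \<Longrightarrow> (2 * ?c) * (real (length y) + 1) \<le> \<epsilon> / 2 * W (y, g)"
          using length_slow[of "2 * ?c" "\<epsilon> / 2"] act_const_nonneg[of "a \<gamma>" "b \<gamma>"] \<open>\<epsilon> > 0\<close>
          by (metis half_gt_zero mult_nonneg_nonneg zero_le_numeral)
        have "(\<Sum>t\<in>U. \<bar>M (inv \<gamma> \<otimes> t) (y, g) - M t (\<rho> (a \<gamma>) (b \<gamma>) (y, g))\<bar>) \<le> \<epsilon>"
          if yg: "(y, g) \<in> X" "W (y, g) > K" and U: "finite U" "U \<subseteq> carrier H" for y g U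
        proof -
          let ?z = "(y, g)" and ?z' = "\<rho> (a \<gamma>) (b \<gamma>) (y, g)"
          have z': "?z' \<in> X" using \<rho>_closed[OF km] yg(1) by auto
          have 1: "(\<Sum>t\<in>U. \<bar>N (p (inv \<gamma> \<otimes> t)) ?z - N (p t) ?z'\<bar>) \<le> \<epsilon> / 2 * W ?z + ?c * length y"
            using sum_N_\<rho>[OF km yg(1), where U = U and p = "\<lambda>t. p (inv \<gamma> \<otimes> t)" and p' = p and \<epsilon> = "\<epsilon> / 2"] bspec[OF \<nu>_Q \<gamma>] U p sum_p[OF U(1)]
            by (simp add: p_def)
          have "(\<Sum>t\<in>U. \<bar>M (inv \<gamma> \<otimes> t) ?z - M t ?z'\<bar>) \<le>
              ((\<Sum>t\<in>U. \<bar>N (p (inv \<gamma> \<otimes> t)) ?z - N (p t) ?z'\<bar>) + \<bar>W ?z - W ?z'\<bar>) / W ?z"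
            unfolding M_def
            using U(1) yg(2) K(1) W_nonneg N_p[OF z'] sum_N_p[OF U(1) z'] by (intro normalize_diff) auto
          also have "\<dots> \<le> (\<epsilon> / 2 * W ?z + (2 * ?c) * (real (length y) + 1)) / W ?z"
            using 1 W_\<rho>[OF km yg(1)] yg(2) K(1) act_const_nonneg[of "a \<gamma>" "b \<gamma>"]
            by (intro divide_right_mono) (auto simp: algebra_simps abs_minus_commute)
          also have "\<dots> \<le> (\<epsilon> / 2 * W ?z + \<epsilon> / 2 * W ?z) / W ?z"
            using K(2)[OF yg(2)] yg(2) K(1) by (intro divide_right_mono add_left_mono) auto
          also have "\<dots> = \<epsilon>" using yg(2) K(1) by (simp add: field_simps)
          finally show ?thesis .
        qed
        then show ?thesis by (intro exI[of _ K]) auto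
      qed
      ultimately show ?thesis
        using T M_bounds by (intro exI[of _ M] exI[of _ T]) blast
    qed
  qed (use H \<alpha> in auto)
qed

lemma small_set_W:
  assumes E: "finite E" and F: "finite F" "F \<subseteq> I"
  shows "\<exists>C. \<forall>z\<in>small_set \<Gamma> \<Delta> I \<phi> E F n. W z \<le> C"
proof -
  define cE where "cE = (\<Sum>d\<in>E. real (LD d))"
  define cF where "cF = (\<Sum>i\<in>F. real (l i))"
  have cE: "real (LD d) \<le> cE" if "d \<in> E" for d
    unfolding cE_def using E that by (intro member_le_sum) auto
  have cF: "real (l i) \<le> cF" if "i \<in> F" for i
    unfolding cF_def using F that by (intro member_le_sum) auto
  have c0: "0 \<le> cE" "0 \<le> cF" by (auto simp: cE_def cF_def intro: sum_nonneg)
  have "W (y, g) \<le> real n * (cE + cF + n)" if yg: "(y, g) \<in> small_set \<Gamma> \<Delta> I \<phi> E F n" for y g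
  proof (cases "y = []")
    case True
    then show ?thesis using c0 by (simp add: N_def)
  next
    case False
    have X: "(y, g) \<in> X" and y: "length y \<le> n" "snd ` set y \<subseteq> E" "supp y \<subseteq> F \<union> \<phi> g ` F"
      using yg False by (auto simp: small_set_def)
    have yw: "y \<in> words" and g: "g \<in> carrier \<Gamma>" using X by (auto simp: X_eq)
    have "W (y, g) = letter_sum (\<lambda>a. weight g a + length y) y"
      by (simp add: N_def case_prod_unfold)
    also have "\<dots> \<le> letter_sum (\<lambda>_. cE + cF + n) y"
    proof (rule letter_sum_mono)
      fix a assume a: "a \<in> set y"
      obtain i d where [simp]: "a = (i, d)" by (cases a)
      have "d \<in> E" using y(2) a by force
      have "i \<in> F \<union> \<phi> g ` F" using y(3) a by (force simp: supp_def)
      then have "real (min (l i) (l (\<phi> (inv\<^bsub>\<Gamma>\<^esub> g) i))) \<le> cF"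
      proof
        assume "i \<in> F"
        with cF[of i] show ?thesis by (simp add: of_nat_min min.coboundedI1)
      next
        assume "i \<in> \<phi> g ` F"
        then obtain j where j: "j \<in> F" "\<phi> g j = i" by blast
        then have "\<phi> (inv\<^bsub>\<Gamma>\<^esub> g) i = j" using act.orbit_sym_aux[OF g] F(2) by blast
        with cF[OF j(1)] show ?thesis by (simp add: of_nat_min min.coboundedI2)
      qed
      then show "weight g a + length y \<le> cE + cF + n"
        using cE[OF \<open>d \<in> E\<close>] y(1) by (simp add: weight_def)
    qed
    also have "\<dots> \<le> real n * (cE + cF + n)"
      unfolding letter_sum_const using y(1) c0 by (intro mult_right_mono) auto
    finally show ?thesis .
  qed
  then show ?thesis by (intro exI[of _ "real n * (cE + cF + n)"]) auto
qed

lemma bounded_W_small_set: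
  obtains E F n where "finite E" "E \<subseteq> carrier \<Delta>" "finite F" "F \<subseteq> I"
    "{z \<in> X. W z \<le> C} \<subseteq> small_set \<Gamma> \<Delta> I \<phi> E F n"
proof -
  define m where "m = nat \<lceil>C\<rceil>"
  have m: "C \<le> m" by (simp add: m_def real_nat_ceiling_ge)
  let ?E = "{d \<in> carrier \<Delta>. LD d \<le> m}" and ?F = "{i \<in> I. l i \<le> m}"
  have "(y, g) \<in> small_set \<Gamma> \<Delta> I \<phi> ?E ?F m" if yg: "(y, g) \<in> X" "W (y, g) \<le> C" for y g
  proof -
    have y: "y \<in> words" and g: "g \<in> carrier \<Gamma>" using yg(1) by (auto simp: X_eq)
    have *: "length y \<le> m \<and> LD d \<le> m \<and> (l i \<le> m \<or> l (\<phi> (inv\<^bsub>\<Gamma>\<^esub> g) i) \<le> m)"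
      if a: "(i, d) \<in> set y" for i d
    proof -
      have "weight g (i, d) + length y \<le> letter_sum (\<lambda>a. weight g a + length y) y"
        by (rule letter_le_letter_sum[OF _ a]) (simp add: weight_nonneg)
      also have "\<dots> = W (y, g)" by (simp add: N_def case_prod_unfold)
      finally have "weight g (i, d) + length y \<le> m" using yg(2) m by simp
      then have "LD d + min (l i) (l (\<phi> (inv\<^bsub>\<Gamma>\<^esub> g) i)) + length y \<le> m"
        unfolding weight_def prod.case by (simp flip: of_nat_add of_nat_min)
      then show ?thesis by linarith
    qed
    have "i \<in> ?F \<union> \<phi> g ` ?F" if a: "(i, d) \<in> set y" for i d
    proof -
      have i: "i \<in> I" by (rule reduced_letter(1)[OF y a])
      have "i = \<phi> g (\<phi> (inv\<^bsub>\<Gamma>\<^esub> g) i)"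
        using act.orbit_sym_aux[of "inv\<^bsub>\<Gamma>\<^esub> g" i] g i by simp
      then show ?thesis using *[OF a] i inv_act[OF g i] by blast
    qed
    then have "supp y \<subseteq> ?F \<union> \<phi> g ` ?F" unfolding supp_def by fastforce
    moreover have "snd ` set y \<subseteq> ?E" using * reduced_letter(2)[OF y] by auto
    moreover have "y = [] \<or> length y \<le> m" using * by (cases y) auto
    ultimately show ?thesis using yg(1) by (auto simp: small_set_def)
  qed
  then show ?thesis
    using LD_finite[of m] l_finite[of m] by (intro that[of ?E ?F m]) auto
qed

lemma G_free_iff: "A \<in> G_free \<Gamma> \<Delta> I \<phi> \<longleftrightarrow> A \<subseteq> X \<and> (\<exists>C. \<forall>z\<in>A. W z \<le> C)"
proof
  assume "A \<in> G_free \<Gamma> \<Delta> I \<phi>"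
  then obtain E F n where A: "finite E" "finite F" "F \<subseteq> I" "A \<subseteq> small_set \<Gamma> \<Delta> I \<phi> E F n"
    by (auto simp: G_free_def)
  then have "A \<subseteq> X" by (auto simp: small_set_def)
  then show "A \<subseteq> X \<and> (\<exists>C. \<forall>z\<in>A. W z \<le> C)" using small_set_W[OF A(1-3)] A(4) by blast
next
  assume "A \<subseteq> X \<and> (\<exists>C. \<forall>z\<in>A. W z \<le> C)"
  then obtain C where "A \<subseteq> {z \<in> X. W z \<le> C}" by blast
  moreover obtain E F n where *: "finite E" "E \<subseteq> carrier \<Delta>" "finite F" "F \<subseteq> I"
    "{z \<in> X. W z \<le> C} \<subseteq> small_set \<Gamma> \<Delta> I \<phi> E F n"
    by (rule bounded_W_small_set)
  ultimately have "A \<subseteq> small_set \<Gamma> \<Delta> I \<phi> E F n" by blast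
  with * show "A \<in> G_free \<Gamma> \<Delta> I \<phi>" unfolding G_free_def by blast
qed

lemma c0_free_eq: "c0_free \<Gamma> \<Delta> I \<phi> = vanishing X W"
proof -
  have *: "({z \<in> X. R z} \<subseteq> X \<and> (\<exists>C. \<forall>z\<in>{z \<in> X. R z}. W z \<le> C)) \<longleftrightarrow> (\<exists>C. \<forall>z\<in>X. R z \<longrightarrow> W z \<le> C)" for R
    by blast
  show ?thesis unfolding c0_free_def vanishing_def G_free_iff * ..
qed

lemma mult_eq:
  "(y, g) \<otimes>\<^bsub>free_wreath \<Gamma> \<Delta> I \<phi>\<^esub> (y', h) = (word_mult \<Delta> y (shift \<phi> g y'), g \<otimes>\<^bsub>\<Gamma>\<^esub> h)"
  by (simp add: free_wreath_def semidirect_product_def free_product_def)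

lemma mult_eq_transl:
  assumes "x \<in> words" "u \<in> words" "h \<in> carrier \<Gamma>" "z \<in> X"
  shows "emb_free \<Gamma> x \<otimes>\<^bsub>free_wreath \<Gamma> \<Delta> I \<phi>\<^esub> z \<otimes>\<^bsub>free_wreath \<Gamma> \<Delta> I \<phi>\<^esub> (u, h) = transl x u h z"
    "emb_free \<Gamma> x \<otimes>\<^bsub>free_wreath \<Gamma> \<Delta> I \<phi>\<^esub> z = transl x [] \<one>\<^bsub>\<Gamma>\<^esub> z"
    "z \<otimes>\<^bsub>free_wreath \<Gamma> \<Delta> I \<phi>\<^esub> emb_free \<Gamma> u = transl [] u \<one>\<^bsub>\<Gamma>\<^esub> z"
proof -
  obtain y g where z: "z = (y, g)" "y \<in> words" "g \<in> carrier \<Gamma>"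
    using assms(4) by (auto simp: X_eq)
  show "emb_free \<Gamma> x \<otimes>\<^bsub>free_wreath \<Gamma> \<Delta> I \<phi>\<^esub> z \<otimes>\<^bsub>free_wreath \<Gamma> \<Delta> I \<phi>\<^esub> (u, h) = transl x u h z"
    using assms z by (simp add: mult_eq transl_def act.shift_one)
  have "word_mult \<Delta> (word_mult \<Delta> x y) [] = word_mult \<Delta> x y"
    using assms z by (intro word_mult_Nil \<Delta>.word_mult_reduced)
  then show "emb_free \<Gamma> x \<otimes>\<^bsub>free_wreath \<Gamma> \<Delta> I \<phi>\<^esub> z = transl x [] \<one>\<^bsub>\<Gamma>\<^esub> z"
    using assms z by (simp add: mult_eq transl_def act.shift_one)
  show "z \<otimes>\<^bsub>free_wreath \<Gamma> \<Delta> I \<phi>\<^esub> emb_free \<Gamma> u = transl [] u \<one>\<^bsub>\<Gamma>\<^esub> z"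
    using assms z by (simp add: mult_eq transl_def)
qed

lemma C_closure_eq: "C_closure \<Gamma> \<Delta> I \<phi> =
    almost_invariant X W ((\<lambda>(x, u, h). transl x u h) ` (words \<times> words \<times> carrier \<Gamma>))"
proof -
  have "(\<lambda>z\<in>X. f (emb_free \<Gamma> x \<otimes>\<^bsub>free_wreath \<Gamma> \<Delta> I \<phi>\<^esub> z \<otimes>\<^bsub>free_wreath \<Gamma> \<Delta> I \<phi>\<^esub> (u, h)) - f z) =
      (\<lambda>z\<in>X. f (transl x u h z) - f z)"
    if "x \<in> words" "u \<in> words" "h \<in> carrier \<Gamma>" for f :: "_ \<Rightarrow> complex" and x u h
    using mult_eq_transl(1)[OF that] by (intro restrict_ext) simp
  then show ?thesis
    unfolding C_closure_def Let_def almost_invariant_def c0_free_eq X_eq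
    by (intro Collect_cong conj_cong refl) (auto simp: free_product_def)
qed

lemma linf_closure_eq: "linf_closure \<Gamma> \<Delta> I \<phi> = almost_invariant X W ((\<lambda>(x, u, h). transl x u h) `
    {(x, u, h). x \<in> words \<and> u \<in> words \<and> h = \<one>\<^bsub>\<Gamma>\<^esub> \<and> (x = [] \<or> u = [])})"
proof -
  have minus: "(\<lambda>z\<in>X. f z - f (\<tau> z)) \<in> vanishing X W \<longleftrightarrow> (\<lambda>z\<in>X. f (\<tau> z) - f z) \<in> vanishing X W"
    for f :: "_ \<Rightarrow> complex" and \<tau>
  proof
    assume "(\<lambda>z\<in>X. f z - f (\<tau> z)) \<in> vanishing X W"
    then show "(\<lambda>z\<in>X. f (\<tau> z) - f z) \<in> vanishing X W"
      by (rule vanishing_dominated[of _ _ _ _ 1]) (auto simp: norm_minus_commute)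
  next
    assume "(\<lambda>z\<in>X. f (\<tau> z) - f z) \<in> vanishing X W"
    then show "(\<lambda>z\<in>X. f z - f (\<tau> z)) \<in> vanishing X W"
      by (rule vanishing_dominated[of _ _ _ _ 1]) (auto simp: norm_minus_commute)
  qed
  have left: "(\<lambda>z\<in>X. f z - f (emb_free \<Gamma> s \<otimes>\<^bsub>free_wreath \<Gamma> \<Delta> I \<phi>\<^esub> z)) =
      (\<lambda>z\<in>X. f z - f (transl s [] \<one>\<^bsub>\<Gamma>\<^esub> z))"
    and right: "(\<lambda>z\<in>X. f z - f (z \<otimes>\<^bsub>free_wreath \<Gamma> \<Delta> I \<phi>\<^esub> emb_free \<Gamma> s)) =
      (\<lambda>z\<in>X. f z - f (transl [] s \<one>\<^bsub>\<Gamma>\<^esub> z))"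
    if "s \<in> words" for f :: "_ \<Rightarrow> complex" and s
    using mult_eq_transl(2,3)[OF that that \<Gamma>.one_closed] by (auto intro!: restrict_ext)
  have car: "carrier (free_product \<Delta> I) = words" by (simp add: free_product_def)
  have "(\<forall>s\<in>words. (\<lambda>z\<in>X. f z - f (emb_free \<Gamma> s \<otimes>\<^bsub>free_wreath \<Gamma> \<Delta> I \<phi>\<^esub> z)) \<in> vanishing X W \<and>
        (\<lambda>z\<in>X. f z - f (z \<otimes>\<^bsub>free_wreath \<Gamma> \<Delta> I \<phi>\<^esub> emb_free \<Gamma> s)) \<in> vanishing X W) \<longleftrightarrow>
      (\<forall>s\<in>words. (\<lambda>z\<in>X. f (transl s [] \<one>\<^bsub>\<Gamma>\<^esub> z) - f z) \<in> vanishing X W \<and>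
        (\<lambda>z\<in>X. f (transl [] s \<one>\<^bsub>\<Gamma>\<^esub> z) - f z) \<in> vanishing X W)" for f :: "_ \<Rightarrow> complex"
    by (intro ball_cong refl) (simp only: left right minus)
  moreover have "(\<forall>\<tau>\<in>(\<lambda>(x, u, h). transl x u h) `
      {(x, u, h). x \<in> words \<and> u \<in> words \<and> h = \<one>\<^bsub>\<Gamma>\<^esub> \<and> (x = [] \<or> u = [])}. R \<tau>) \<longleftrightarrow>
      (\<forall>s\<in>words. R (transl s [] \<one>\<^bsub>\<Gamma>\<^esub>) \<and> R (transl [] s \<one>\<^bsub>\<Gamma>\<^esub>))" for R
    by auto
  ultimately show ?thesis
    unfolding linf_closure_def Let_def almost_invariant_def c0_free_eq car by (simp only:)
qed

lemma left_translation_eq: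
  assumes "k \<in> carrier \<Gamma>"
  shows "left_translation \<Gamma> \<Delta> I \<phi> (inv\<^bsub>\<Gamma>\<^esub> k) f = (\<lambda>z\<in>X. f (\<rho> k \<one>\<^bsub>\<Gamma>\<^esub> z))"
  unfolding left_translation_def Let_def
  by (rule restrict_ext) (use assms in \<open>auto simp: X_eq mult_eq \<rho>_def\<close>)

lemma left_right_translation_eq:
  assumes "k \<in> carrier \<Gamma>" "m \<in> carrier \<Gamma>"
  shows "left_right_translation \<Gamma> \<Delta> I \<phi> (inv\<^bsub>\<Gamma>\<^esub> k, inv\<^bsub>\<Gamma>\<^esub> m) f = (\<lambda>z\<in>X. f (\<rho> k m z))"
  unfolding left_right_translation_def Let_def prod.case
  by (intro restrict_ext)
    (use assms in \<open>auto simp: X_eq mult_eq \<rho>_def word_mult_Nil[where I = I] act.shift_reduced\<close>)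

end

lemma finite_probs_product:
  assumes "p \<in> finite_probs T" "q \<in> finite_probs T'"
  shows "(\<lambda>(s, t). p s * q t) \<in> finite_probs (T \<times> T')"
  using assms by (auto simp: finite_probs_def simp flip: sum.cartesian_product sum_product)

lemma sum_product_diff_le:
  fixes p p' :: "'s \<Rightarrow> real" and q q' :: "'t \<Rightarrow> real"
  assumes "finite U" "finite V"
    and "\<And>s. s \<in> U \<Longrightarrow> 0 \<le> p' s" "sum p' U \<le> 1" "\<And>t. t \<in> V \<Longrightarrow> 0 \<le> q t" "sum q V \<le> 1"
    and "(\<Sum>s\<in>U. \<bar>p s - p' s\<bar>) \<le> \<epsilon>" "(\<Sum>t\<in>V. \<bar>q t - q' t\<bar>) \<le> \<epsilon>"
  shows "(\<Sum>(s, t)\<in>U \<times> V. \<bar>p s * q t - p' s * q' t\<bar>) \<le> 2 * \<epsilon>"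
proof -
  have \<epsilon>: "0 \<le> \<epsilon>" using assms(7) by (meson order_trans sum_nonneg abs_ge_zero)
  have "(\<Sum>(s, t)\<in>U \<times> V. \<bar>p s * q t - p' s * q' t\<bar>) \<le>
      (\<Sum>(s, t)\<in>U \<times> V. \<bar>p s - p' s\<bar> * q t + p' s * \<bar>q t - q' t\<bar>)"
  proof (rule sum_mono, clarify)
    fix s t assume "s \<in> U" "t \<in> V"
    have "p s * q t - p' s * q' t = (p s - p' s) * q t + p' s * (q t - q' t)"
      by (simp add: algebra_simps)
    also have "\<bar>\<dots>\<bar> \<le> \<bar>(p s - p' s) * q t\<bar> + \<bar>p' s * (q t - q' t)\<bar>"
      by (rule abs_triangle_ineq)
    also have "\<dots> = \<bar>p s - p' s\<bar> * q t + p' s * \<bar>q t - q' t\<bar>"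
      using assms(3)[OF \<open>s \<in> U\<close>] assms(5)[OF \<open>t \<in> V\<close>] by (simp add: abs_mult)
    finally show "\<bar>p s * q t - p' s * q' t\<bar> \<le> \<bar>p s - p' s\<bar> * q t + p' s * \<bar>q t - q' t\<bar>" .
  qed
  also have "\<dots> = (\<Sum>s\<in>U. \<bar>p s - p' s\<bar>) * sum q V + sum p' U * (\<Sum>t\<in>V. \<bar>q t - q' t\<bar>)"
    by (simp add: sum.distrib sum_product flip: sum.cartesian_product)
  also have "\<dots> \<le> \<epsilon> * 1 + 1 * \<epsilon>"
    using assms \<epsilon> by (intro add_mono mult_mono) (auto intro!: sum_nonneg)
  finally show ?thesis by simp
qed

theorem theorem5p4:
  fixes \<Gamma> :: "('g, 'b) monoid_scheme"
    and \<Delta> :: "('d, 'c) monoid_scheme"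
    and I :: "'i set"
    and \<phi> :: "'g \<Rightarrow> 'i \<Rightarrow> 'i"
  assumes "group \<Gamma>" and "countable (carrier \<Gamma>)"
    and "group \<Delta>" and "countable (carrier \<Delta>)"
    and "countable I" and "group_action \<Gamma> I \<phi>"
    and "exact_group \<Gamma>"
    and "\<forall>i\<in>I. finite (stabilizer \<Gamma> \<phi> i)"
    and "finite (orbits \<Gamma> I \<phi>)"
  shows "amenable_action \<Gamma> (C_boundary \<Gamma> \<Delta> I \<phi>) (quotient_action (left_translation \<Gamma> \<Delta> I \<phi>))
       \<and> biexact_relative_G_free \<Gamma> \<Delta> I \<phi>"
proof -
  interpret \<Gamma>: group \<Gamma> by fact
  interpret \<Delta>: group \<Delta> by fact
  interpret act: group_action \<Gamma> I \<phi> by fact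
  obtain L :: "'g \<Rightarrow> nat" where L: "\<And>n. finite {g \<in> carrier \<Gamma>. L g \<le> n}"
    "\<And>g h. g \<in> carrier \<Gamma> \<Longrightarrow> h \<in> carrier \<Gamma> \<Longrightarrow> L (g \<otimes>\<^bsub>\<Gamma>\<^esub> h) \<le> L g + L h"
    using \<Gamma>.ex_length_function[OF assms(2)] by blast
  obtain LD :: "'d \<Rightarrow> nat" where LD: "\<And>n. finite {g \<in> carrier \<Delta>. LD g \<le> n}"
    "\<And>g h. g \<in> carrier \<Delta> \<Longrightarrow> h \<in> carrier \<Delta> \<Longrightarrow> LD (g \<otimes>\<^bsub>\<Delta>\<^esub> h) \<le> LD g + LD h"
    using \<Delta>.ex_length_function[OF assms(4)] by blast
  obtain l :: "'i \<Rightarrow> nat" where l: "\<And>n. finite {i \<in> I. l i \<le> n}"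
    "\<And>g i. g \<in> carrier \<Gamma> \<Longrightarrow> i \<in> I \<Longrightarrow> l (\<phi> g i) \<le> L g + l i"
    using act.ex_length_function_action[OF assms(5), of L, OF L] by blast
  interpret wreath_lengths \<Gamma> \<Delta> I \<phi> L LD l
    by unfold_locales (use L LD l in auto)
  have \<mu>_ex: "\<exists>\<mu> T. finite T \<and> T \<subseteq> carrier \<Gamma> \<and> (\<forall>i\<in>I. \<mu> i \<in> finite_probs T) \<and>
      almost_equivariant \<Gamma> Q \<epsilon> \<phi> I \<mu>" if "finite Q" "Q \<subseteq> carrier \<Gamma>" "\<epsilon> > 0" for Q \<epsilon>
    using act.exact_group_action_almost_equivariant[OF assms(7,8) that] by metis
  have "amenable_action \<Gamma> (C_boundary \<Gamma> \<Delta> I \<phi>) (quotient_action (left_translation \<Gamma> \<Delta> I \<phi>))"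
    unfolding C_boundary_def C_closure_eq c0_free_eq
  proof (rule amenable_weighted[where a = "\<lambda>g. g" and b = "\<lambda>_. \<one>\<^bsub>\<Gamma>\<^esub>"])
    fix Q and \<epsilon> :: real assume "finite Q" "Q \<subseteq> carrier \<Gamma>" "\<epsilon> > 0"
    then obtain \<mu> T where \<mu>: "finite T" "T \<subseteq> carrier \<Gamma>" "\<forall>i\<in>I. \<mu> i \<in> finite_probs T"
      "almost_equivariant \<Gamma> Q \<epsilon> \<phi> I \<mu>" using \<mu>_ex by metis
    then show "\<exists>\<nu> T. finite T \<and> T \<subseteq> carrier \<Gamma> \<and> (\<forall>i\<in>I. \<forall>j\<in>I. \<nu> i j \<in> finite_probs T) \<and>
        (\<forall>(x, u, h)\<in>words \<times> words \<times> carrier \<Gamma>. \<forall>i\<in>I. \<forall>j\<in>I. \<nu> i (\<phi> (inv\<^bsub>\<Gamma>\<^esub> h) j) = \<nu> i j) \<and>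
        (\<forall>\<gamma>\<in>Q. \<forall>i\<in>I. \<forall>j\<in>I. \<forall>U. finite U \<longrightarrow> U \<subseteq> carrier \<Gamma> \<longrightarrow>
          (\<Sum>t\<in>U. \<bar>\<nu> i j (inv\<^bsub>\<Gamma>\<^esub> \<gamma> \<otimes>\<^bsub>\<Gamma>\<^esub> t) - \<nu> (\<phi> \<gamma> i) (\<phi> \<one>\<^bsub>\<Gamma>\<^esub> j) t\<bar>) \<le> \<epsilon>)"
      by (intro exI[of _ "\<lambda>i j. \<mu> i"] exI[of _ T]) (simp add: almost_equivariant_def)
  qed (use assms left_translation_eq act.shift_reduced in \<open>auto simp: hom_def act.shift_one\<close>)
  moreover have "biexact_relative_G_free \<Gamma> \<Delta> I \<phi>"
    unfolding biexact_relative_G_free_def linf_boundary_def linf_closure_eq c0_free_eq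
  proof (rule amenable_weighted[where a = fst and b = snd])
    show "group (\<Gamma> \<times>\<times> \<Gamma>)" using assms(1) by (intro DirProd_group)
    show "countable (carrier (\<Gamma> \<times>\<times> \<Gamma>))" using assms(2) by (simp add: DirProd_def)
    show "fst \<in> hom (\<Gamma> \<times>\<times> \<Gamma>) \<Gamma>" "snd \<in> hom (\<Gamma> \<times>\<times> \<Gamma>) \<Gamma>" by (auto simp: hom_def DirProd_def)
    show "left_right_translation \<Gamma> \<Delta> I \<phi> (inv\<^bsub>\<Gamma> \<times>\<times> \<Gamma>\<^esub> \<gamma>) f = (\<lambda>z\<in>X. f (\<rho> (fst \<gamma>) (snd \<gamma>) z))"
      if "\<gamma> \<in> carrier (\<Gamma> \<times>\<times> \<Gamma>)" for \<gamma> and f :: "_ \<Rightarrow> complex"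
      using that left_right_translation_eq[of "fst \<gamma>" "snd \<gamma>" f]
      by (cases \<gamma>) (simp add: inv_DirProd[OF assms(1) assms(1)])
    fix Q and \<epsilon> :: real assume Q: "finite Q" "Q \<subseteq> carrier (\<Gamma> \<times>\<times> \<Gamma>)" and "\<epsilon> > 0"
    let ?Q = "fst ` Q \<union> snd ` Q"
    have "finite ?Q" "?Q \<subseteq> carrier \<Gamma>" "\<epsilon> / 2 > 0" using Q \<open>\<epsilon> > 0\<close> by (auto simp: DirProd_def)
    then obtain \<mu> T where T: "finite T" "T \<subseteq> carrier \<Gamma>" and \<mu>: "\<forall>i\<in>I. \<mu> i \<in> finite_probs T"
      and \<mu>_equiv: "almost_equivariant \<Gamma> ?Q (\<epsilon> / 2) \<phi> I \<mu>" using \<mu>_ex by metis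
    define \<nu> where "\<nu> i j = (\<lambda>(s, t). \<mu> i s * \<mu> j t)" for i j
    have "(\<Sum>t\<in>U. \<bar>\<nu> i j (inv\<^bsub>\<Gamma> \<times>\<times> \<Gamma>\<^esub> \<gamma> \<otimes>\<^bsub>\<Gamma> \<times>\<times> \<Gamma>\<^esub> t) - \<nu> (\<phi> (fst \<gamma>) i) (\<phi> (snd \<gamma>) j) t\<bar>) \<le> \<epsilon>"
      if \<gamma>: "\<gamma> \<in> Q" and ij: "i \<in> I" "j \<in> I" and U: "finite U" "U \<subseteq> carrier (\<Gamma> \<times>\<times> \<Gamma>)" for \<gamma> i j U
    proof -
      obtain k m where km: "\<gamma> = (k, m)" "k \<in> carrier \<Gamma>" "m \<in> carrier \<Gamma>" "k \<in> ?Q" "m \<in> ?Q"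
        using \<gamma> Q(2) by (cases \<gamma>) (force simp: DirProd_def)
      let ?U = "fst ` U" and ?V = "snd ` U"
      have UV: "finite ?U" "finite ?V" "?U \<subseteq> carrier \<Gamma>" "?V \<subseteq> carrier \<Gamma>" "U \<subseteq> ?U \<times> ?V"
        using U by (auto simp: DirProd_def intro: rev_image_eqI)
      have \<mu>_le: "0 \<le> \<mu> i t" "finite S \<Longrightarrow> sum (\<mu> i) S \<le> 1" if "i \<in> I" for i t S
        using finite_probs_bounds(1)[OF bspec[OF \<mu> that] T(1)] sum_finite_probs_le[OF bspec[OF \<mu> that] T(1)]
        by auto
      obtain V' where "finite V'" "\<And>f::_ \<Rightarrow> real. (\<Sum>t\<in>?V. f (inv\<^bsub>\<Gamma>\<^esub> m \<otimes>\<^bsub>\<Gamma>\<^esub> t)) = sum f V'"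
        using \<Gamma>.sum_translate[OF \<Gamma>.inv_closed[OF km(3)] UV(2,4)] by metis
      then have sum_m: "(\<Sum>t\<in>?V. \<mu> j (inv\<^bsub>\<Gamma>\<^esub> m \<otimes>\<^bsub>\<Gamma>\<^esub> t)) \<le> 1" using \<mu>_le(2)[OF ij(2)] by simp
      have "(\<Sum>t\<in>U. \<bar>\<nu> i j (inv\<^bsub>\<Gamma> \<times>\<times> \<Gamma>\<^esub> \<gamma> \<otimes>\<^bsub>\<Gamma> \<times>\<times> \<Gamma>\<^esub> t) - \<nu> (\<phi> (fst \<gamma>) i) (\<phi> (snd \<gamma>) j) t\<bar>) =
          (\<Sum>(s, t)\<in>U. \<bar>\<mu> i (inv\<^bsub>\<Gamma>\<^esub> k \<otimes>\<^bsub>\<Gamma>\<^esub> s) * \<mu> j (inv\<^bsub>\<Gamma>\<^esub> m \<otimes>\<^bsub>\<Gamma>\<^esub> t) - \<mu> (\<phi> k i) s * \<mu> (\<phi> m j) t\<bar>)"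
        using km by (intro sum.cong) (auto simp: \<nu>_def inv_DirProd[OF assms(1) assms(1)])
      also have "\<dots> \<le> (\<Sum>(s, t)\<in>?U \<times> ?V.
          \<bar>\<mu> i (inv\<^bsub>\<Gamma>\<^esub> k \<otimes>\<^bsub>\<Gamma>\<^esub> s) * \<mu> j (inv\<^bsub>\<Gamma>\<^esub> m \<otimes>\<^bsub>\<Gamma>\<^esub> t) - \<mu> (\<phi> k i) s * \<mu> (\<phi> m j) t\<bar>)"
        using UV by (intro sum_mono2) auto
      also have "\<dots> \<le> 2 * (\<epsilon> / 2)"
        using \<mu>_equiv km ij UV sum_m \<mu>_le act.action_closed
        by (intro sum_product_diff_le) (auto simp: almost_equivariant_def)
      finally show ?thesis by simp
    qed
    moreover have "\<nu> i j \<in> finite_probs (T \<times> T)" if "i \<in> I" "j \<in> I" for i j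
      unfolding \<nu>_def using \<mu> that by (intro finite_probs_product) auto
    moreover have "\<phi> (inv\<^bsub>\<Gamma>\<^esub> \<one>\<^bsub>\<Gamma>\<^esub>) j = j" if "j \<in> I" for j
      using that by (simp flip: act.id_eq_one)
    ultimately show "\<exists>\<nu> T. finite T \<and> T \<subseteq> carrier (\<Gamma> \<times>\<times> \<Gamma>) \<and> (\<forall>i\<in>I. \<forall>j\<in>I. \<nu> i j \<in> finite_probs T) \<and>
        (\<forall>(x, u, h)\<in>{(x, u, h). x \<in> words \<and> u \<in> words \<and> h = \<one>\<^bsub>\<Gamma>\<^esub> \<and> (x = [] \<or> u = [])}.
          \<forall>i\<in>I. \<forall>j\<in>I. \<nu> i (\<phi> (inv\<^bsub>\<Gamma>\<^esub> h) j) = \<nu> i j) \<and>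
        (\<forall>\<gamma>\<in>Q. \<forall>i\<in>I. \<forall>j\<in>I. \<forall>U. finite U \<longrightarrow> U \<subseteq> carrier (\<Gamma> \<times>\<times> \<Gamma>) \<longrightarrow>
          (\<Sum>t\<in>U. \<bar>\<nu> i j (inv\<^bsub>\<Gamma> \<times>\<times> \<Gamma>\<^esub> \<gamma> \<otimes>\<^bsub>\<Gamma> \<times>\<times> \<Gamma>\<^esub> t) - \<nu> (\<phi> (fst \<gamma>) i) (\<phi> (snd \<gamma>) j) t\<bar>) \<le> \<epsilon>)"
      using T by (intro exI[of _ \<nu>] exI[of _ "T \<times> T"]) (auto simp: DirProd_def)
  qed (use act.shift_reduced in \<open>auto simp: DirProd_def\<close>)
  ultimately show ?thesis ..
qed

end
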